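(* Let $B$ be an Artin group of type $A_n$ ($n\ge1$), $D_n$ ($n\ge4$), $E_6$, $E_7$ or $E_8$. Then for each $k\in\{1,\dots,n\}$ and each $\beta\in\Phi^+$ there is a polynomial $T_{k,\beta}\in\mathbb{Z}[r]$ such that the following holds. Let $V$ be the free $\mathbb{Z}[r^{\pm1},t^{\pm1}]$-module with basis $x_\beta$ $(\beta\in\Phi^+)$; let $\tau_k$ be the linear map on $V$ determined by $$\tau_k(x_\beta)=\begin{cases}0&\text{if }(\alpha_k,\beta)=2,\\ r\,x_{\beta-\alpha_k}&\text{if }(\alpha_k,\beta)=1,\\ x_\beta&\text{if }(\alpha_k,\beta)=0,\\ (1-r^2)\,x_\beta+r\,x_{\beta+\alpha_k}&\text{if }(\alpha_k,\beta)=-1,\end{cases}$$ and let $T_k$ be the linear map on $V$ determined by $T_kx_\beta=T_{k,\beta}\,x_{\alpha_k}$ for all $\beta\in\Phi^+$. Then the map $s_k\mapsto\sigma_k=\tau_k+tT_k$ $(k=1,\dots,n)$ on the generators of $B$ determines a representation of $B$ on $V$. Moreover, if $r$ is specialized to a real number $r_0$ with $0<r_0<1$ in $V\otimes\mathbb{R}$, then the resulting representation of $B$ on the resulting free $\mathbb{R}[t,t^{-1}]$-module $V_1$ with basis $x_\beta$ $(\beta\in\Phi^+)$ is faithful.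
   Context: $B$ is the Artin group of type $M$, where $M$ is the Coxeter matrix of the named type, of rank $n$: the group generated by $s_1,\dots,s_n$ subject to $s_is_js_i\cdots=s_js_is_j\cdots$ (both sides of length $M_{ij}$) for $1\le i<j\le n$. The Coxeter group $W$ of type $M$ is finite, with root system $\Phi\subset\mathbb{R}^n$; all roots have the same length, and the inner product $(\cdot,\cdot)$ is normalized so that $(\alpha,\alpha)=2$ for $\alpha\in\Phi$. The fundamental (simple) roots are $\alpha_1,\dots,\alpha_n$, and $\Phi^+=\Phi\cap\bigoplus_i\mathbb{R}_{\ge0}\alpha_i$ is the set of positive roots. Specializing $r$ to $r_0$ means extending scalars along the ring homomorphism $\mathbb{Z}[r^{\pm1},t^{\pm1}]\to\mathbb{R}[t^{\pm1}]$ with $r\mapsto r_0$, $t\mapsto t$. *)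

theory Defs
  imports
    Complex_Main
    "HOL-Library.Poly_Mapping"
    "HOL-Library.Product_Plus"
    "HOL-Computational_Algebra.Polynomial"
    "HOL-Algebra.Bij"
begin

section \<open>Groups given by generators and relations\<close>

text \<open>A letter \<open>(s, True)\<close> stands for the generator \<open>s\<close> and \<open>(s, False)\<close> for its inverse.\<close>

type_synonym 'g word = "('g \<times> bool) list"

abbreviation words :: "'g set \<Rightarrow> 'g word set" where
  "words S \<equiv> lists (S \<times> UNIV)"

inductive_set pres_rel :: "'g set \<Rightarrow> ('g word \<times> 'g word) set \<Rightarrow> ('g word \<times> 'g word) set"
  for S R where
  refl: "u \<in> words S \<Longrightarrow> (u, u) \<in> pres_rel S R"
| sym: "(u, v) \<in> pres_rel S R \<Longrightarrow> (v, u) \<in> pres_rel S R"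
| trans: "(u, v) \<in> pres_rel S R \<Longrightarrow> (v, w) \<in> pres_rel S R \<Longrightarrow> (u, w) \<in> pres_rel S R"
| append: "(u, v) \<in> pres_rel S R \<Longrightarrow> (u', v') \<in> pres_rel S R \<Longrightarrow> (u @ u', v @ v') \<in> pres_rel S R"
| cancel: "s \<in> S \<Longrightarrow> ([(s, e), (s, \<not> e)], []) \<in> pres_rel S R"
| relator: "(u, v) \<in> R \<Longrightarrow> u \<in> words S \<Longrightarrow> v \<in> words S \<Longrightarrow> (u, v) \<in> pres_rel S R"

definition presented_group :: "'g set \<Rightarrow> ('g word \<times> 'g word) set \<Rightarrow> 'g word set monoid" where
  "presented_group S R =
    \<lparr>carrier = words S // pres_rel S R,
     mult = \<lambda>X Y. \<Union>u\<in>X. \<Union>v\<in>Y. pres_rel S R `` {u @ v},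
     one = pres_rel S R `` {[]}\<rparr>"

definition pres_gen :: "'g set \<Rightarrow> ('g word \<times> 'g word) set \<Rightarrow> 'g \<Rightarrow> 'g word set" where
  "pres_gen S R s = pres_rel S R `` {[(s, True)]}"

lemma pres_rel_words: "(u, v) \<in> pres_rel S R \<Longrightarrow> u \<in> words S \<and> v \<in> words S"
  by (induction rule: pres_rel.induct) auto

lemma equiv_pres_rel: "equiv (words S) (pres_rel S R)"
proof (rule equivI)
  show "pres_rel S R \<subseteq> words S \<times> words S"
    by (auto dest!: pres_rel_words)
  show "refl_on (words S) (pres_rel S R)"
    by (simp add: pres_rel.refl refl_on_def)
  show "Relation.sym (pres_rel S R)"
    by (meson pres_rel.sym symI)
  show "Relation.trans (pres_rel S R)"
    by (meson pres_rel.trans transI)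
qed

lemma pres_mult_class:
  assumes "u \<in> words S" "v \<in> words S"
  shows "mult (presented_group S R) (pres_rel S R `` {u}) (pres_rel S R `` {v})
       = pres_rel S R `` {u @ v}"
proof -
  have "pres_rel S R `` {u' @ v'} = pres_rel S R `` {u @ v}"
    if "(u, u') \<in> pres_rel S R" "(v, v') \<in> pres_rel S R" for u' v'
    using equiv_class_eq[OF equiv_pres_rel pres_rel.append[OF that]] by simp
  moreover have "u \<in> pres_rel S R `` {u}" "v \<in> pres_rel S R `` {v}"
    using assms by (simp_all add: pres_rel.refl)
  ultimately show ?thesis
    unfolding presented_group_def monoid.simps by blast
qed

lemma pres_inverse_word:
  assumes "u \<in> words S"
  shows "\<exists>v\<in>words S. (v @ u, []) \<in> pres_rel S R"
  using assms
proof (induction u rule: lists.induct)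
  case Nil
  then show ?case by (intro bexI[of _ "[]"]) (auto intro: pres_rel.refl)
next
  case (Cons a u)
  obtain s e where a: "a = (s, e)" by (cases a)
  have s: "s \<in> S" and u: "u \<in> words S"
    using Cons.hyps a by simp_all
  obtain v where v: "v \<in> words S" "(v @ u, []) \<in> pres_rel S R"
    using Cons.IH by blast
  have "([(s, \<not> e), (s, e)], []) \<in> pres_rel S R"
    using pres_rel.cancel[of s S "\<not> e" R] s by simp
  then have "(v @ [(s, \<not> e), (s, e)] @ u, v @ [] @ u) \<in> pres_rel S R"
    using v(1) u by (intro pres_rel.append pres_rel.refl)
  then have "((v @ [(s, \<not> e)]) @ a # u, []) \<in> pres_rel S R"
    using pres_rel.trans[OF _ v(2)] a by simp
  then show ?case using v(1) s by (intro bexI[of _ "v @ [(s, \<not> e)]"]) auto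
qed

lemma group_presented_group: "group (presented_group S R)"
proof (rule groupI)
  let ?c = "\<lambda>u. pres_rel S R `` {u}"
  have car: "carrier (presented_group S R) = words S // pres_rel S R"
    and one: "one (presented_group S R) = ?c []"
    by (simp_all add: presented_group_def)
  note mult = pres_mult_class[where S = S and R = R]
  have app: "u @ v \<in> words S" if "u \<in> words S" "v \<in> words S" for u v :: "'a word"
    using that by auto
  show "one (presented_group S R) \<in> carrier (presented_group S R)"
    unfolding car one by (rule quotientI) simp
  fix X assume "X \<in> carrier (presented_group S R)"
  then obtain u where u: "u \<in> words S" "X = ?c u"
    unfolding car by (elim quotientE)
  show "mult (presented_group S R) (one (presented_group S R)) X = X"
    unfolding one u(2) using mult[of "[]" u] u(1) by simp
  obtain v where v: "v \<in> words S" "(v @ u, []) \<in> pres_rel S R"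
    using pres_inverse_word[OF u(1)] by blast
  have "mult (presented_group S R) (?c v) X = one (presented_group S R)"
    unfolding one u(2) mult[OF v(1) u(1)] by (rule equiv_class_eq[OF equiv_pres_rel v(2)])
  then show "\<exists>Y\<in>carrier (presented_group S R).
      mult (presented_group S R) Y X = one (presented_group S R)"
    unfolding car using quotientI[OF v(1)] by blast
  fix Y assume "Y \<in> carrier (presented_group S R)"
  then obtain v where v: "v \<in> words S" "Y = ?c v"
    unfolding car by (elim quotientE)
  show "mult (presented_group S R) X Y \<in> carrier (presented_group S R)"
    unfolding car u(2) v(2) mult[OF u(1) v(1)] by (rule quotientI[OF app[OF u(1) v(1)]])
  fix Z assume "Z \<in> carrier (presented_group S R)"
  then obtain w where w: "w \<in> words S" "Z = ?c w"
    unfolding car by (elim quotientE)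
  show "mult (presented_group S R) (mult (presented_group S R) X Y) Z
      = mult (presented_group S R) X (mult (presented_group S R) Y Z)"
    unfolding u(2) v(2) w(2) mult[OF u(1) v(1)] mult[OF v(1) w(1)]
      mult[OF app[OF u(1) v(1)] w(1)] mult[OF u(1) app[OF v(1) w(1)]] by simp
qed


section \<open>Coxeter matrices of types A, D, E and their Artin groups\<close>

datatype ade = TypeA nat | TypeD nat | TypeE6 | TypeE7 | TypeE8

fun valid_ade :: "ade \<Rightarrow> bool" where
  "valid_ade (TypeA n) = (n \<ge> 1)"
| "valid_ade (TypeD n) = (n \<ge> 4)"
| "valid_ade _ = True"

fun ade_rank :: "ade \<Rightarrow> nat" where
  "ade_rank (TypeA n) = n"
| "ade_rank (TypeD n) = n"
| "ade_rank TypeE6 = 6"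
| "ade_rank TypeE7 = 7"
| "ade_rank TypeE8 = 8"

text \<open>The edges \<open>{i, j}\<close>, \<open>i < j\<close>, of the Dynkin diagrams, with nodes \<open>1, \<dots>, n\<close> numbered as in
  Bourbaki: in type D, node \<open>n\<close> is joined to \<open>n - 2\<close>; in type E, node \<open>2\<close> is joined to \<open>4\<close>, which
  lies on the chain \<open>1, 3, 4, \<dots>, n\<close>.\<close>

fun dynkin_edge :: "ade \<Rightarrow> nat \<Rightarrow> nat \<Rightarrow> bool" where
  "dynkin_edge (TypeA n) i j = (j = i + 1)"
| "dynkin_edge (TypeD n) i j = (j = i + 1 \<and> j < n \<or> i + 2 = n \<and> j = n)"
| "dynkin_edge _ i j = (i = 1 \<and> j = 3 \<or> i = 2 \<and> j = 4 \<or> 3 \<le> i \<and> j = i + 1)"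

definition coxeter_matrix :: "ade \<Rightarrow> nat \<Rightarrow> nat \<Rightarrow> nat" where
  "coxeter_matrix X i j =
    (if i = j then 1 else if dynkin_edge X i j \<or> dynkin_edge X j i then 3 else 2)"

fun alternating :: "nat \<Rightarrow> 'g \<Rightarrow> 'g \<Rightarrow> 'g word" where
  "alternating 0 a b = []"
| "alternating (Suc m) a b = (a, True) # alternating m b a"

definition artin_relations :: "nat \<Rightarrow> (nat \<Rightarrow> nat \<Rightarrow> nat) \<Rightarrow> (nat word \<times> nat word) set" where
  "artin_relations n M =
    {(alternating (M i j) i j, alternating (M i j) j i) | i j. 1 \<le> i \<and> i < j \<and> j \<le> n}"

definition artin_group :: "ade \<Rightarrow> nat word set monoid" where
  "artin_group X =
    presented_group {1..ade_rank X} (artin_relations (ade_rank X) (coxeter_matrix X))"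

definition artin_gen :: "ade \<Rightarrow> nat \<Rightarrow> nat word set" where
  "artin_gen X = pres_gen {1..ade_rank X} (artin_relations (ade_rank X) (coxeter_matrix X))"


section \<open>The root system\<close>

text \<open>A vector of \<open>\<real>\<^sup>n\<close> is given by its coordinates, indexed by \<open>1, \<dots>, n\<close>, with respect to the
  basis of simple roots; the inner product is the standard form of the Coxeter matrix, normalised
  so that every root \<open>\<alpha>\<close> has \<open>(\<alpha>, \<alpha>) = 2\<close>.\<close>

type_synonym root = "nat \<Rightarrow> real"

definition simple_root :: "nat \<Rightarrow> root" where
  "simple_root k = (\<lambda>i. if i = k then 1 else 0)"

definition ip :: "ade \<Rightarrow> root \<Rightarrow> root \<Rightarrow> real" where
  "ip X x y = (\<Sum>i = 1..ade_rank X. \<Sum>j = 1..ade_rank X.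
     x i * y j * (- 2 * cos (pi / real (coxeter_matrix X i j))))"

definition reflection :: "ade \<Rightarrow> nat \<Rightarrow> root \<Rightarrow> root" where
  "reflection X k x = (\<lambda>i. x i - ip X (simple_root k) x * simple_root k i)"

text \<open>Since reflections are involutions, closure under composition gives the generated group.\<close>

inductive_set coxeter_group :: "ade \<Rightarrow> (root \<Rightarrow> root) set" for X where
  one: "id \<in> coxeter_group X"
| mult: "w \<in> coxeter_group X \<Longrightarrow> k \<in> {1..ade_rank X} \<Longrightarrow> reflection X k \<circ> w \<in> coxeter_group X"

definition roots :: "ade \<Rightarrow> root set" where
  "roots X = {w (simple_root k) | w k. w \<in> coxeter_group X \<and> k \<in> {1..ade_rank X}}"

definition pos_roots :: "ade \<Rightarrow> root set" where
  "pos_roots X = {\<beta> \<in> roots X. \<forall>i\<in>{1..ade_rank X}. 0 \<le> \<beta> i}"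


section \<open>Free modules\<close>

text \<open>The free module with basis \<open>I\<close> over a commutative ring consists of the finitely supported
  functions with support in \<open>I\<close>; the basis vector \<open>x\<^sub>b\<close> is \<open>bvec b\<close>.\<close>

definition free_mod :: "'b set \<Rightarrow> ('b \<Rightarrow>\<^sub>0 'r::comm_ring_1) set" where
  "free_mod I = {v. Poly_Mapping.keys v \<subseteq> I}"

abbreviation bvec :: "'b \<Rightarrow> ('b \<Rightarrow>\<^sub>0 'r::comm_ring_1)" where
  "bvec b \<equiv> Poly_Mapping.single b 1"

definition fm_scale :: "'r::comm_ring_1 \<Rightarrow> ('b \<Rightarrow>\<^sub>0 'r) \<Rightarrow> ('b \<Rightarrow>\<^sub>0 'r)" (infixr \<open>*\<^sub>f\<close> 75) where
  "c *\<^sub>f v = Poly_Mapping.map (\<lambda>a. c * a) v"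

definition linear_on :: "'b set \<Rightarrow> (('b \<Rightarrow>\<^sub>0 'r::comm_ring_1) \<Rightarrow> ('b \<Rightarrow>\<^sub>0 'r)) \<Rightarrow> bool" where
  "linear_on I f \<longleftrightarrow>
     (\<forall>u\<in>free_mod I. \<forall>v\<in>free_mod I. f (u + v) = f u + f v) \<and>
     (\<forall>c. \<forall>v\<in>free_mod I. f (c *\<^sub>f v) = c *\<^sub>f f v)"

definition GL :: "'b set \<Rightarrow> (('b \<Rightarrow>\<^sub>0 'r::comm_ring_1) \<Rightarrow> ('b \<Rightarrow>\<^sub>0 'r)) monoid" where
  "GL I = (BijGroup (free_mod I)) \<lparr>carrier := {f \<in> Bij (free_mod I). linear_on I f}\<rparr>"

text \<open>The linear map on the free module with basis \<open>I\<close> that sends \<open>x\<^sub>b\<close> to \<open>f b\<close> for \<open>b \<in> I\<close>.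
  Like the elements of \<open>GL I\<close>, it is extensional, i.e. \<open>undefined\<close> outside the module.\<close>

definition lin_ext :: "'b set \<Rightarrow> ('b \<Rightarrow> 'b \<Rightarrow>\<^sub>0 'r::comm_ring_1) \<Rightarrow> ('b \<Rightarrow>\<^sub>0 'r) \<Rightarrow> ('b \<Rightarrow>\<^sub>0 'r)" where
  "lin_ext I f = (\<lambda>v\<in>free_mod I. \<Sum>b\<in>Poly_Mapping.keys v. Poly_Mapping.lookup v b *\<^sub>f f b)"

text \<open>Extension of scalars along \<open>\<phi>\<close> of an endomorphism \<open>f\<close> of the free module with basis \<open>I\<close>:
  \<open>\<phi>\<close> is applied to the matrix entries of \<open>f\<close>.\<close>

definition base_change ::
  "('r::comm_ring_1 \<Rightarrow> 's::comm_ring_1) \<Rightarrow> 'b set \<Rightarrow> (('b \<Rightarrow>\<^sub>0 'r) \<Rightarrow> ('b \<Rightarrow>\<^sub>0 'r))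
    \<Rightarrow> (('b \<Rightarrow>\<^sub>0 's) \<Rightarrow> ('b \<Rightarrow>\<^sub>0 's))" where
  "base_change \<phi> I f = lin_ext I (\<lambda>b. Poly_Mapping.map \<phi> (f (bvec b)))"

lemma lookup_fm_scale:
  "Poly_Mapping.lookup (c *\<^sub>f v) b = c * Poly_Mapping.lookup v b"
  by (simp add: fm_scale_def Poly_Mapping.map.rep_eq when_def)

lemma free_mod_add: "u \<in> free_mod I \<Longrightarrow> v \<in> free_mod I \<Longrightarrow> u + v \<in> free_mod I"
  using Poly_Mapping.keys_add[of u v] by (auto simp: free_mod_def)

lemma free_mod_smult: "v \<in> free_mod I \<Longrightarrow> c *\<^sub>f v \<in> free_mod I"
  by (fastforce simp: free_mod_def in_keys_iff lookup_fm_scale)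

lemma group_GL: "group (GL I :: (('b \<Rightarrow>\<^sub>0 'r::comm_ring_1) \<Rightarrow> ('b \<Rightarrow>\<^sub>0 'r)) monoid)"
proof -
  let ?V = "free_mod I :: ('b \<Rightarrow>\<^sub>0 'r) set"
  let ?G = "BijGroup ?V"
  interpret group ?G by (rule group_BijGroup)
  have "subgroup {f \<in> Bij ?V. linear_on I f} ?G"
  proof (rule subgroupI)
    show "{f \<in> Bij ?V. linear_on I f} \<subseteq> carrier ?G"
      by (auto simp: BijGroup_def)
    have "linear_on I (\<lambda>x\<in>?V. x)"
      by (simp add: linear_on_def free_mod_add free_mod_smult)
    then show "{f \<in> Bij ?V. linear_on I f} \<noteq> {}"
      using id_Bij by blast
  next
    fix f assume f: "f \<in> {f \<in> Bij ?V. linear_on I f}"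
    then have fB: "f \<in> Bij ?V" and lin: "linear_on I f" by auto
    have bij: "bij_betw f ?V ?V" using fB by (simp add: Bij_def)
    define g where "g = inv_into ?V f"
    have gV: "g v \<in> ?V" if "v \<in> ?V" for v
      using Bij_inv_into_mem[OF fB that] by (simp add: g_def)
    have fg: "f (g v) = v" if "v \<in> ?V" for v
      using bij_betw_inv_into_right[OF bij that] by (simp add: g_def)
    have gf: "g (f v) = v" if "v \<in> ?V" for v
      using bij_betw_inv_into_left[OF bij that] by (simp add: g_def)
    have "linear_on I (\<lambda>x\<in>?V. g x)"
      unfolding linear_on_def
    proof (intro conjI ballI allI)
      fix u v assume uv: "u \<in> ?V" "v \<in> ?V"
      have "f (g u + g v) = u + v"
        using lin uv gV fg by (simp add: linear_on_def)
      then have "g (u + v) = g u + g v"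
        using gf[of "g u + g v"] gV uv free_mod_add by metis
      then show "(\<lambda>x\<in>?V. g x) (u + v) = (\<lambda>x\<in>?V. g x) u + (\<lambda>x\<in>?V. g x) v"
        using uv by (simp add: free_mod_add)
    next
      fix c v assume v: "v \<in> ?V"
      have "f (c *\<^sub>f g v) = c *\<^sub>f v"
        using lin v gV fg by (simp add: linear_on_def)
      then have "g (c *\<^sub>f v) = c *\<^sub>f g v"
        using gf[of "c *\<^sub>f g v"] gV v free_mod_smult by metis
      then show "(\<lambda>x\<in>?V. g x) (c *\<^sub>f v) = c *\<^sub>f (\<lambda>x\<in>?V. g x) v"
        using v by (simp add: free_mod_smult)
    qed
    moreover have "(\<lambda>x\<in>?V. g x) \<in> Bij ?V"
      unfolding g_def by (rule restrict_inv_into_Bij[OF fB])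
    ultimately show "inv\<^bsub>?G\<^esub> f \<in> {f \<in> Bij ?V. linear_on I f}"
      using inv_BijGroup[OF fB] by (simp add: g_def)
  next
    fix f g assume f: "f \<in> {f \<in> Bij ?V. linear_on I f}" and g: "g \<in> {f \<in> Bij ?V. linear_on I f}"
    have gV: "g v \<in> ?V" if "v \<in> ?V" for v
      using g that Bij_imp_funcset by blast
    have "linear_on I (compose ?V f g)"
      using f g gV by (simp add: linear_on_def compose_def free_mod_add free_mod_smult)
    then show "f \<otimes>\<^bsub>?G\<^esub> g \<in> {f \<in> Bij ?V. linear_on I f}"
      using f g by (simp add: BijGroup_def compose_Bij)
  qed
  then show ?thesis
    unfolding GL_def by (rule subgroup.subgroup_is_group) (rule group_BijGroup)
qed


section \<open>Laurent polynomial rings and specialisation\<close>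

text \<open>Laurent polynomials are finitely supported functions on the exponents, multiplied by
  convolution: \<open>laurent_rt\<close> is \<open>\<int>[r\<^sup>\<plusminus>\<^sup>1, t\<^sup>\<plusminus>\<^sup>1]\<close>, with exponent pairs (of \<open>r\<close>, of \<open>t\<close>), and
  \<open>laurent_t\<close> is \<open>\<real>[t\<^sup>\<plusminus>\<^sup>1]\<close>.\<close>

type_synonym laurent_rt = "(int \<times> int) \<Rightarrow>\<^sub>0 int"
type_synonym laurent_t = "int \<Rightarrow>\<^sub>0 real"

definition var_r :: laurent_rt where "var_r = Poly_Mapping.single (1, 0) 1"
definition var_t :: laurent_rt where "var_t = Poly_Mapping.single (0, 1) 1"

definition poly_in_r :: "int poly \<Rightarrow> laurent_rt" where
  "poly_in_r p = poly (map_poly of_int p) var_r"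

definition specialise :: "real \<Rightarrow> laurent_rt \<Rightarrow> laurent_t" where
  "specialise r\<^sub>0 p = (\<Sum>(i, j)\<in>Poly_Mapping.keys p.
     Poly_Mapping.single j (of_int (Poly_Mapping.lookup p (i, j)) * r\<^sub>0 powi i))"

lemma poly_mapping_single_induct [case_names zero single_add]:
  fixes p :: "'a \<Rightarrow>\<^sub>0 'b::comm_monoid_add"
  assumes "P 0" "\<And>a c p. P p \<Longrightarrow> P (Poly_Mapping.single a c + p)"
  shows "P p"
proof (induction p rule: Poly_Mapping.update_induct)
  case const
  then show ?case by (rule assms(1))
next
  case (update p a c)
  have "Poly_Mapping.update a c p = Poly_Mapping.single a c + p"
    using update(1)
    by (intro poly_mapping_eqI)
      (auto simp: lookup_update lookup_add lookup_single in_keys_iff when_def)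
  then show ?case using update assms(2) by simp
qed

lemma specialise_superset:
  assumes "finite A" "Poly_Mapping.keys p \<subseteq> A"
  shows "specialise r\<^sub>0 p = (\<Sum>(i, j)\<in>A.
     Poly_Mapping.single j (of_int (Poly_Mapping.lookup p (i, j)) * r\<^sub>0 powi i))"
  unfolding specialise_def
  by (rule sum.mono_neutral_left) (use assms in \<open>auto simp: in_keys_iff\<close>)

lemma specialise_add: "specialise r\<^sub>0 (p + q) = specialise r\<^sub>0 p + specialise r\<^sub>0 q"
proof -
  let ?A = "Poly_Mapping.keys p \<union> Poly_Mapping.keys q"
  have fin: "finite ?A" by simp
  have "Poly_Mapping.keys (p + q) \<subseteq> ?A" by (rule Poly_Mapping.keys_add)
  then show ?thesis
    unfolding specialise_superset[OF fin \<open>Poly_Mapping.keys (p + q) \<subseteq> ?A\<close>]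
      specialise_superset[OF fin Un_upper1] specialise_superset[OF fin Un_upper2]
    by (simp add: sum.distrib[symmetric] case_prod_unfold lookup_add distrib_right single_add)
qed

lemma specialise_single:
  "specialise r\<^sub>0 (Poly_Mapping.single (i, j) c) = Poly_Mapping.single j (of_int c * r\<^sub>0 powi i)"
  by (simp add: specialise_def)

lemma specialise_one: "specialise r\<^sub>0 1 = 1"
  using specialise_single[of r\<^sub>0 0 0 1] by (simp add: zero_prod_def[symmetric])

lemma specialise_mult:
  assumes "r\<^sub>0 \<noteq> 0"
  shows "specialise r\<^sub>0 (p * q) = specialise r\<^sub>0 p * specialise r\<^sub>0 q"
proof -
  have zero: "specialise r\<^sub>0 0 = 0" by (simp add: specialise_def)
  have ss: "specialise r\<^sub>0 (Poly_Mapping.single a c * Poly_Mapping.single b d)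
      = specialise r\<^sub>0 (Poly_Mapping.single a c) * specialise r\<^sub>0 (Poly_Mapping.single b d)"
    for a b c d
    using assms
    by (cases a; cases b)
      (simp add: mult_single specialise_single power_int_add algebra_simps)
  have s: "specialise r\<^sub>0 (Poly_Mapping.single a c * q)
      = specialise r\<^sub>0 (Poly_Mapping.single a c) * specialise r\<^sub>0 q" for a c
    by (induction q rule: poly_mapping_single_induct)
      (simp_all add: ss zero distrib_left specialise_add)
  show ?thesis
    by (induction p rule: poly_mapping_single_induct)
      (simp_all add: s zero distrib_right specialise_add)
qed


section \<open>The maps \<open>\<sigma>\<^sub>k\<close>\<close>

text \<open>For a positive root \<open>\<beta>\<close> the inner product \<open>(\<alpha>\<^sub>k, \<beta>)\<close> is \<open>2\<close>, \<open>1\<close>, \<open>0\<close> or \<open>-1\<close>, so the last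
  case below is the case \<open>-1\<close>.\<close>

definition tau_map :: "ade \<Rightarrow> nat \<Rightarrow> (root \<Rightarrow>\<^sub>0 laurent_rt) \<Rightarrow> (root \<Rightarrow>\<^sub>0 laurent_rt)" where
  "tau_map X k = lin_ext (pos_roots X) (\<lambda>\<beta>.
     if ip X (simple_root k) \<beta> = 2 then 0
     else if ip X (simple_root k) \<beta> = 1 then var_r *\<^sub>f bvec (\<lambda>i. \<beta> i - simple_root k i)
     else if ip X (simple_root k) \<beta> = 0 then bvec \<beta>
     else (1 - var_r ^ 2) *\<^sub>f bvec \<beta> + var_r *\<^sub>f bvec (\<lambda>i. \<beta> i + simple_root k i))"

definition T_map ::
  "ade \<Rightarrow> (nat \<Rightarrow> root \<Rightarrow> int poly) \<Rightarrow> nat \<Rightarrow> (root \<Rightarrow>\<^sub>0 laurent_rt) \<Rightarrow> (root \<Rightarrow>\<^sub>0 laurent_rt)" where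
  "T_map X T k = lin_ext (pos_roots X) (\<lambda>\<beta>. poly_in_r (T k \<beta>) *\<^sub>f bvec (simple_root k))"

definition sigma_map ::
  "ade \<Rightarrow> (nat \<Rightarrow> root \<Rightarrow> int poly) \<Rightarrow> nat \<Rightarrow> (root \<Rightarrow>\<^sub>0 laurent_rt) \<Rightarrow> (root \<Rightarrow>\<^sub>0 laurent_rt)" where
  "sigma_map X T k = (\<lambda>v\<in>free_mod (pos_roots X). tau_map X k v + var_t *\<^sub>f T_map X T k v)"

text \<open>\<open>\<rho>\<close> is a representation of the Artin group with \<open>\<rho> s\<^sub>k = \<sigma>\<^sub>k\<close>. The value of \<open>\<rho>\<close> outside the
  group is fixed to be \<open>undefined\<close>, so that \<open>\<rho>\<close> can be unique.\<close>

definition extends_sigma ::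
  "ade \<Rightarrow> (nat \<Rightarrow> root \<Rightarrow> int poly)
    \<Rightarrow> (nat word set \<Rightarrow> (root \<Rightarrow>\<^sub>0 laurent_rt) \<Rightarrow> (root \<Rightarrow>\<^sub>0 laurent_rt)) \<Rightarrow> bool" where
  "extends_sigma X T \<rho> \<longleftrightarrow>
     \<rho> \<in> hom (artin_group X) (GL (pos_roots X)) \<and>
     \<rho> \<in> extensional (carrier (artin_group X)) \<and>
     (\<forall>k\<in>{1..ade_rank X}. \<rho> (artin_gen X k) = sigma_map X T k)"

definition specialised_rep ::
  "ade \<Rightarrow> real \<Rightarrow> (nat word set \<Rightarrow> (root \<Rightarrow>\<^sub>0 laurent_rt) \<Rightarrow> (root \<Rightarrow>\<^sub>0 laurent_rt))
    \<Rightarrow> nat word set \<Rightarrow> (root \<Rightarrow>\<^sub>0 laurent_t) \<Rightarrow> (root \<Rightarrow>\<^sub>0 laurent_t)" where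
  "specialised_rep X r\<^sub>0 \<rho> b = base_change (specialise r\<^sub>0) (pos_roots X) (\<rho> b)"

end

theory Submission
  imports Defs
begin

text \<open>
  In coordinates, \<open>\<tau>\<^sub>k\<close> is a symmetric matrix, so the same formula describes its action on vectors and
  on linear functionals. Write \<open>T\<^sub>k v = \<phi>\<^sub>k(v) x\<^bsub>\<alpha>\<^sub>k\<^esub>\<close>. Expanding the braid relations in powers of
  \<open>t\<close> reduces them to the relations between the \<open>\<tau>\<^sub>k\<close> together with \<open>\<phi>\<^sub>j(x\<^bsub>\<alpha>\<^sub>i\<^esub>) = 0\<close> for \<open>i \<noteq> j\<close>,
  \<open>\<phi>\<^sub>j \<tau>\<^sub>i = \<phi>\<^sub>j\<close> for non-adjacent nodes and \<open>\<phi>\<^sub>j \<tau>\<^sub>i = \<phi>\<^sub>i \<tau>\<^sub>j\<close> for adjacent ones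
  (\<open>sigma_commute\<close>, \<open>sigma_braid\<close>); and \<open>\<sigma>\<^sub>k\<close> is invertible as soon as \<open>\<phi>\<^sub>k(x\<^bsub>\<alpha>\<^sub>k\<^esub>)\<close> is a unit.

  Functionals with these properties belong to a family \<open>\<phi>\<^sub>\<beta>\<close> indexed by all positive roots and
  constructed downwards from the maximal roots, like the \<open>R\<close>-polynomials of Kazhdan and Lusztig:
  if \<open>\<beta>\<close> is maximal then \<open>\<phi>\<^sub>\<beta>\<close> is the coordinate at \<open>\<beta>\<close>, and if \<open>(\<alpha>\<^sub>i, \<beta>) = -1\<close> then \<open>\<phi>\<^sub>\<beta>\<close> is
  \<open>r\<^sup>2 \<phi>\<^bsub>\<beta>+\<alpha>\<^sub>i\<^esub> \<tau>\<^sub>i\<^sup>-\<^sup>1\<close>, where the inverse is the one given by the quadratic relation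
  \<open>\<tau>\<^sub>i\<^sup>2 = (1 - r\<^sup>2) \<tau>\<^sub>i + r\<^sup>2\<close>, valid away from \<open>\<alpha>\<^sub>i\<close>. Two adjacent nodes never both satisfy
  \<open>(\<alpha>\<^sub>i, \<beta>) = -1\<close>, so the choice of \<open>i\<close> is immaterial by a diamond argument (\<open>R_fun_unique\<close>); the
  required identities follow by induction from the top (\<open>tau_R_poly_orthogonal\<close>,
  \<open>tau_R_poly_simple_adjacent\<close>).

  Faithfulness uses the part of the representation at \<open>t = 0\<close> alone. For \<open>0 < r < 1\<close> the matrices
  \<open>\<tau>\<^sub>k\<close> have non-negative entries, so a positive word \<open>u\<close> acts on subsets of \<open>\<Phi>\<^sup>+\<close> by taking supports,
  and the image \<open>u \<Phi>\<^sup>+\<close> depends only on the matrix that represents \<open>u\<close>. The key fact is that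
  \<open>\<alpha>\<^sub>k \<notin> u \<Phi>\<^sup>+\<close> exactly when \<open>s\<^sub>k\<close> divides \<open>u\<close> from the left among positive words
  (\<open>left_divisor_if_notin_act\<close>, \<open>simple_root_notin_act\<close>). Cancelling left divisors one after the
  other, two positive words with the same matrix are equal in the group. Moreover some positive word
  \<open>\<Delta>\<close> satisfies \<open>\<Delta> \<Phi>\<^sup>+ = {}\<close> (\<open>exists_annihilating_word\<close>), so every \<open>s\<^sub>k\<close> divides every \<open>v \<Delta>\<close>; hence each
  group element becomes positive after multiplication by a positive word from the right, and the
  kernel is trivial (\<open>injective_if_determines_supports\<close>).
\<close>


section \<open>Positive definiteness of the Cartan matrices\<close>

text \<open>Substituting \<open>x\<^sub>i = d\<^sub>i y\<^sub>i\<close> and replacing each \<open>2 y\<^sub>i y\<^sub>j\<close> by \<open>y\<^sub>i\<^sup>2 + y\<^sub>j\<^sup>2\<close> can only decrease the form,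
  because the off-diagonal entries are not positive; what remains is the diagonal form with
  coefficients \<open>d\<^sub>i (A d)\<^sub>i\<close>.\<close>

lemma positive_definite_if_weights:
  fixes A :: "'i \<Rightarrow> 'i \<Rightarrow> real" and d x :: "'i \<Rightarrow> real"
  assumes fin: "finite I" and sym: "\<And>i j. A i j = A j i"
    and off: "\<And>i j. i \<noteq> j \<Longrightarrow> A i j \<le> 0"
    and d: "\<And>i. i \<in> I \<Longrightarrow> 0 < d i"
    and Ad: "\<And>i. i \<in> I \<Longrightarrow> 0 < (\<Sum>j\<in>I. A i j * d j)"
    and x: "i \<in> I" "x i \<noteq> 0"
  shows "0 < (\<Sum>i\<in>I. \<Sum>j\<in>I. x i * x j * A i j)"
proof -
  define y where "y = (\<lambda>i. x i / d i)"
  have xy: "x i = d i * y i" if "i \<in> I" for i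
    using d[OF that] by (simp add: y_def)
  have le: "A i j * d i * d j * (y i ^ 2 + y j ^ 2) / 2 \<le> x i * x j * A i j"
    if "i \<in> I" "j \<in> I" for i j
  proof (cases "i = j")
    case True
    then show ?thesis using xy[OF that(1)] by (simp add: power2_eq_square)
  next
    case False
    have "0 \<le> - A i j * (d i * d j) * (y i - y j) ^ 2"
      using off[OF False] d[OF that(1)] d[OF that(2)] by (intro mult_nonneg_nonneg) auto
    then show ?thesis
      unfolding xy[OF that(1)] xy[OF that(2)] by (simp add: power2_eq_square algebra_simps)
  qed
  have "(\<Sum>i\<in>I. \<Sum>j\<in>I. A i j * d i * d j * (y i ^ 2 + y j ^ 2) / 2)
      = (\<Sum>i\<in>I. \<Sum>j\<in>I. A i j * d i * d j * y i ^ 2 / 2)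
        + (\<Sum>i\<in>I. \<Sum>j\<in>I. A i j * d i * d j * y j ^ 2 / 2)"
    by (simp add: distrib_left add_divide_distrib sum.distrib)
  also have "(\<Sum>i\<in>I. \<Sum>j\<in>I. A i j * d i * d j * y j ^ 2 / 2)
      = (\<Sum>i\<in>I. \<Sum>j\<in>I. A i j * d i * d j * y i ^ 2 / 2)"
    by (subst sum.swap) (simp add: sym mult.commute mult.left_commute)
  also have "(\<Sum>i\<in>I. \<Sum>j\<in>I. A i j * d i * d j * y i ^ 2 / 2)
      + (\<Sum>i\<in>I. \<Sum>j\<in>I. A i j * d i * d j * y i ^ 2 / 2)
      = (\<Sum>i\<in>I. d i * y i ^ 2 * (\<Sum>j\<in>I. A i j * d j))"
    by (simp add: sum_distrib_left sum.distrib[symmetric] algebra_simps)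
  finally have eq: "(\<Sum>i\<in>I. \<Sum>j\<in>I. A i j * d i * d j * (y i ^ 2 + y j ^ 2) / 2)
      = (\<Sum>i\<in>I. d i * y i ^ 2 * (\<Sum>j\<in>I. A i j * d j))" .
  have "0 < (\<Sum>i\<in>I. d i * y i ^ 2 * (\<Sum>j\<in>I. A i j * d j))"
  proof (rule sum_pos2[OF fin x(1)])
    have "y i \<noteq> 0" using x d[OF x(1)] by (simp add: y_def)
    then show "0 < d i * y i ^ 2 * (\<Sum>j\<in>I. A i j * d j)"
      using d[OF x(1)] Ad[OF x(1)] by simp
    show "0 \<le> d i * y i ^ 2 * (\<Sum>j\<in>I. A i j * d j)" if "i \<in> I" for i
      using d[OF that] Ad[OF that] by simp
  qed
  also have "\<dots> \<le> (\<Sum>i\<in>I. \<Sum>j\<in>I. x i * x j * A i j)"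
    unfolding eq[symmetric] by (intro sum_mono le)
  finally show ?thesis .
qed

locale ade_system =
  fixes X :: ade
  assumes valid: "valid_ade X"
begin

definition nodes :: "nat set" where "nodes = {1..ade_rank X}"

definition cartan :: "nat \<Rightarrow> nat \<Rightarrow> real" where
  "cartan i j = (if i = j then 2 else if dynkin_edge X i j \<or> dynkin_edge X j i then - 1 else 0)"

lemma finite_nodes [simp]: "finite nodes"
  by (simp add: nodes_def)

lemma cartan_commute: "cartan i j = cartan j i"
  by (auto simp: cartan_def)

lemma cartan_same [simp]: "cartan i i = 2"
  by (simp add: cartan_def)

lemma cartan_cases: "i \<noteq> j \<Longrightarrow> cartan i j = 0 \<or> cartan i j = - 1"
  by (simp add: cartan_def)

lemma cartan_cos: "- 2 * cos (pi / real (coxeter_matrix X i j)) = cartan i j"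
  by (simp add: coxeter_matrix_def cartan_def cos_60)

lemma cartan_Ints: "cartan i j \<in> \<int>"
  by (simp add: cartan_def)

text \<open>The weights are the coordinates, with respect to the simple roots, of a multiple of the sum of
  all positive roots, whose inner products with the simple roots coincide. The weights of type
  \<open>E\<^sub>8\<close> serve for \<open>E\<^sub>6\<close> and \<open>E\<^sub>7\<close> as well: deleting nodes only removes negative terms.\<close>
lemma exists_weights:
  "\<exists>d. \<forall>i\<in>nodes. 0 < d i \<and> 0 < (\<Sum>j\<in>nodes. cartan i j * d j)"
proof (cases X)
  case (TypeA n)
  have N: "nodes = {1..ade_rank (TypeA n)}"
    unfolding nodes_def unfolding TypeA ..
  have C: "cartan i j = (if i = j then 2
      else if dynkin_edge (TypeA n) i j \<or> dynkin_edge (TypeA n) j i then - 1 else 0)" for i j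
    unfolding cartan_def unfolding TypeA ..
  define d :: "nat \<Rightarrow> real" where "d = (\<lambda>i. real i * (real n + 1 - real i))"
  have "0 < d i \<and> 0 < (\<Sum>j\<in>nodes. cartan i j * d j)" if i: "i \<in> nodes" for i
  proof
    have i': "1 \<le> i" "i \<le> n" using i by (auto simp: N)
    then show "0 < d i" by (simp add: d_def)
    have "(\<Sum>j\<in>nodes. cartan i j * d j)
        = (\<Sum>j\<in>nodes. (if j = i then 2 * d i else 0) - (if j = i - 1 then d (i - 1) else 0)
            - (if j = i + 1 then d (i + 1) else 0))"
      using i' by (intro sum.cong) (auto simp: C N)
    also have "\<dots> = 2 * d i - (if 1 < i then d (i - 1) else 0) - (if i < n then d (i + 1) else 0)"
      using i' by (auto simp: sum_subtractf N)
    also have "\<dots> = 2 * d i - d (i - 1) - d (i + 1)"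
      using i' by (auto simp: d_def)
    also have "\<dots> = 2"
      using i' by (simp add: d_def of_nat_diff algebra_simps)
    finally show "0 < (\<Sum>j\<in>nodes. cartan i j * d j)" by simp
  qed
  then show ?thesis by blast
next
  case (TypeD n)
  have N: "nodes = {1..ade_rank (TypeD n)}"
    unfolding nodes_def unfolding TypeD ..
  have C: "cartan i j = (if i = j then 2
      else if dynkin_edge (TypeD n) i j \<or> dynkin_edge (TypeD n) j i then - 1 else 0)" for i j
    unfolding cartan_def unfolding TypeD ..
  have n: "4 \<le> n" using valid TypeD by simp
  define d :: "nat \<Rightarrow> real" where
    "d = (\<lambda>i. if i + 2 \<le> n then real i * (2 * real n - 1 - real i) else real n * (real n - 1) / 2)"
  have "0 < d i \<and> 0 < (\<Sum>j\<in>nodes. cartan i j * d j)" if i: "i \<in> nodes" for i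
  proof
    have i': "1 \<le> i" "i \<le> n" using i by (auto simp: N)
    then show "0 < d i" using n by (auto simp: d_def)
    consider "i + 2 < n" | "i + 2 = n" | "i + 1 = n" | "i = n" using i' by linarith
    then show "0 < (\<Sum>j\<in>nodes. cartan i j * d j)"
    proof cases
      case 1
      have "(\<Sum>j\<in>nodes. cartan i j * d j)
          = (\<Sum>j\<in>nodes. (if j = i then 2 * d i else 0) - (if j = i - 1 then d (i - 1) else 0)
              - (if j = i + 1 then d (i + 1) else 0))"
        using i' 1 by (intro sum.cong) (auto simp: C N)
      also have "\<dots> = 2 * d i - (if 1 < i then d (i - 1) else 0) - d (i + 1)"
        using i' 1 by (auto simp: sum_subtractf N)
      also have "\<dots> = 2 * d i - d (i - 1) - d (i + 1)"
        using i' by (auto simp: d_def)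
      also have "\<dots> = 2"
        using i' 1 by (simp add: d_def of_nat_diff algebra_simps)
      finally show ?thesis by simp
    next
      case 2
      have "(\<Sum>j\<in>nodes. cartan i j * d j)
          = (\<Sum>j\<in>nodes. (if j = i then 2 * d i else 0) - (if j = i - 1 then d (i - 1) else 0)
              - (if j = i + 1 then d (i + 1) else 0) - (if j = n then d n else 0))"
        using i' 2 n by (intro sum.cong) (auto simp: C N)
      also have "\<dots> = 2 * d i - d (i - 1) - d (i + 1) - d n"
        using i' 2 n by (auto simp: sum_subtractf N)
      also have "\<dots> > 0"
        using 2 n by (auto simp: d_def of_nat_diff algebra_simps)
      finally show ?thesis .
    next
      case 3
      have "(\<Sum>j\<in>nodes. cartan i j * d j)
          = (\<Sum>j\<in>nodes. (if j = i then 2 * d i else 0) - (if j = n - 2 then d (n - 2) else 0))"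
        using i' 3 n by (intro sum.cong) (auto simp: C N)
      also have "\<dots> = 2 * d i - d (n - 2)"
        using i' 3 n by (auto simp: sum_subtractf N)
      also have "\<dots> > 0"
        using 3 n by (auto simp: d_def of_nat_diff algebra_simps)
      finally show ?thesis .
    next
      case 4
      have "(\<Sum>j\<in>nodes. cartan i j * d j)
          = (\<Sum>j\<in>nodes. (if j = i then 2 * d i else 0) - (if j = n - 2 then d (n - 2) else 0))"
        using i' 4 n by (intro sum.cong) (auto simp: C N)
      also have "\<dots> = 2 * d i - d (n - 2)"
        using i' 4 n by (auto simp: sum_subtractf N)
      also have "\<dots> > 0"
        using 4 n by (auto simp: d_def of_nat_diff algebra_simps)
      finally show ?thesis .
    qed
  qed
  then show ?thesis by blast
next
  case TypeE6
  have N: "nodes = {1..ade_rank (TypeE6)}"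
    unfolding nodes_def unfolding TypeE6 ..
  have N6: "nodes = {1, 2, 3, 4, 5, 6}"
    unfolding N by auto
  have C: "cartan i j = (if i = j then 2
      else if dynkin_edge (TypeE6) i j \<or> dynkin_edge (TypeE6) j i then - 1 else 0)" for i j
    unfolding cartan_def unfolding TypeE6 ..
  define d :: "nat \<Rightarrow> real" where "d = (\<lambda>i. [0, 46, 68, 91, 135, 110, 84, 57, 29] ! i)"
  show ?thesis
    by (rule exI[of _ d]) (simp add: N6 C d_def)
next
  case TypeE7
  have N: "nodes = {1..ade_rank (TypeE7)}"
    unfolding nodes_def unfolding TypeE7 ..
  have N7: "nodes = {1, 2, 3, 4, 5, 6, 7}"
    unfolding N by auto
  have C: "cartan i j = (if i = j then 2
      else if dynkin_edge (TypeE7) i j \<or> dynkin_edge (TypeE7) j i then - 1 else 0)" for i j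
    unfolding cartan_def unfolding TypeE7 ..
  define d :: "nat \<Rightarrow> real" where "d = (\<lambda>i. [0, 46, 68, 91, 135, 110, 84, 57, 29] ! i)"
  show ?thesis
    by (rule exI[of _ d]) (simp add: N7 C d_def)
next
  case TypeE8
  have N: "nodes = {1..ade_rank (TypeE8)}"
    unfolding nodes_def unfolding TypeE8 ..
  have N8: "nodes = {1, 2, 3, 4, 5, 6, 7, 8}"
    unfolding N by auto
  have C: "cartan i j = (if i = j then 2
      else if dynkin_edge (TypeE8) i j \<or> dynkin_edge (TypeE8) j i then - 1 else 0)" for i j
    unfolding cartan_def unfolding TypeE8 ..
  define d :: "nat \<Rightarrow> real" where "d = (\<lambda>i. [0, 46, 68, 91, 135, 110, 84, 57, 29] ! i)"
  show ?thesis
    by (rule exI[of _ d]) (simp add: N8 C d_def)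
qed

lemma ip_cartan: "ip X x y = (\<Sum>i\<in>nodes. \<Sum>j\<in>nodes. x i * y j * cartan i j)"
  unfolding ip_def cartan_cos nodes_def ..

lemma ip_pos: "i \<in> nodes \<Longrightarrow> x i \<noteq> 0 \<Longrightarrow> 0 < ip X x x"
proof -
  assume x: "i \<in> nodes" "x i \<noteq> 0"
  obtain d where d: "\<forall>i\<in>nodes. 0 < d i \<and> 0 < (\<Sum>j\<in>nodes. cartan i j * d j)"
    using exists_weights by blast
  show ?thesis
    unfolding ip_cartan
  proof (rule positive_definite_if_weights[where d = d])
    show "cartan i j \<le> 0" if "i \<noteq> j" for i j
      using cartan_cases[OF that] by auto
  qed (use d x in \<open>auto simp: cartan_commute\<close>)
qed

end


section \<open>Positive roots\<close>
lemma even_quadratic_form: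
  fixes A :: "'i \<Rightarrow> 'i \<Rightarrow> real" and x :: "'i \<Rightarrow> real"
  assumes "finite I" and sym: "\<And>i j. A i j = A j i"
    and diag: "\<And>i. A i i = 2" and int: "\<And>i j. A i j \<in> \<int>" "\<And>i. x i \<in> \<int>"
  shows "(\<Sum>i\<in>I. \<Sum>j\<in>I. x i * x j * A i j) / 2 \<in> \<int>"
  using \<open>finite I\<close>
proof induction
  case (insert k I)
  have swap: "(\<Sum>i\<in>I. x i * x k * A i k) = (\<Sum>j\<in>I. x k * x j * A k j)"
  proof (rule sum.cong)
    show "x i * x k * A i k = x k * x i * A k i" for i
      using sym[of i k] by simp
  qed simp
  have "(\<Sum>i\<in>insert k I. \<Sum>j\<in>insert k I. x i * x j * A i j) / 2
      = x k * x k + (\<Sum>j\<in>I. x k * x j * A k j) + (\<Sum>i\<in>I. \<Sum>j\<in>I. x i * x j * A i j) / 2"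
    using insert.hyps by (simp add: sum.distrib swap diag add_divide_distrib)
  also have "\<dots> \<in> \<int>"
    using insert.IH int by (intro Ints_add Ints_mult Ints_sum) auto
  finally show ?case .
qed simp

context ade_system
begin

abbreviation pair :: "nat \<Rightarrow> root \<Rightarrow> real" where
  "pair k x \<equiv> ip X (simple_root k) x"

abbreviation refl :: "nat \<Rightarrow> root \<Rightarrow> root" where
  "refl \<equiv> reflection X"

abbreviation Pos :: "root set" where
  "Pos \<equiv> pos_roots X"

lemma ip_commute: "ip X x y = ip X y x"
  unfolding ip_cartan by (subst sum.swap) (simp add: cartan_commute mult_ac)

lemma ip_add_scaled_right: "ip X z (\<lambda>i. x i + e * y i) = ip X z x + e * ip X z y"
  unfolding ip_cartan by (simp add: sum_distrib_left sum.distrib[symmetric] algebra_simps)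

lemma ip_add_scaled_left: "ip X (\<lambda>i. x i + e * y i) z = ip X x z + e * ip X y z"
  using ip_add_scaled_right[of z x e y] by (simp add: ip_commute)

lemma pair_eq: "k \<in> nodes \<Longrightarrow> pair k x = (\<Sum>j\<in>nodes. cartan k j * x j)"
proof -
  assume k: "k \<in> nodes"
  have "pair k x = (\<Sum>i\<in>nodes. if i = k then \<Sum>j\<in>nodes. x j * cartan k j else 0)"
    unfolding ip_cartan by (intro sum.cong) (auto simp: simple_root_def)
  then show ?thesis using k by (simp add: mult.commute)
qed

lemma ip_eq_sum_pair: "ip X x y = (\<Sum>i\<in>nodes. x i * pair i y)"
  unfolding ip_cartan[of x y]
  by (intro sum.cong) (auto simp: pair_eq sum_distrib_left mult_ac)

lemma pair_simple_root: "k \<in> nodes \<Longrightarrow> j \<in> nodes \<Longrightarrow> pair k (simple_root j) = cartan k j"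
  by (simp add: pair_eq[of k "simple_root j"])
    (simp add: simple_root_def if_distrib[of "\<lambda>t. _ * t"] cong: if_cong)

lemma norm_add_simple_root:
  assumes "k \<in> nodes"
  shows "ip X (\<lambda>i. x i + e * simple_root k i) (\<lambda>i. x i + e * simple_root k i)
    = ip X x x + 2 * e * pair k x + 2 * e ^ 2"
proof -
  have "ip X x (simple_root k) = pair k x" by (rule ip_commute)
  then show ?thesis
    using assms
    by (simp add: ip_add_scaled_left ip_add_scaled_right pair_simple_root
        power2_eq_square algebra_simps)
qed

lemma reflection_eq: "refl k x = (\<lambda>i. x i + (- pair k x) * simple_root k i)"
  by (simp add: reflection_def)

lemma pair_reflection:
  "k \<in> nodes \<Longrightarrow> i \<in> nodes \<Longrightarrow> pair k (refl i x) = pair k x - pair i x * cartan k i"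
  unfolding reflection_eq[of i] ip_add_scaled_right by (simp add: pair_simple_root)

lemma reflection_reflection: "k \<in> nodes \<Longrightarrow> refl k (refl k x) = x"
  by (rule ext) (simp add: reflection_def[of X k "refl k x"] pair_reflection, simp add: reflection_def)

lemma reflection_norm: "k \<in> nodes \<Longrightarrow> ip X (refl k x) (refl k x) = ip X x x"
  unfolding reflection_eq
  by (subst norm_add_simple_root) (simp_all add: power2_eq_square)

lemma reflection_fixed: "pair k x = 0 \<Longrightarrow> refl k x = x"
  by (simp add: reflection_def)

lemma reflection_commute:
  assumes "i \<in> nodes" "j \<in> nodes" "cartan i j = 0"
  shows "refl i (refl j x) = refl j (refl i x)"
proof
  fix m
  show "refl i (refl j x) m = refl j (refl i x) m"
    using assms cartan_commute[of i j]
    by (simp add: reflection_def[of X i "refl j x"] reflection_def[of X j "refl i x"]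
        pair_reflection) (simp add: reflection_def)
qed

definition lattice :: "root set" where
  "lattice = {x. (\<forall>i. x i \<in> \<int>) \<and> (\<forall>i. i \<notin> nodes \<longrightarrow> x i = 0)}"

lemma simple_root_lattice: "k \<in> nodes \<Longrightarrow> simple_root k \<in> lattice"
  by (auto simp: lattice_def simple_root_def)

lemma pair_Ints: "k \<in> nodes \<Longrightarrow> x \<in> lattice \<Longrightarrow> pair k x \<in> \<int>"
  by (auto simp: pair_eq lattice_def intro!: Ints_sum Ints_mult cartan_Ints)

lemma reflection_lattice: "k \<in> nodes \<Longrightarrow> x \<in> lattice \<Longrightarrow> refl k x \<in> lattice"
  using pair_Ints[of k x] by (auto simp: lattice_def reflection_def simple_root_def)

lemma lattice_norm_pos:
  assumes "x \<in> lattice" "x \<noteq> (\<lambda>i. 0)"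
  shows "0 < ip X x x"
proof -
  obtain i where "x i \<noteq> 0" using assms(2) by auto
  then show ?thesis using assms(1) ip_pos[of i x] by (auto simp: lattice_def)
qed

lemma lattice_norm_ge_2:
  assumes "x \<in> lattice" "x \<noteq> (\<lambda>i. 0)"
  shows "2 \<le> ip X x x"
proof -
  have "ip X x x / 2 \<in> \<int>"
    unfolding ip_cartan using assms(1)
    by (intro even_quadratic_form cartan_commute) (simp_all add: lattice_def cartan_Ints)
  then obtain m where m: "ip X x x / 2 = real_of_int m" by (elim Ints_cases)
  then have "0 < m" using lattice_norm_pos[OF assms] by simp
  then have "1 \<le> real_of_int m" by simp
  then show ?thesis using m by linarith
qed

text \<open>If \<open>x = y - z\<close> with \<open>y, z \<ge> 0\<close> of disjoint support and both nonzero, then \<open>(y, z) \<le> 0\<close> and so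
  \<open>(x, x) \<ge> (y, y) + (z, z) \<ge> 4\<close>. Thus norm 2 alone forces the coefficients of a root to have one
  sign.\<close>
lemma norm_2_sign:
  assumes x: "x \<in> lattice" "ip X x x = 2"
  shows "(\<forall>i. 0 \<le> x i) \<or> (\<forall>i. x i \<le> 0)"
proof (rule ccontr)
  assume "\<not> ?thesis"
  then obtain i j where "\<not> 0 \<le> x i" "\<not> x j \<le> 0" by blast
  then have ij: "x i < 0" "0 < x j" by simp_all
  define y where "y = (\<lambda>i. max (x i) 0)"
  define z where "z = (\<lambda>i. max (- x i) 0)"
  have yz: "y \<in> lattice" "z \<in> lattice"
    using x(1) by (auto simp: lattice_def y_def z_def max_def)
  have "y j \<noteq> 0" "z i \<noteq> 0" using ij by (auto simp: y_def z_def)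
  then have "2 \<le> ip X y y" "2 \<le> ip X z z"
    using yz by (auto intro!: lattice_norm_ge_2)
  moreover have "ip X y z \<le> 0"
    unfolding ip_cartan
  proof (intro sum_nonpos)
    fix i j
    show "y i * z j * cartan i j \<le> 0"
    proof (cases "i = j")
      case True
      then show ?thesis by (auto simp: y_def z_def max_def)
    next
      case False
      have "0 \<le> y i * z j" by (simp add: y_def z_def)
      then show ?thesis
        using cartan_cases[OF False] by auto
    qed
  qed
  moreover have "x = (\<lambda>i. y i + (- 1) * z i)"
    by (rule ext) (auto simp: y_def z_def max_def)
  then have "ip X x x = ip X y y - 2 * ip X y z + ip X z z"
    using ip_add_scaled_left[of y "- 1" z] ip_add_scaled_right[of _ y "- 1" z]
    by (simp add: ip_commute)
  ultimately show False using x(2) by linarith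
qed

lemma roots_lattice: "x \<in> roots X \<Longrightarrow> x \<in> lattice \<and> ip X x x = 2"
proof -
  assume "x \<in> roots X"
  then obtain w k where w: "w \<in> coxeter_group X" and k: "k \<in> nodes" and x: "x = w (simple_root k)"
    by (auto simp: roots_def nodes_def)
  from w show ?thesis
    unfolding x
  proof induction
    case one
    then show ?case using k by (simp add: simple_root_lattice pair_simple_root)
  next
    case (mult w j)
    have "j \<in> nodes" using mult.hyps(2) by (simp add: nodes_def)
    then show ?case
      using mult.IH by (simp add: reflection_lattice reflection_norm)
  qed
qed

lemma reflection_roots: "k \<in> nodes \<Longrightarrow> x \<in> roots X \<Longrightarrow> refl k x \<in> roots X"
proof -
  assume k: "k \<in> nodes" and "x \<in> roots X"
  then obtain w j where w: "w \<in> coxeter_group X" "j \<in> {1..ade_rank X}" "x = w (simple_root j)"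
    by (auto simp: roots_def)
  have "refl k \<circ> w \<in> coxeter_group X"
    using k w(1) by (intro coxeter_group.mult) (simp_all add: nodes_def)
  then show ?thesis
    unfolding roots_def using w(2,3) by (intro CollectI exI[of _ "refl k \<circ> w"] exI[of _ j]) simp
qed

lemma Pos_roots: "x \<in> Pos \<Longrightarrow> x \<in> roots X"
  by (simp add: pos_roots_def)

lemma Pos_lattice: "x \<in> Pos \<Longrightarrow> x \<in> lattice" and Pos_norm: "x \<in> Pos \<Longrightarrow> ip X x x = 2"
  using roots_lattice Pos_roots by blast+

lemma Pos_nonneg: "x \<in> Pos \<Longrightarrow> 0 \<le> x i"
  using Pos_lattice[of x] by (cases "i \<in> nodes") (auto simp: pos_roots_def nodes_def lattice_def)

lemma Pos_nonzero: "x \<in> Pos \<Longrightarrow> x \<noteq> (\<lambda>i. 0)"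
  using Pos_norm[of x] by (auto simp: ip_cartan)

lemma simple_root_Pos [simp]: "k \<in> nodes \<Longrightarrow> simple_root k \<in> Pos"
proof -
  assume "k \<in> nodes"
  then have "simple_root k \<in> roots X"
    unfolding roots_def
    by (intro CollectI exI[of _ id] exI[of _ k]) (simp add: coxeter_group.one nodes_def)
  then show ?thesis by (simp add: pos_roots_def simple_root_def)
qed

lemma simple_root_eq_iff [simp]: "simple_root i = simple_root j \<longleftrightarrow> i = j"
proof
  assume "simple_root i = simple_root j"
  then have "simple_root i i = simple_root j i" by simp
  then show "i = j" by (simp add: simple_root_def split: if_splits)
qed simp

lemma Pos_le_simple_root:
  assumes x: "x \<in> Pos" and k: "k \<in> nodes" and le: "\<And>i. i \<noteq> k \<Longrightarrow> x i \<le> 0"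
  shows "x = simple_root k"
proof -
  have zero: "x i = 0" if "i \<noteq> k" for i
    using Pos_nonneg[OF x, of i] le[OF that] by simp
  then have "x = (\<lambda>i. 0 + x k * simple_root k i)" by (auto simp: simple_root_def)
  moreover have "ip X (\<lambda>i. 0 + x k * simple_root k i) (\<lambda>i. 0 + x k * simple_root k i)
      = 2 * x k ^ 2"
    by (subst norm_add_simple_root[OF k]) (simp add: ip_cartan)
  ultimately have "2 * x k ^ 2 = 2" using Pos_norm[OF x] by simp
  then have "x k = 1" using Pos_nonneg[OF x, of k] by (simp add: power2_eq_1_iff)
  then show ?thesis using zero by (auto simp: simple_root_def)
qed

text \<open>The reflection changes only the coordinate at \<open>k\<close>, so the sign could only flip if all other
  coordinates vanished.\<close>
lemma reflection_Pos:
  assumes k: "k \<in> nodes" and x: "x \<in> Pos" "x \<noteq> simple_root k"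
  shows "refl k x \<in> Pos"
proof -
  have R: "refl k x \<in> roots X" using k x Pos_roots reflection_roots by blast
  then have "(\<forall>i. 0 \<le> refl k x i) \<or> (\<forall>i. refl k x i \<le> 0)"
    using roots_lattice norm_2_sign by blast
  moreover have "\<not> (\<forall>i. refl k x i \<le> 0)"
  proof
    assume "\<forall>i. refl k x i \<le> 0"
    then have "x i \<le> 0" if "i \<noteq> k" for i
      using that by (auto simp: reflection_def simple_root_def dest!: spec[of _ i])
    then show False using Pos_le_simple_root[OF x(1) k] x(2) by blast
  qed
  ultimately show ?thesis using R by (simp add: pos_roots_def)
qed

lemma pair_Pos_cases:
  assumes k: "k \<in> nodes" and x: "x \<in> Pos" "x \<noteq> simple_root k"
  shows "pair k x = 0 \<or> pair k x = 1 \<or> pair k x = - 1"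
proof -
  have lat: "(\<lambda>i. x i + e * simple_root k i) \<in> lattice" if "e \<in> \<int>" for e
    using that Pos_lattice[OF x(1)] simple_root_lattice[OF k] by (auto simp: lattice_def)
  have "(\<lambda>i. x i + (- 1) * simple_root k i) \<noteq> (\<lambda>i. 0)"
  proof
    assume "(\<lambda>i. x i + (- 1) * simple_root k i) = (\<lambda>i. 0)"
    then have "x = simple_root k" by (auto simp: fun_eq_iff)
    then show False using x(2) by simp
  qed
  from lattice_norm_pos[OF lat this] have 1: "pair k x < 2"
    unfolding norm_add_simple_root[OF k] using Pos_norm[OF x(1)] by simp
  have "x k + simple_root k k \<noteq> 0"
    using Pos_nonneg[OF x(1), of k] by (simp add: simple_root_def)
  then have "(\<lambda>i. x i + 1 * simple_root k i) \<noteq> (\<lambda>i. 0)" by (auto simp: fun_eq_iff)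
  from lattice_norm_pos[OF lat this] have 2: "- 2 < pair k x"
    unfolding norm_add_simple_root[OF k] using Pos_norm[OF x(1)] by simp
  obtain m where m: "pair k x = real_of_int m"
    using pair_Ints[OF k Pos_lattice[OF x(1)]] by (elim Ints_cases)
  with 1 2 have "-2 < m" "m < 2" by auto
  then have "m = 0 \<or> m = 1 \<or> m = -1" by auto
  then show ?thesis using m by auto
qed

text \<open>A root is determined by its inner products with the simple roots, which take four values.\<close>
lemma finite_Pos: "finite Pos"
proof -
  let ?F = "\<lambda>x. \<lambda>k\<in>nodes. pair k x"
  have "?F ` Pos \<subseteq> nodes \<rightarrow>\<^sub>E {- 1, 0, 1, 2}"
    using pair_Pos_cases pair_simple_root by fastforce
  then have "finite (?F ` Pos)"
    by (rule finite_subset) (auto intro: finite_PiE)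
  moreover have "inj_on ?F Pos"
  proof (rule inj_onI)
    fix x y assume x: "x \<in> Pos" and y: "y \<in> Pos" and eq: "?F x = ?F y"
    let ?z = "\<lambda>i. x i + (- 1) * y i"
    have "pair k ?z = 0" if "k \<in> nodes" for k
      using fun_cong[OF eq, of k] that by (simp only: ip_add_scaled_right) simp
    then have "ip X ?z ?z = 0" unfolding ip_eq_sum_pair[of ?z ?z] by (intro sum.neutral ballI) (simp only: mult_zero_right)
    moreover have "?z \<in> lattice"
      using Pos_lattice[OF x] Pos_lattice[OF y] by (auto simp: lattice_def)
    ultimately have "?z = (\<lambda>i. 0)" using lattice_norm_pos by force
    then show "x = y" by (auto simp: fun_eq_iff)
  qed
  ultimately show ?thesis by (rule finite_imageD)
qed


section \<open>The maps \<open>\<tau>\<^sub>k\<close> in coordinates\<close>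
lemma pair_simple_root_same [simp]: "k \<in> nodes \<Longrightarrow> pair k (simple_root k) = 2"
  by (simp add: pair_simple_root)

text \<open>Otherwise the root \<open>s\<^sub>i x\<close> would have inner product \<open>-2\<close> with \<open>\<alpha>\<^sub>j\<close>.\<close>
lemma adjacent_not_both_minus_1:
  assumes "i \<in> nodes" "j \<in> nodes" "cartan i j = - 1" "x \<in> Pos" "pair i x = - 1"
  shows "pair j x \<noteq> - 1"
proof
  assume j: "pair j x = - 1"
  have ne: "x \<noteq> simple_root i" using assms by auto
  have "refl i x \<in> Pos" using assms ne by (simp add: reflection_Pos)
  moreover have "pair j (refl i x) = - 2"
    using assms j by (simp add: pair_reflection cartan_commute[of j])
  ultimately show False
    using pair_Pos_cases[of j "refl i x"] assms(2) by (cases "refl i x = simple_root j") auto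
qed

lemma reflection_eq_simple_root:
  assumes "i \<in> nodes" "j \<in> nodes" "cartan i j = 0" "x \<in> Pos" "refl i x = simple_root j"
  shows "x = simple_root j"
proof -
  have "x = refl i (simple_root j)" using assms reflection_reflection[of i x] by simp
  then show ?thesis using assms by (simp add: reflection_fixed pair_simple_root)
qed

text \<open>The coordinates of \<open>\<tau>\<^sub>k v\<close> in terms of those of \<open>v\<close>. Since the matrix is symmetric, this is also
  the functional \<open>f \<circ> \<tau>\<^sub>k\<close> when \<open>f\<close> holds the values of a functional on the basis.\<close>
definition tau :: "'r::comm_ring_1 \<Rightarrow> nat \<Rightarrow> (root \<Rightarrow> 'r) \<Rightarrow> root \<Rightarrow> 'r" where
  "tau r k f x =
    (if x \<in> Pos \<and> x \<noteq> simple_root k then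
       if pair k x = 0 then f x
       else if pair k x = 1 then r * f (refl k x)
       else (1 - r ^ 2) * f x + r * f (refl k x)
     else 0)"

lemma tau_simple_root [simp]: "tau r k f (simple_root k) = 0"
  by (simp add: tau_def)

lemma tau_outside [simp]: "x \<notin> Pos \<Longrightarrow> tau r k f x = 0"
  by (simp add: tau_def)

lemma tau_0: "x \<in> Pos \<Longrightarrow> k \<in> nodes \<Longrightarrow> pair k x = 0 \<Longrightarrow> tau r k f x = f x"
  and tau_1: "x \<in> Pos \<Longrightarrow> k \<in> nodes \<Longrightarrow> pair k x = 1 \<Longrightarrow> tau r k f x = r * f (refl k x)"
  and tau_m1: "x \<in> Pos \<Longrightarrow> k \<in> nodes \<Longrightarrow> pair k x = - 1 \<Longrightarrow>
    tau r k f x = (1 - r ^ 2) * f x + r * f (refl k x)"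
  by (auto simp: tau_def)

lemma tau_add: "tau r k (\<lambda>x. f x + g x) = (\<lambda>x. tau r k f x + tau r k g x)"
  by (rule ext) (simp add: tau_def algebra_simps)

lemma tau_scale: "tau r k (\<lambda>x. c * f x) = (\<lambda>x. c * tau r k f x)"
  by (rule ext) (simp add: tau_def algebra_simps)

lemma Pos_cases:
  assumes "k \<in> nodes" "x \<in> Pos"
  obtains (simple) "x = simple_root k" "pair k x = 2" | (zero) "pair k x = 0"
    | (one) "pair k x = 1" "x \<noteq> simple_root k" | (minus_one) "pair k x = - 1" "x \<noteq> simple_root k"
  using pair_Pos_cases[OF assms] assms by (cases "x = simple_root k") auto

text \<open>Away from \<open>\<alpha>\<^sub>k\<close>, which it kills, \<open>\<tau>\<^sub>k\<close> satisfies the quadratic relation of a Hecke algebra; in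
  particular it is invertible there once \<open>r\<close> is.\<close>
lemma tau_square:
  assumes k: "k \<in> nodes" and f0: "f (simple_root k) = 0" and out: "\<And>x. x \<notin> Pos \<Longrightarrow> f x = 0"
  shows "tau r k (tau r k f) = (\<lambda>x. (1 - r ^ 2) * tau r k f x + r ^ 2 * f x)"
proof
  fix x
  show "tau r k (tau r k f) x = (1 - r ^ 2) * tau r k f x + r ^ 2 * f x"
  proof (cases "x \<in> Pos")
    case True
    from k True show ?thesis
    proof (cases rule: Pos_cases)
      case simple
      then show ?thesis using f0 by simp
    next
      case zero
      then show ?thesis using True k by (simp add: tau_0 algebra_simps)
    next
      case one
      have "refl k x \<in> Pos" "pair k (refl k x) = - 1" "refl k (refl k x) = x"
        using one True k by (simp_all add: reflection_Pos pair_reflection reflection_reflection)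
      then show ?thesis
        using one True k by (simp add: tau_1 tau_m1 algebra_simps power2_eq_square)
    next
      case minus_one
      have "refl k x \<in> Pos" "pair k (refl k x) = 1" "refl k (refl k x) = x"
        using minus_one True k by (simp_all add: reflection_Pos pair_reflection reflection_reflection)
      then show ?thesis
        using minus_one True k by (simp add: tau_1 tau_m1 algebra_simps power2_eq_square)
    qed
  qed (simp add: out)
qed

lemma tau_commute:
  assumes i: "i \<in> nodes" and j: "j \<in> nodes" and c: "cartan i j = 0"
  shows "tau r i (tau r j f) = tau r j (tau r i f)"
proof
  fix x
  have c': "cartan j i = 0" using c by (simp add: cartan_commute)
  show "tau r i (tau r j f) x = tau r j (tau r i f) x"
  proof (cases "x \<in> Pos")
    case x: True
    have Pi: "x \<noteq> simple_root i \<Longrightarrow> refl i x \<in> Pos" and Pj: "x \<noteq> simple_root j \<Longrightarrow> refl j x \<in> Pos"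
      using x i j by (simp_all add: reflection_Pos)
    have ci: "pair i (refl j x) = pair i x" and cj: "pair j (refl i x) = pair j x"
      using i j c c' by (simp_all add: pair_reflection)
    from i x show ?thesis
    proof (cases rule: Pos_cases)
      case simple
      then show ?thesis
        using i j c' by (simp add: tau_0 pair_simple_root)
    next
      case xi: zero
      from j x show ?thesis
      proof (cases rule: Pos_cases)
        case simple
        then show ?thesis
          using i j c by (simp add: tau_0 pair_simple_root)
      qed (use xi x i j Pj ci in \<open>simp_all add: tau_0 tau_1 tau_m1\<close>)
    next
      case xi: one
      from j x show ?thesis
      proof (cases rule: Pos_cases)
        case simple
        then show ?thesis
          using i j c xi by (simp add: pair_simple_root)
      qed (use xi x i j Pi Pj ci cj in \<open>simp_all add: tau_0 tau_1 tau_m1 reflection_commute[OF i j c]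
        algebra_simps\<close>)
    next
      case xi: minus_one
      from j x show ?thesis
      proof (cases rule: Pos_cases)
        case simple
        then show ?thesis
          using i j c xi by (simp add: pair_simple_root)
      qed (use xi x i j Pi Pj ci cj in \<open>simp_all add: tau_0 tau_1 tau_m1 reflection_commute[OF i j c]
        algebra_simps\<close>)
    qed
  qed simp
qed

lemma reflection_simple_root_adjacent:
  assumes "i \<in> nodes" "j \<in> nodes" "cartan i j = - 1"
  shows "refl i (simple_root j) = refl j (simple_root i)"
  using assms by (auto simp: reflection_def pair_simple_root cartan_commute[of j i])

lemma reflection_ne_simple_root:
  assumes "k \<in> nodes" "x \<in> Pos" "x \<noteq> simple_root k"
  shows "refl k x \<noteq> simple_root k"
proof
  assume "refl k x = simple_root k"
  then have "pair k (refl k x) = 2" using assms(1) by simp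
  then show False using assms pair_Pos_cases[OF assms] by (auto simp: pair_reflection)
qed

text \<open>The reflection permutes the positive roots other than \<open>\<alpha>\<^sub>k\<close>, which matches the off-diagonal
  terms of the two sides.\<close>
lemma tau_self_adjoint:
  assumes k: "k \<in> nodes"
  shows "(\<Sum>x\<in>Pos. f x * tau r k g x) = (\<Sum>x\<in>Pos. tau r k f x * g x)"
proof -
  let ?P = "Pos - {simple_root k}"
  define d where "d = (\<lambda>x. if pair k x = 0 then 1 else if pair k x = 1 then 0 else 1 - r ^ 2)"
  define e where "e = (\<lambda>x. if pair k x = 0 then 0 else r)"
  have tau: "tau r k h x = d x * h x + e x * h (refl k x)" if "x \<in> ?P" for h x
    using that by (simp add: tau_def d_def e_def)
  have e: "e (refl k x) = e x" for x
    using k by (simp add: e_def pair_reflection)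
  have bij: "bij_betw (refl k) ?P ?P"
    using k by (intro bij_betw_byWitness[where f' = "refl k"])
      (auto simp: reflection_Pos reflection_reflection reflection_ne_simple_root)
  have "(\<Sum>x\<in>?P. f x * (e x * g (refl k x))) = (\<Sum>x\<in>?P. f (refl k x) * (e (refl k x) * g (refl k (refl k x))))"
    using sum.reindex_bij_betw[OF bij, of "\<lambda>x. f x * (e x * g (refl k x))"] by simp
  also have "\<dots> = (\<Sum>x\<in>?P. e x * f (refl k x) * g x)"
    using k by (simp add: e reflection_reflection mult_ac)
  finally have swap: "(\<Sum>x\<in>?P. f x * (e x * g (refl k x))) = (\<Sum>x\<in>?P. e x * f (refl k x) * g x)" .
  have P: "(\<Sum>x\<in>Pos. h x) = (\<Sum>x\<in>?P. h x)" if "h (simple_root k) = 0" for h :: "root \<Rightarrow> 'a"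
    using that by (intro sum.mono_neutral_right) (auto simp: finite_Pos)
  have "(\<Sum>x\<in>Pos. f x * tau r k g x) = (\<Sum>x\<in>?P. f x * (d x * g x) + f x * (e x * g (refl k x)))"
    by (subst P) (simp_all add: tau distrib_left)
  also have "\<dots> = (\<Sum>x\<in>?P. d x * f x * g x + e x * f (refl k x) * g x)"
    unfolding sum.distrib swap by (simp add: mult_ac)
  also have "\<dots> = (\<Sum>x\<in>Pos. tau r k f x * g x)"
    by (subst P) (simp_all add: tau distrib_right)
  finally show ?thesis .
qed

lemma tau_braid:
  assumes i: "i \<in> nodes" and j: "j \<in> nodes" and c: "cartan i j = - 1"
  shows "tau r i (tau r j (tau r i f)) = tau r j (tau r i (tau r j f))"
proof
  fix x
  let ?b = "refl i (simple_root j)"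
  have c': "cartan j i = - 1" using c by (simp add: cartan_commute)
  have ne: "i \<noteq> j" using c by auto
  note R = pair_reflection c c'
  have b: "?b \<in> Pos" "refl j (simple_root i) = ?b" "pair i ?b = 1" "pair j ?b = 1"
    "refl i ?b = simple_root j" "refl j ?b = simple_root i"
    using i j ne c reflection_simple_root_adjacent[OF i j c] reflection_reflection[of i "simple_root j"]
      reflection_reflection[of j "simple_root i"]
    by (simp_all add: reflection_Pos R pair_simple_root)
  show "tau r i (tau r j (tau r i f)) x = tau r j (tau r i (tau r j f)) x"
  proof (cases "x \<in> Pos")
    case x: True
    \<comment> \<open>The three exceptional values of \<open>x\<close> are the positive roots of the rank two subsystem. The orbit
      of any other \<open>x\<close> under the two reflections consists of one or three positive roots.\<close>
    show ?thesis
    proof (cases "x = simple_root i \<or> x = simple_root j \<or> x = ?b")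
      case True
      then show ?thesis
        using i j b c c' ne
        by (auto simp: tau_0 tau_1 tau_m1 pair_simple_root algebra_simps power2_eq_square)
    next
      case False
      have P: "refl i x \<in> Pos" "refl j x \<in> Pos"
        using False x i j by (simp_all add: reflection_Pos)
      have ne2: "refl i x \<noteq> simple_root j" "refl j x \<noteq> simple_root i"
        using False i j b reflection_reflection[of i x] reflection_reflection[of j x] by auto
      have P2: "refl i (refl j x) \<in> Pos" "refl j (refl i x) \<in> Pos"
        using P ne2 i j by (simp_all add: reflection_Pos)
      have rr: "refl i (refl i y) = y" "refl j (refl j y) = y" for y
        using i j by (simp_all add: reflection_reflection)
      have p: "pair i (refl j x) = pair i x + pair j x" "pair j (refl i x) = pair j x + pair i x"
        "pair i (refl i y) = - pair i y" "pair j (refl j y) = - pair j y"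
        "pair i (refl j (refl i x)) = pair j x" "pair j (refl i (refl j x)) = pair i x" for y
        using i j by (simp_all add: R)
      have cases: "pair i x = 0 \<or> pair i x = 1 \<or> pair i x = - 1"
        "pair j x = 0 \<or> pair j x = 1 \<or> pair j x = - 1"
        "pair i x + pair j x = 0 \<or> pair i x + pair j x = 1 \<or> pair i x + pair j x = - 1"
        using pair_Pos_cases[OF i x] pair_Pos_cases[OF j x] pair_Pos_cases[OF i P(2) ne2(2)] p False
        by auto
      note T = i j x P P2 p tau_0 tau_1 tau_m1 reflection_fixed rr
      show ?thesis
      proof (cases "pair i x = 0")
        case pi: True
        show ?thesis
        proof (cases "pair j x = 0")
          case True
          then show ?thesis using pi by (simp add: T)
        next
          case nz: False
          have f: "refl i x = x" using pi by (simp add: reflection_fixed)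
          show ?thesis
            using cases nz pi by (auto simp: T f algebra_simps power2_eq_square)
        qed
      next
        case pi: False
        show ?thesis
        proof (cases "pair j x = 0")
          case True
          have f: "refl j x = x" using True by (simp add: reflection_fixed)
          show ?thesis
            using cases True pi by (auto simp: T f algebra_simps power2_eq_square)
        next
          case nz: False
          then have s: "pair i x + pair j x = 0" using cases pi by auto
          have "refl i (refl j x) = refl j x" "refl j (refl i x) = refl i x"
            using s p by (simp_all add: reflection_fixed)
          moreover have "pair i x = 1 \<and> pair j x = - 1 \<or> pair i x = - 1 \<and> pair j x = 1"
            using s cases pi by auto
          ultimately show ?thesis
            using s by (auto simp: T algebra_simps power2_eq_square)
        qed
      qed
    qed
  qed simp
qed


section \<open>Construction of the coefficients\<close>

text \<open>By the quadratic relation, this is \<open>r\<^sup>2\<close> times the inverse of \<open>\<tau>\<^sub>k\<close> on functions vanishing at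
  \<open>\<alpha>\<^sub>k\<close>. The factor \<open>r\<^sup>2\<close> keeps the values polynomial in \<open>r\<close>.\<close>
definition R_step :: "'r::comm_ring_1 \<Rightarrow> nat \<Rightarrow> (root \<Rightarrow> 'r) \<Rightarrow> root \<Rightarrow> 'r" where
  "R_step r k f = (\<lambda>x. tau r k f x + (r ^ 2 - 1) * f x)"

text \<open>The path from \<open>x\<close> up to a maximal root is left open here; \<open>R_fun_unique\<close> shows that it does not
  affect the result.\<close>
inductive R_fun :: "'r::comm_ring_1 \<Rightarrow> root \<Rightarrow> (root \<Rightarrow> 'r) \<Rightarrow> bool" for r where
  top: "x \<in> Pos \<Longrightarrow> (\<And>k. k \<in> nodes \<Longrightarrow> pair k x \<noteq> - 1) \<Longrightarrow> R_fun r x (\<lambda>y. if y = x then 1 else 0)"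
| step: "x \<in> Pos \<Longrightarrow> k \<in> nodes \<Longrightarrow> pair k x = - 1 \<Longrightarrow> R_fun r (refl k x) f \<Longrightarrow> R_fun r x (R_step r k f)"

lemma reflection_minus_1: "pair k x = - 1 \<Longrightarrow> refl k x i = x i + simple_root k i"
  by (simp add: reflection_def)

lemma minus_1_Pos:
  assumes "k \<in> nodes" "x \<in> Pos" "pair k x = - 1"
  shows "x \<noteq> simple_root k" "refl k x \<in> Pos" "pair k (refl k x) = 1" "refl k x \<noteq> simple_root k"
proof -
  show ne: "x \<noteq> simple_root k" using assms by auto
  show "refl k x \<in> Pos" using ne assms by (simp add: reflection_Pos)
  show "pair k (refl k x) = 1" using assms by (simp add: pair_reflection)
  show "refl k x \<noteq> simple_root k" using ne assms by (simp add: reflection_ne_simple_root)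
qed

text \<open>Each step increases the height, and there are finitely many positive roots.\<close>
lemma wf_raising: "wf {(refl k x, x) | k x. k \<in> nodes \<and> x \<in> Pos \<and> pair k x = - 1}"
proof (rule wf_subset)
  define ht where "ht = (\<lambda>x :: root. \<Sum>i\<in>nodes. x i)"
  show "wf (measure (\<lambda>x. card {y \<in> Pos. ht x < ht y}))" by simp
  show "{(refl k x, x) | k x. k \<in> nodes \<and> x \<in> Pos \<and> pair k x = - 1}
      \<subseteq> measure (\<lambda>x. card {y \<in> Pos. ht x < ht y})"
  proof (rule subrelI)
    fix y x assume "(y, x) \<in> {(refl k x, x) | k x. k \<in> nodes \<and> x \<in> Pos \<and> pair k x = - 1}"
    then obtain k where y: "y = refl k x" and k: "k \<in> nodes" "x \<in> Pos" "pair k x = - 1"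
      by blast
    have "ht y = (\<Sum>i\<in>nodes. x i + simple_root k i)"
      unfolding y ht_def using k by (intro sum.cong) (simp_all add: reflection_minus_1)
    also have "\<dots> = ht x + 1"
      using k(1) by (simp add: ht_def sum.distrib simple_root_def)
    finally have ht: "ht y = ht x + 1" .
    have "y \<in> Pos" unfolding y by (rule minus_1_Pos(2)[OF k])
    then have "y \<in> {z \<in> Pos. ht x < ht z}" using ht by simp
    moreover have "y \<notin> {z \<in> Pos. ht y < ht z}" by simp
    moreover have "{z \<in> Pos. ht y < ht z} \<subseteq> {z \<in> Pos. ht x < ht z}" using ht by auto
    ultimately have "{z \<in> Pos. ht y < ht z} \<subset> {z \<in> Pos. ht x < ht z}" by blast
    then have "card {z \<in> Pos. ht y < ht z} < card {z \<in> Pos. ht x < ht z}"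
      by (intro psubset_card_mono) (simp_all add: finite_Pos)
    then show "(y, x) \<in> measure (\<lambda>x. card {y \<in> Pos. ht x < ht y})" by simp
  qed
qed

lemma R_step_commute:
  assumes "i \<in> nodes" "j \<in> nodes" "cartan i j = 0"
  shows "R_step r i (R_step r j f) = R_step r j (R_step r i f)"
  unfolding R_step_def tau_add tau_scale tau_commute[OF assms]
  by (rule ext) (simp add: algebra_simps)

lemma raising_induct [consumes 1, case_names raise]:
  assumes "x \<in> Pos"
    and "\<And>x. x \<in> Pos \<Longrightarrow> (\<And>k. k \<in> nodes \<Longrightarrow> pair k x = - 1 \<Longrightarrow> P (refl k x)) \<Longrightarrow> P x"
  shows "P x"
  using assms(1)
proof (induction x rule: wf_induct_rule[OF wf_raising])
  case (1 x)
  show ?case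
  proof (rule assms(2)[OF 1(2)])
    fix k assume k: "k \<in> nodes" "pair k x = - 1"
    show "P (refl k x)"
      using k 1(2) by (intro 1(1) minus_1_Pos(2)) auto
  qed
qed

lemma raising_induct_two_steps [consumes 1, case_names raise]:
  assumes "x \<in> Pos"
    and "\<And>x. x \<in> Pos \<Longrightarrow> (\<And>k. k \<in> nodes \<Longrightarrow> pair k x = - 1 \<Longrightarrow> P (refl k x)) \<Longrightarrow>
      (\<And>k l. k \<in> nodes \<Longrightarrow> pair k x = - 1 \<Longrightarrow> l \<in> nodes \<Longrightarrow> pair l (refl k x) = - 1 \<Longrightarrow>
        P (refl l (refl k x))) \<Longrightarrow> P x"
  shows "P x"
proof -
  have "P x \<and> (\<forall>k\<in>nodes. pair k x = - 1 \<longrightarrow> P (refl k x))"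
    using assms(1)
  proof (induction x rule: raising_induct)
    case (raise x)
    have 1: "P (refl k x)" if "k \<in> nodes" "pair k x = - 1" for k
      using raise(2)[OF that] by blast
    have 2: "P (refl l (refl k x))"
      if "k \<in> nodes" "pair k x = - 1" "l \<in> nodes" "pair l (refl k x) = - 1" for k l
      using raise(2)[OF that(1,2)] that(3,4) by blast
    show ?case using assms(2)[OF raise(1) 1 2] 1 by blast
  qed
  then show ?thesis by blast
qed

lemma R_fun_exists: "x \<in> Pos \<Longrightarrow> \<exists>f. R_fun r x f"
proof (induction x rule: raising_induct)
  case (raise x)
  show ?case
  proof (cases "\<exists>k\<in>nodes. pair k x = - 1")
    case False
    then show ?thesis using R_fun.top[OF raise(1)] by blast
  next
    case True
    then show ?thesis using R_fun.step[OF raise(1)] raise(2) by blast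
  qed
qed

text \<open>Two nodes along which \<open>x\<close> can be raised are not adjacent, so the two steps commute and meet at the
  root raised along both.\<close>
lemma R_fun_unique: "x \<in> Pos \<Longrightarrow> R_fun r x f \<Longrightarrow> R_fun r x g \<Longrightarrow> f = g"
proof (induction x arbitrary: f g rule: raising_induct)
  case (raise x)
  have step_eq: "R_step r i f' = R_step r k g'"
    if i: "i \<in> nodes" "pair i x = - 1" "R_fun r (refl i x) f'"
      and k: "k \<in> nodes" "pair k x = - 1" "R_fun r (refl k x) g'" for i k f' g'
  proof (cases "i = k")
    case True
    then show ?thesis using raise(2)[OF i(1,2) i(3)] k(3) by blast
  next
    case False
    have c: "cartan i k = 0"
      using cartan_cases[OF False] adjacent_not_both_minus_1[OF i(1) k(1) _ raise(1) i(2)] k(2)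
      by auto
    have p: "pair i (refl k x) = - 1" "pair k (refl i x) = - 1"
      using i k c by (simp_all add: pair_reflection cartan_commute[of k i])
    have x: "refl k x \<in> Pos" "refl i x \<in> Pos"
      using minus_1_Pos(2)[OF k(1) raise(1) k(2)] minus_1_Pos(2)[OF i(1) raise(1) i(2)] by simp_all
    have comm: "refl i (refl k x) = refl k (refl i x)"
      by (rule reflection_commute[OF i(1) k(1) c])
    obtain h where h: "R_fun r (refl k (refl i x)) h"
      using R_fun_exists[OF minus_1_Pos(2)[OF k(1) x(2) p(2)]] by blast
    have "R_fun r (refl i x) (R_step r k h)"
      by (rule R_fun.step[OF x(2) k(1) p(2) h])
    then have f': "f' = R_step r k h" by (rule raise(2)[OF i])
    have "R_fun r (refl k x) (R_step r i h)"
      by (rule R_fun.step[OF x(1) i(1) p(1)]) (simp add: comm h)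
    then have g': "g' = R_step r i h" by (rule raise(2)[OF k])
    show ?thesis unfolding f' g' by (rule R_step_commute[OF i(1) k(1) c])
  qed
  from raise(3) show ?case
  proof cases
    case top
    with raise(4) show ?thesis by cases auto
  next
    case f: (step i f')
    from raise(4) show ?thesis
    proof cases
      case top
      then show ?thesis using f by auto
    next
      case g: (step k g')
      show ?thesis
        unfolding f(1) g(1) by (rule step_eq[OF f(3,4,5) g(3,4,5)])
    qed
  qed
qed

definition R_poly :: "'r::comm_ring_1 \<Rightarrow> root \<Rightarrow> root \<Rightarrow> 'r" where
  "R_poly r x = (THE f. R_fun r x f)"

lemma R_fun_R_poly: "x \<in> Pos \<Longrightarrow> R_fun r x (R_poly r x)"
  unfolding R_poly_def
  by (rule theI'[of "R_fun r x"]) (metis R_fun_exists R_fun_unique)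

lemma R_poly_step:
  assumes "k \<in> nodes" "x \<in> Pos" "pair k x = - 1"
  shows "R_poly r x = R_step r k (R_poly r (refl k x))"
  by (rule R_fun_unique[OF assms(2) R_fun_R_poly[OF assms(2)]
        R_fun.step[OF assms(2,1,3) R_fun_R_poly[OF minus_1_Pos(2)[OF assms]]]])

lemma R_poly_top:
  assumes "x \<in> Pos" "\<And>k. k \<in> nodes \<Longrightarrow> pair k x \<noteq> - 1"
  shows "R_poly r x = (\<lambda>y. if y = x then 1 else 0)"
  by (rule R_fun_unique[OF assms(1) R_fun_R_poly[OF assms(1)] R_fun.top[OF assms]])

text \<open>Triangularity, in the coordinatewise order. It yields the vanishing of \<open>\<phi>\<^sub>x\<close> at all simple roots
  other than \<open>x\<close>, without which the quadratic relation could not be applied to \<open>\<phi>\<^sub>x\<close>.\<close>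
lemma R_poly_nonzero_le:
  assumes "x \<in> Pos" "R_poly r x y \<noteq> 0"
  shows "y \<in> Pos \<and> (\<forall>i. x i \<le> y i)"
  using assms
proof (induction x arbitrary: y rule: raising_induct)
  case (raise x)
  show ?case
  proof (cases "\<exists>k\<in>nodes. pair k x = - 1")
    case False
    then have "y = x" using raise(1,3) R_poly_top[of x r] by (auto split: if_splits)
    then show ?thesis using raise(1) by simp
  next
    case True
    then obtain k where k: "k \<in> nodes" "pair k x = - 1" by blast
    let ?f = "R_poly r (refl k x)"
    have le: "z \<in> Pos \<and> (\<forall>i. x i + simple_root k i \<le> z i)" if "?f z \<noteq> 0" for z
      using raise(2)[OF k that] by (simp add: reflection_minus_1[OF k(2)])
    have pos: "0 \<le> simple_root k i" for i by (simp add: simple_root_def)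
    have "tau r k ?f y \<noteq> 0 \<or> ?f y \<noteq> 0"
      using raise(3) R_poly_step[OF k(1) raise(1) k(2), of r] by (auto simp: R_step_def)
    then have "?f y \<noteq> 0 \<or> y \<in> Pos \<and> y \<noteq> simple_root k \<and> ?f (refl k y) \<noteq> 0"
      by (auto simp: tau_def split: if_splits)
    then show ?thesis
    proof
      assume "?f y \<noteq> 0"
      then show ?thesis using le[of y] pos by (smt (verit))
    next
      assume y: "y \<in> Pos \<and> y \<noteq> simple_root k \<and> ?f (refl k y) \<noteq> 0"
      then have "- 1 \<le> pair k y" using pair_Pos_cases[of k y] k(1) by auto
      then have "- pair k y * simple_root k i \<le> simple_root k i" for i
        by (simp add: simple_root_def)
      moreover have "x i + simple_root k i \<le> y i + - pair k y * simple_root k i" for i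
        using le[of "refl k y"] y by (simp add: reflection_def)
      ultimately have "x i \<le> y i" for i by (smt (verit))
      then show ?thesis using y by simp
    qed
  qed
qed

lemma R_poly_outside: "x \<in> Pos \<Longrightarrow> y \<notin> Pos \<Longrightarrow> R_poly r x y = 0"
  using R_poly_nonzero_le by blast

lemma R_poly_simple_root:
  assumes "x \<in> Pos" "k \<in> nodes" "x \<noteq> simple_root k"
  shows "R_poly r x (simple_root k) = 0"
proof (rule ccontr)
  assume "R_poly r x (simple_root k) \<noteq> 0"
  then have "x i \<le> simple_root k i" for i using R_poly_nonzero_le assms(1) by blast
  then have "x i \<le> 0" if "i \<noteq> k" for i using that by (force simp: simple_root_def dest: spec[of _ i])
  then show False using Pos_le_simple_root assms by blast
qed

lemma R_poly_diagonal: "x \<in> Pos \<Longrightarrow> \<exists>m. R_poly r x x = r ^ m"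
proof (induction x rule: raising_induct)
  case (raise x)
  show ?case
  proof (cases "\<exists>k\<in>nodes. pair k x = - 1")
    case False
    then have "R_poly r x x = r ^ 0" using R_poly_top[of x r] raise(1) by auto
    then show ?thesis by blast
  next
    case True
    then obtain k where k: "k \<in> nodes" "pair k x = - 1" by blast
    then obtain m where m: "R_poly r (refl k x) (refl k x) = r ^ m" using raise(2) by blast
    have "R_poly r (refl k x) x = 0"
    proof (rule ccontr)
      assume "R_poly r (refl k x) x \<noteq> 0"
      then have "refl k x k \<le> x k"
        using R_poly_nonzero_le[OF minus_1_Pos(2)[OF k(1) raise(1) k(2)]] by blast
      then show False using reflection_minus_1[OF k(2), of k] by (simp add: simple_root_def)
    qed
    then have "R_poly r x x = r ^ Suc m"
      unfolding R_poly_step[OF k(1) raise(1) k(2)] R_step_def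
      using k raise(1) m by (simp add: tau_m1)
    then show ?thesis by blast
  qed
qed

text \<open>Let \<open>x\<close> be raised along \<open>j\<close>. If \<open>i\<close> and \<open>j\<close> are not adjacent, the step along \<open>j\<close> commutes with
  \<open>\<tau>\<^sub>i\<close>. If they are adjacent, the raised root can be raised again along \<open>i\<close>, to a root orthogonal to
  \<open>\<alpha>\<^sub>j\<close>; the invariance of its function under \<open>\<tau>\<^sub>j\<close> becomes invariance under \<open>\<tau>\<^sub>i\<close> by the braid
  relation \<open>\<tau>\<^sub>i \<tau>\<^sub>j\<^sup>-\<^sup>1 \<tau>\<^sub>i\<^sup>-\<^sup>1 = \<tau>\<^sub>j\<^sup>-\<^sup>1 \<tau>\<^sub>i\<^sup>-\<^sup>1 \<tau>\<^sub>j\<close>. The induction therefore has to reach two steps up.\<close>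
lemma tau_R_poly_orthogonal:
  assumes "x \<in> Pos" "i \<in> nodes" "pair i x = 0"
  shows "tau r i (R_poly r x) = R_poly r x"
  using assms
proof (induction x arbitrary: i rule: raising_induct_two_steps)
  case (raise x)
  note i = raise(4,5)
  show ?case
  proof (cases "\<exists>k\<in>nodes. pair k x = - 1")
    case False
    then have top: "R_poly r x = (\<lambda>y. if y = x then 1 else 0)"
      using R_poly_top raise(1) by blast
    show ?thesis
    proof
      fix y
      show "tau r i (R_poly r x) y = R_poly r x y"
      proof (cases "y = x \<or> y \<notin> Pos")
        case True
        then show ?thesis using i raise(1) by (auto simp: top tau_0)
      next
        case False
        have "refl i y \<noteq> x"
          using False reflection_reflection[OF i(1), of y] reflection_fixed[OF i(2)] by metis
        then show ?thesis using False by (simp add: top tau_def)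
      qed
    qed
  next
    case True
    then obtain j where j: "j \<in> nodes" "pair j x = - 1" by blast
    let ?y = "refl j x" and ?f = "R_poly r (refl j x)"
    note y = minus_1_Pos[OF j(1) raise(1) j(2)]
    have xy: "R_poly r x = R_step r j ?f" by (rule R_poly_step[OF j(1) raise(1) j(2)])
    have ne: "i \<noteq> j" using i(2) j(2) by auto
    show ?thesis
    proof (cases "cartan i j = 0")
      case True
      have "tau r i ?f = ?f"
        by (rule raise(2)[OF j i(1)]) (use i j True in \<open>simp add: pair_reflection\<close>)
      then show ?thesis
        unfolding xy R_step_def
        by (simp only: tau_add tau_scale tau_commute[OF i(1) j(1) True])
    next
      case False
      then have c: "cartan i j = - 1" "cartan j i = - 1"
        using cartan_cases[OF ne] by (simp_all add: cartan_commute)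
      have pi: "pair i ?y = - 1" using i j c by (simp add: pair_reflection)
      let ?z = "refl i ?y" and ?g = "R_poly r (refl i (refl j x))"
      note z = minus_1_Pos[OF i(1) y(2) pi]
      have pj: "pair j ?z = 0" using i j c y by (simp add: pair_reflection)
      have yz: "?f = R_step r i ?g" by (rule R_poly_step[OF i(1) y(2) pi])
      have inv: "tau r j ?g = ?g"
        by (rule raise(3)[OF j i(1) pi j(1) pj])
      have g0: "?g (simple_root i) = 0"
        by (rule R_poly_simple_root[OF z(2) i(1) z(4)])
      have sq: "tau r i (tau r i ?g) = (\<lambda>x. (1 - r ^ 2) * tau r i ?g x + r ^ 2 * ?g x)"
        by (rule tau_square[where f = ?g, OF i(1) g0]) (rule R_poly_outside[OF z(2)])
      have br: "tau r i (tau r j (tau r i ?g)) = tau r j (tau r i ?g)"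
        using tau_braid[OF i(1) j(1) c(1), of r ?g] inv by simp
      show ?thesis
        unfolding xy yz R_step_def tau_add tau_scale inv br sq
        by (rule ext) (simp add: algebra_simps power2_eq_square)
    qed
  qed
qed

lemma tau_R_step:
  assumes "k \<in> nodes" "f (simple_root k) = 0" "\<And>x. x \<notin> Pos \<Longrightarrow> f x = 0"
  shows "tau r k (R_step r k f) = (\<lambda>x. r ^ 2 * f x)"
  unfolding R_step_def tau_add tau_scale
  by (rule ext) (simp add: tau_square[where f = f, OF assms] algebra_simps)

text \<open>Both functions come from that of the root \<open>\<alpha>\<^sub>i + \<alpha>\<^sub>j\<close>, and both sides equal \<open>r\<^sup>2\<close> times the
  latter.\<close>
lemma tau_R_poly_simple_adjacent:
  assumes i: "i \<in> nodes" and j: "j \<in> nodes" and c: "cartan i j = - 1"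
  shows "tau r i (R_poly r (simple_root j)) = tau r j (R_poly r (simple_root i))"
proof -
  have *: "tau r i (R_poly r (simple_root j))
      = (\<lambda>x. r ^ 2 * R_poly r (refl i (simple_root j)) x)"
    if ij: "i \<in> nodes" "j \<in> nodes" "cartan i j = - 1" for i j
  proof -
    have p: "pair i (simple_root j) = - 1" using ij by (simp add: pair_simple_root)
    note b = minus_1_Pos[OF ij(1) simple_root_Pos[OF ij(2)] p]
    show ?thesis
      unfolding R_poly_step[OF ij(1) simple_root_Pos[OF ij(2)] p]
      by (rule tau_R_step[where f = "R_poly r (refl i (simple_root j))", OF ij(1)
            R_poly_simple_root[OF b(2) ij(1) b(4)] R_poly_outside[OF b(2)]])
  qed
  show ?thesis
    using *[OF i j c] *[OF j i] c reflection_simple_root_adjacent[OF i j c]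
    by (simp add: cartan_commute)
qed


section \<open>The maps \<open>\<sigma>\<^sub>k\<close> in coordinates\<close>
definition form :: "(root \<Rightarrow> 'r::comm_ring_1) \<Rightarrow> (root \<Rightarrow> 'r) \<Rightarrow> 'r" where
  "form f v = (\<Sum>x\<in>Pos. f x * v x)"

definition unit_vec :: "nat \<Rightarrow> root \<Rightarrow> 'r::comm_ring_1" where
  "unit_vec k x = (if x = simple_root k then 1 else 0)"

definition sigma :: "'r::comm_ring_1 \<Rightarrow> 'r \<Rightarrow> (nat \<Rightarrow> root \<Rightarrow> 'r) \<Rightarrow> nat \<Rightarrow> (root \<Rightarrow> 'r) \<Rightarrow> root \<Rightarrow> 'r" where
  "sigma r t \<phi> k v = (\<lambda>x. tau r k v x + t * form (\<phi> k) v * unit_vec k x)"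

text \<open>The conditions on the functionals under which the braid relations between the \<open>\<tau>\<^sub>k\<close> extend to
  the \<open>\<sigma>\<^sub>k\<close>.\<close>
definition compatible :: "'r::comm_ring_1 \<Rightarrow> (nat \<Rightarrow> root \<Rightarrow> 'r) \<Rightarrow> bool" where
  "compatible r \<phi> \<longleftrightarrow>
    (\<forall>k\<in>nodes. \<forall>x. x \<notin> Pos \<longrightarrow> \<phi> k x = 0) \<and>
    (\<forall>i\<in>nodes. \<forall>j\<in>nodes. i \<noteq> j \<longrightarrow> \<phi> j (simple_root i) = 0) \<and>
    (\<forall>i\<in>nodes. \<forall>j\<in>nodes. cartan i j = 0 \<longrightarrow> tau r i (\<phi> j) = \<phi> j) \<and>
    (\<forall>i\<in>nodes. \<forall>j\<in>nodes. cartan i j = - 1 \<longrightarrow> tau r i (\<phi> j) = tau r j (\<phi> i))"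

lemma compatible_R_poly: "compatible r (\<lambda>k. R_poly r (simple_root k))"
  unfolding compatible_def
  by (intro conjI ballI allI impI; (rule tau_R_poly_simple_adjacent)?;
      simp add: R_poly_outside R_poly_simple_root tau_R_poly_orthogonal pair_simple_root)

lemma form_add: "form f (\<lambda>x. v x + w x) = form f v + form f w"
  by (simp add: form_def distrib_left sum.distrib)

lemma form_scale: "form f (\<lambda>x. c * v x) = c * form f v"
  by (simp add: form_def sum_distrib_left mult.left_commute)

lemma form_add_left: "form (\<lambda>x. f x + g x) v = form f v + form g v"
  by (simp add: form_def distrib_right sum.distrib)

lemma form_scale_left: "form (\<lambda>x. c * f x) v = c * form f v"
  by (simp add: form_def sum_distrib_left mult.assoc)

lemma form_unit_vec: "k \<in> nodes \<Longrightarrow> form f (unit_vec k) = f (simple_root k)"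
  by (simp add: form_def unit_vec_def finite_Pos if_distrib[of "\<lambda>t. _ * t"] cong: if_cong)

lemma form_tau: "k \<in> nodes \<Longrightarrow> form f (tau r k v) = form (tau r k f) v"
  unfolding form_def by (rule tau_self_adjoint)

lemma tau_unit_vec_same: "k \<in> nodes \<Longrightarrow> tau r k (unit_vec k) = (\<lambda>x. 0)"
  using reflection_ne_simple_root by (auto simp: tau_def unit_vec_def fun_eq_iff)

lemma tau_unit_vec_orthogonal:
  assumes "i \<in> nodes" "j \<in> nodes" "cartan i j = 0"
  shows "tau r i (unit_vec j) = unit_vec j"
proof
  fix x
  have p: "pair i (simple_root j) = 0" using assms by (simp add: pair_simple_root)
  have "simple_root j \<noteq> simple_root i" using assms by auto
  then show "tau r i (unit_vec j) x = unit_vec j x"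
    using assms p reflection_eq_simple_root[OF assms, of x]
    by (cases "x = simple_root j") (auto simp: tau_def unit_vec_def)
qed

lemma tau_unit_vec_adjacent:
  fixes r :: "'r::comm_ring_1"
  assumes i: "i \<in> nodes" and j: "j \<in> nodes" and c: "cartan i j = - 1"
  defines "b \<equiv> refl i (simple_root j)"
  defines "e \<equiv> \<lambda>x. if x = b then 1 else 0"
  shows "tau r i (unit_vec j) = (\<lambda>x. (1 - r ^ 2) * unit_vec j x + r * e x)"
    and "tau r i e = (\<lambda>x. r * unit_vec j x)"
proof -
  have p: "pair i (simple_root j) = - 1" using assms by (simp add: pair_simple_root)
  note b = minus_1_Pos[OF i simple_root_Pos[OF j] p, folded b_def]
  have bj: "refl i b = simple_root j" unfolding b_def by (rule reflection_reflection[OF i])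
  have ne: "b \<noteq> simple_root j" using b(3) p by auto
  have rx: "refl i x = simple_root j \<longleftrightarrow> x = b" "refl i x = b \<longleftrightarrow> x = simple_root j" for x
    using reflection_reflection[OF i, of x] bj b_def by metis+
  have ji: "simple_root j \<noteq> simple_root i" using c by auto
  have other: "tau r i f x = (if x \<in> Pos \<and> x \<noteq> simple_root i \<and> pair i x = 0 then f x else 0)"
    if "f x = 0" "f (refl i x) = 0" for f :: "root \<Rightarrow> 'r" and x
    using that by (simp add: tau_def)
  show "tau r i (unit_vec j) = (\<lambda>x. (1 - r ^ 2) * unit_vec j x + r * e x)"
  proof
    fix x
    consider "x = b" | "x = simple_root j" | "x \<noteq> b" "x \<noteq> simple_root j" by blast
    then show "tau r i (unit_vec j) x = (1 - r ^ 2) * unit_vec j x + r * e x"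
    proof cases
      case 1
      show ?thesis unfolding 1 using i b(2,3) ne bj by (simp add: tau_1 unit_vec_def e_def)
    next
      case 2
      show ?thesis unfolding 2 using i j p ne[symmetric]
        by (simp add: tau_m1 unit_vec_def e_def flip: b_def)
    next
      case 3
      then show ?thesis using other[of "unit_vec j" x] rx(1)[of x] by (simp add: unit_vec_def e_def)
    qed
  qed
  show "tau r i e = (\<lambda>x. r * unit_vec j x)"
  proof
    fix x
    consider "x = b" | "x = simple_root j" | "x \<noteq> b" "x \<noteq> simple_root j" by blast
    then show "tau r i e x = r * unit_vec j x"
    proof cases
      case 1
      show ?thesis unfolding 1 using i b(2,3) ne bj ne[symmetric] by (simp add: tau_1 unit_vec_def e_def)
    next
      case 2
      show ?thesis unfolding 2 using i j p ne[symmetric]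
        by (simp add: tau_m1 unit_vec_def e_def flip: b_def)
    next
      case 3
      then show ?thesis using other[of e x] rx(2)[of x] by (simp add: unit_vec_def e_def)
    qed
  qed
qed

lemma tau_tau_unit_vec:
  assumes i: "i \<in> nodes" and j: "j \<in> nodes" and c: "cartan i j = - 1"
  shows "tau r j (tau r i (unit_vec j)) = (\<lambda>x. r ^ 2 * unit_vec i x)"
proof -
  have c': "cartan j i = - 1" using c by (simp add: cartan_commute)
  have b: "refl j (simple_root i) = refl i (simple_root j)"
    by (rule reflection_simple_root_adjacent[OF j i c'])
  show ?thesis
    unfolding tau_unit_vec_adjacent(1)[OF i j c] tau_add tau_scale tau_unit_vec_same[OF j]
      tau_unit_vec_adjacent(2)[OF j i c', unfolded b]
    by (simp add: power2_eq_square mult.assoc)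
qed

lemma sigma_add: "sigma r t \<phi> k (\<lambda>x. v x + w x) = (\<lambda>x. sigma r t \<phi> k v x + sigma r t \<phi> k w x)"
  unfolding sigma_def tau_add form_add by (simp add: algebra_simps)

lemma sigma_scale: "sigma r t \<phi> k (\<lambda>x. c * v x) = (\<lambda>x. c * sigma r t \<phi> k v x)"
  unfolding sigma_def tau_scale form_scale by (simp add: algebra_simps)

lemma sigma_unit_vec:
  assumes "compatible r \<phi>" "i \<in> nodes" "j \<in> nodes" "i \<noteq> j"
  shows "sigma r t \<phi> j (unit_vec i) = tau r j (unit_vec i)"
  using assms by (simp add: sigma_def form_unit_vec compatible_def)

lemma sigma_sigma:
  assumes "compatible r \<phi>" "i \<in> nodes" "j \<in> nodes" "i \<noteq> j"
  shows "sigma r t \<phi> j (sigma r t \<phi> i v) =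
    (\<lambda>x. tau r j (tau r i v) x + t * form (\<phi> j) (tau r i v) * unit_vec j x
      + t * form (\<phi> i) v * tau r j (unit_vec i) x)"
proof -
  have "sigma r t \<phi> j (sigma r t \<phi> i v) =
    (\<lambda>x. sigma r t \<phi> j (tau r i v) x + t * form (\<phi> i) v * sigma r t \<phi> j (unit_vec i) x)"
    unfolding sigma_def[of r t \<phi> i v] sigma_add sigma_scale ..
  then show ?thesis
    unfolding sigma_unit_vec[OF assms] by (simp add: sigma_def[of r t \<phi> j "tau r i v"])
qed

lemma sigma_commute:
  assumes \<phi>: "compatible r \<phi>" and i: "i \<in> nodes" and j: "j \<in> nodes" and c: "cartan i j = 0"
  shows "sigma r t \<phi> i (sigma r t \<phi> j v) = sigma r t \<phi> j (sigma r t \<phi> i v)"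
proof -
  have c': "cartan j i = 0" and ne: "i \<noteq> j" using c by (auto simp: cartan_commute)
  have "form (\<phi> j) (tau r i v) = form (\<phi> j) v" "form (\<phi> i) (tau r j v) = form (\<phi> i) v"
    using \<phi> i j c c' by (simp_all add: form_tau compatible_def)
  then show ?thesis
    unfolding sigma_sigma[OF \<phi> i j ne] sigma_sigma[OF \<phi> j i ne[symmetric]]
      tau_unit_vec_orthogonal[OF i j c] tau_unit_vec_orthogonal[OF j i c'] tau_commute[OF i j c]
    by (simp add: algebra_simps)
qed

text \<open>Once \<open>\<phi>\<^sub>i(\<tau>\<^sub>j \<tau>\<^sub>i v) = \<phi>\<^sub>j(\<tau>\<^sub>i \<tau>\<^sub>i v)\<close> has been rewritten by the quadratic relation, the
  \<open>t\<close>-linear part is symmetric in \<open>i\<close> and \<open>j\<close>, and the higher powers of \<open>t\<close> vanish.\<close>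
lemma sigma_sigma_sigma:
  fixes r t :: "'r::comm_ring_1"
  assumes \<phi>: "compatible r \<phi>" and i: "i \<in> nodes" and j: "j \<in> nodes" and c: "cartan i j = - 1"
  defines "e \<equiv> \<lambda>x. if x = refl i (simple_root j) then 1 else 0"
  shows "sigma r t \<phi> i (sigma r t \<phi> j (sigma r t \<phi> i v)) =
    (\<lambda>x. tau r i (tau r j (tau r i v)) x
      + t * r ^ 2 * (form (\<phi> i) v * unit_vec j x + form (\<phi> j) v * unit_vec i x)
      + t * form (\<phi> j) (tau r i v) * ((1 - r ^ 2) * (unit_vec i x + unit_vec j x) + r * e x))"
proof -
  have c': "cartan j i = - 1" and ne: "i \<noteq> j" using c by (auto simp: cartan_commute)
  have swap: "tau r j (\<phi> i) = tau r i (\<phi> j)" using \<phi> i j c' by (simp add: compatible_def)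
  have sq: "tau r i (tau r i (\<phi> j)) = (\<lambda>x. (1 - r ^ 2) * tau r i (\<phi> j) x + r ^ 2 * \<phi> j x)"
    using \<phi> i j ne by (intro tau_square) (simp_all add: compatible_def)
  have fj: "form (\<phi> i) (tau r j (tau r i v)) =
      (1 - r ^ 2) * form (\<phi> j) (tau r i v) + r ^ 2 * form (\<phi> j) v"
    unfolding form_tau[OF i] form_tau[OF j] swap sq by (simp add: form_add_left form_scale_left)
  have 0: "form (\<phi> i) (tau r j (unit_vec i)) = 0"
    using i j swap by (simp add: form_tau form_unit_vec)
  have s: "sigma r t \<phi> i (tau r j (unit_vec i)) = (\<lambda>x. r ^ 2 * unit_vec j x)"
    unfolding sigma_def 0 tau_tau_unit_vec[OF j i c'] by simp
  have s': "sigma r t \<phi> i (unit_vec j) = (\<lambda>x. (1 - r ^ 2) * unit_vec j x + r * e x)"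
    unfolding sigma_unit_vec[OF \<phi> j i ne[symmetric]] e_def by (rule tau_unit_vec_adjacent(1)[OF i j c])
  have s'': "sigma r t \<phi> i (tau r j (tau r i v)) = (\<lambda>x. tau r i (tau r j (tau r i v)) x
      + t * ((1 - r ^ 2) * form (\<phi> j) (tau r i v) + r ^ 2 * form (\<phi> j) v) * unit_vec i x)"
    unfolding sigma_def fj ..
  show ?thesis
    unfolding sigma_sigma[OF \<phi> i j ne] sigma_add sigma_scale s s' s''
    by (rule ext) (simp add: algebra_simps)
qed

lemma sigma_braid:
  assumes \<phi>: "compatible r \<phi>" and i: "i \<in> nodes" and j: "j \<in> nodes" and c: "cartan i j = - 1"
  shows "sigma r t \<phi> i (sigma r t \<phi> j (sigma r t \<phi> i v)) = sigma r t \<phi> j (sigma r t \<phi> i (sigma r t \<phi> j v))"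
proof -
  have c': "cartan j i = - 1" using c by (simp add: cartan_commute)
  have "tau r i (\<phi> j) = tau r j (\<phi> i)"
    using \<phi> i j c unfolding compatible_def by blast
  then have "form (\<phi> j) (tau r i v) = form (\<phi> i) (tau r j v)"
    unfolding form_tau[OF i] form_tau[OF j] by (rule arg_cong)
  then show ?thesis
    unfolding sigma_sigma_sigma[OF \<phi> i j c] sigma_sigma_sigma[OF \<phi> j i c'] tau_braid[OF i j c]
      reflection_simple_root_adjacent[OF i j c]
    by (simp add: algebra_simps)
qed

lemma tau_ignores_simple_root:
  "k \<in> nodes \<Longrightarrow> tau r k (\<lambda>x. if x = simple_root k then c else f x) = tau r k f"
  using reflection_ne_simple_root by (auto simp: tau_def fun_eq_iff)

text \<open>The image of \<open>\<tau>\<^sub>k\<close> has no component at \<open>\<alpha>\<^sub>k\<close>, so a vector killed by \<open>\<sigma>\<^sub>k\<close> is killed by \<open>\<tau>\<^sub>k\<close> and by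
  \<open>\<phi>\<^sub>k\<close> separately. The quadratic relation makes it a multiple of the basis vector at \<open>\<alpha>\<^sub>k\<close>, where
  \<open>\<phi>\<^sub>k\<close> takes a unit value.\<close>
lemma sigma_injective:
  assumes k: "k \<in> nodes" and units: "r * r' = 1" "t * t' = 1" "\<phi> k (simple_root k) * u = 1"
    and out: "\<And>x. x \<notin> Pos \<Longrightarrow> v x = 0" and 0: "\<And>x. sigma r t \<phi> k v x = 0"
  shows "v x = 0"
proof -
  let ?v = "\<lambda>x. if x = simple_root k then 0 else v x"
  have "t * form (\<phi> k) v = 0"
    using 0[of "simple_root k"] by (simp add: sigma_def unit_vec_def)
  then have "(t * t') * form (\<phi> k) v = 0" by (metis mult.commute mult.assoc mult_zero_left)
  then have f0: "form (\<phi> k) v = 0" using units by simp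
  have "tau r k v = (\<lambda>x. 0)" using 0 by (simp add: sigma_def f0 fun_eq_iff)
  then have tau0: "tau r k ?v = (\<lambda>x. 0)" using tau_ignores_simple_root[OF k, of r 0 v] by simp
  have "tau r k (tau r k ?v) = (\<lambda>x. (1 - r ^ 2) * tau r k ?v x + r ^ 2 * ?v x)"
    using out by (intro tau_square[OF k]) auto
  moreover have "tau r k (\<lambda>x. 0) = (\<lambda>x. 0)" by (rule ext) (simp add: tau_def)
  ultimately have eq: "(\<lambda>x. r ^ 2 * ?v x) = (\<lambda>x. 0)" unfolding tau0 by simp
  have "r ^ 2 * ?v x = 0" for x using fun_cong[OF eq, of x] .
  then have "r' ^ 2 * (r ^ 2 * ?v x) = 0" for x by (simp only: mult_zero_right)
  then have "(r * r') ^ 2 * ?v x = 0" for x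
    by (simp only: power_mult_distrib mult_ac)
  then have v0: "?v x = 0" for x using units by simp
  have v0': "v x = 0" if "x \<noteq> simple_root k" for x
    using v0[of x] that by simp
  then have "v = (\<lambda>x. v (simple_root k) * unit_vec k x)"
    by (intro ext) (auto simp: unit_vec_def)
  then have "form (\<phi> k) v = form (\<phi> k) (\<lambda>x. v (simple_root k) * unit_vec k x)"
    by (rule arg_cong)
  also have "\<dots> = v (simple_root k) * \<phi> k (simple_root k)"
    unfolding form_scale form_unit_vec[OF k] ..
  finally have "v (simple_root k) * \<phi> k (simple_root k) = 0" using f0 by simp
  then have "v (simple_root k) * (\<phi> k (simple_root k) * u) = 0"
    by (simp only: mult.assoc[symmetric] mult_zero_left)
  then have "v (simple_root k) = 0" unfolding units(3) by simp
  then show ?thesis using v0' by (cases "x = simple_root k") simp_all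
qed

lemma sigma_surjective:
  assumes k: "k \<in> nodes" and units: "r * r' = 1" "t * t' = 1" "\<phi> k (simple_root k) * u = 1"
    and out: "\<And>x. x \<notin> Pos \<Longrightarrow> v x = 0"
  shows "\<exists>w. (\<forall>x. x \<notin> Pos \<longrightarrow> w x = 0) \<and> sigma r t \<phi> k w = v"
proof -
  let ?v = "\<lambda>x. if x = simple_root k then 0 else v x"
  \<comment> \<open>\<open>w0\<close> is the preimage under \<open>\<tau>\<^sub>k\<close> that the quadratic relation provides; \<open>c\<close> then adjusts the
    coordinate at \<open>\<alpha>\<^sub>k\<close>, on which \<open>\<tau>\<^sub>k\<close> does not depend.\<close>
  define w0 where "w0 = (\<lambda>x. r' ^ 2 * (tau r k ?v x + (r ^ 2 - 1) * ?v x))"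
  define c where "c = u * (t' * v (simple_root k) - form (\<phi> k) w0)"
  let ?w = "\<lambda>x. w0 x + c * unit_vec k x"
  have sq: "tau r k (tau r k ?v) = (\<lambda>x. (1 - r ^ 2) * tau r k ?v x + r ^ 2 * ?v x)"
    using out by (intro tau_square[OF k]) auto
  have "tau r k w0 = (\<lambda>x. r' ^ 2 * (tau r k (tau r k ?v) x + (r ^ 2 - 1) * tau r k ?v x))"
    unfolding w0_def tau_scale tau_add ..
  also have "\<dots> = (\<lambda>x. (r * r') ^ 2 * ?v x)"
    unfolding sq by (rule ext) (simp add: power_mult_distrib algebra_simps)
  finally have "tau r k w0 = ?v" using units by simp
  then have tau: "tau r k ?w = ?v"
    unfolding tau_add tau_scale tau_unit_vec_same[OF k] by simp
  have "t * form (\<phi> k) ?w = t * (form (\<phi> k) w0 + (\<phi> k (simple_root k) * u) *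
      (t' * v (simple_root k) - form (\<phi> k) w0))"
    unfolding form_add form_scale form_unit_vec[OF k] c_def by (simp add: algebra_simps)
  also have "\<dots> = (t * t') * v (simple_root k)"
    unfolding units(3) mult_1_left add_diff_eq add_diff_cancel_left' mult.assoc ..
  finally have form: "t * form (\<phi> k) ?w = v (simple_root k)" using units by simp
  have "sigma r t \<phi> k ?w = v"
    unfolding sigma_def tau form by (rule ext) (simp add: unit_vec_def)
  moreover have "?w x = 0" if "x \<notin> Pos" for x
  proof -
    have "x \<noteq> simple_root k" using that k by auto
    then show ?thesis using out that by (simp add: w0_def unit_vec_def)
  qed
  ultimately show ?thesis by (intro exI[of _ ?w] conjI allI impI)
qed

end


section \<open>Homomorphisms from a presented group\<close>
fun eval_word :: "('a, 'm) monoid_scheme \<Rightarrow> ('g \<Rightarrow> 'a) \<Rightarrow> 'g word \<Rightarrow> 'a" where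
  "eval_word G h [] = \<one>\<^bsub>G\<^esub>"
| "eval_word G h ((s, e) # w) = (if e then h s else inv\<^bsub>G\<^esub> (h s)) \<otimes>\<^bsub>G\<^esub> eval_word G h w"

lemma eval_word_closed:
  assumes "group G" "h \<in> S \<rightarrow> carrier G" "w \<in> words S"
  shows "eval_word G h w \<in> carrier G"
proof -
  interpret group G by fact
  show ?thesis
    using assms(3)
  proof (induction w)
    case (Cons a w)
    then show ?case using assms(2) by (cases a) auto
  qed simp
qed

lemma eval_word_append:
  assumes "group G" "h \<in> S \<rightarrow> carrier G" "u \<in> words S" "v \<in> words S"
  shows "eval_word G h (u @ v) = eval_word G h u \<otimes>\<^bsub>G\<^esub> eval_word G h v"
proof -
  interpret group G by fact
  note closed = eval_word_closed[OF assms(1,2)]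
  show ?thesis
    using assms(3)
  proof (induction u)
    case Nil
    then show ?case using closed[OF assms(4)] by simp
  next
    case (Cons a u)
    then show ?case
      using funcset_mem[OF assms(2)] closed[of u] closed[OF assms(4)]
      by (cases a) (auto simp: m_assoc)
  qed
qed

lemma eval_word_pres_rel:
  assumes G: "group G" and h: "h \<in> S \<rightarrow> carrier G"
    and R: "\<And>u v. (u, v) \<in> R \<Longrightarrow> u \<in> words S \<Longrightarrow> v \<in> words S \<Longrightarrow> eval_word G h u = eval_word G h v"
    and uv: "(u, v) \<in> pres_rel S R"
  shows "eval_word G h u = eval_word G h v"
proof -
  interpret group G by fact
  from uv show ?thesis
  proof induction
    case (append u v u' v')
    have "u \<in> words S" "v \<in> words S" "u' \<in> words S" "v' \<in> words S"
      using append.hyps pres_rel_words by blast+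
    then show ?case using append.IH by (simp add: eval_word_append[OF G h])
  next
    case (cancel s e)
    then have "h s \<in> carrier G" using h by blast
    then show ?case by simp
  qed (use R in simp_all)
qed

lemma carrier_presented_group: "carrier (presented_group S R) = words S // pres_rel S R"
  by (simp add: presented_group_def)

lemma hom_presented_group_eval:
  assumes G: "group G" and \<rho>: "\<rho> \<in> hom (presented_group S R) G"
    and gen: "\<And>s. s \<in> S \<Longrightarrow> \<rho> (pres_gen S R s) = h s" and w: "w \<in> words S"
  shows "\<rho> (pres_rel S R `` {w}) = eval_word G h w"
proof -
  interpret G: group G by fact
  interpret P: group "presented_group S R" by (rule group_presented_group)
  interpret group_hom "presented_group S R" G \<rho>
    using \<rho> by unfold_locales
  let ?c = "\<lambda>u. pres_rel S R `` {u}"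
  have one: "?c [] = \<one>\<^bsub>presented_group S R\<^esub>" by (simp add: presented_group_def)
  have car: "?c u \<in> carrier (presented_group S R)" if "u \<in> words S" for u
    using that by (simp add: carrier_presented_group quotientI)
  have letter: "\<rho> (?c [(s, e)]) = (if e then h s else inv\<^bsub>G\<^esub> (h s))" if s: "s \<in> S" for s e
  proof (cases e)
    case True
    then show ?thesis using gen[OF s] by (simp add: pres_gen_def)
  next
    case False
    have "?c [(s, False)] \<otimes>\<^bsub>presented_group S R\<^esub> ?c [(s, True)] = ?c []"
      using s equiv_class_eq[OF equiv_pres_rel pres_rel.cancel[of s S False R]]
      by (subst pres_mult_class) auto
    then have "\<rho> (?c [(s, False)]) \<otimes>\<^bsub>G\<^esub> \<rho> (?c [(s, True)]) = \<one>\<^bsub>G\<^esub>"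
      using s car by (metis (no_types, lifting) hom_mult hom_one one lists.Cons lists.Nil SigmaI UNIV_I)
    moreover have "\<rho> (?c [(s, b)]) \<in> carrier G" for b using s by (intro hom_closed car) auto
    ultimately have "\<rho> (?c [(s, False)]) = inv\<^bsub>G\<^esub> (\<rho> (?c [(s, True)]))"
      by (metis G.inv_equality)
    then show ?thesis using gen[OF s] False by (simp add: pres_gen_def)
  qed
  show ?thesis
    using w
  proof (induction w)
    case Nil
    then show ?case by (simp add: one)
  next
    case (Cons a w)
    obtain s e where a: "a = (s, e)" by (cases a)
    have s: "s \<in> S" "[(s, e)] \<in> words S" using Cons.hyps a by auto
    have "?c (a # w) = ?c [(s, e)] \<otimes>\<^bsub>presented_group S R\<^esub> ?c w"
      using s Cons.hyps by (subst pres_mult_class) (auto simp: a)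
    then show ?case
      using Cons s car by (simp add: a letter)
  qed
qed

lemma presented_group_universal:
  assumes G: "group G" and h: "h \<in> S \<rightarrow> carrier G"
    and R: "\<And>u v. (u, v) \<in> R \<Longrightarrow> u \<in> words S \<Longrightarrow> v \<in> words S \<Longrightarrow> eval_word G h u = eval_word G h v"
  shows "\<exists>!\<rho>. \<rho> \<in> hom (presented_group S R) G \<and> \<rho> \<in> extensional (carrier (presented_group S R)) \<and>
    (\<forall>s\<in>S. \<rho> (pres_gen S R s) = h s)"
proof (rule ex_ex1I)
  let ?c = "\<lambda>u. pres_rel S R `` {u}"
  let ?B = "presented_group S R"
  interpret G: group G by fact
  define \<rho> where "\<rho> = (\<lambda>X\<in>carrier ?B. eval_word G h (SOME u. u \<in> X))"
  have car: "?c u \<in> carrier ?B" if "u \<in> words S" for u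
    using that by (simp add: carrier_presented_group quotientI)
  have \<rho>: "\<rho> (?c u) = eval_word G h u" if u: "u \<in> words S" for u
  proof -
    have "u \<in> ?c u" using u by (simp add: pres_rel.refl)
    then have "(SOME u'. u' \<in> ?c u) \<in> ?c u" by (rule someI)
    then have "eval_word G h u = eval_word G h (SOME u'. u' \<in> ?c u)"
      by (intro eval_word_pres_rel[OF G h R]) auto
    then show ?thesis using car[OF u] by (simp add: \<rho>_def)
  qed
  have "\<rho> \<in> hom ?B G"
  proof (rule homI)
    fix x y assume "x \<in> carrier ?B" "y \<in> carrier ?B"
    then obtain u v where u: "u \<in> words S" "x = ?c u" and v: "v \<in> words S" "y = ?c v"
      unfolding carrier_presented_group by (elim quotientE) blast
    then show "\<rho> x \<in> carrier G" by (simp add: \<rho> eval_word_closed[OF G h])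
    have "u @ v \<in> words S" using u(1) v(1) by simp
    then show "\<rho> (x \<otimes>\<^bsub>?B\<^esub> y) = \<rho> x \<otimes>\<^bsub>G\<^esub> \<rho> y"
      unfolding u(2) v(2) pres_mult_class[OF u(1) v(1)]
      by (simp add: \<rho> u(1) v(1) eval_word_append[OF G h])
  qed
  moreover have "\<rho> (pres_gen S R s) = h s" if "s \<in> S" for s
    using that h by (auto simp: pres_gen_def \<rho> Pi_iff)
  ultimately show "\<exists>\<rho>. \<rho> \<in> hom ?B G \<and> \<rho> \<in> extensional (carrier ?B) \<and> (\<forall>s\<in>S. \<rho> (pres_gen S R s) = h s)"
    by (intro exI[of _ \<rho>]) (simp add: \<rho>_def)
  fix f g
  assume f: "f \<in> hom ?B G \<and> f \<in> extensional (carrier ?B) \<and> (\<forall>s\<in>S. f (pres_gen S R s) = h s)"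
    and g: "g \<in> hom ?B G \<and> g \<in> extensional (carrier ?B) \<and> (\<forall>s\<in>S. g (pres_gen S R s) = h s)"
  note f' = hom_presented_group_eval[OF G, where \<rho> = f and h = h]
    and g' = hom_presented_group_eval[OF G, where \<rho> = g and h = h]
  show "f = g"
  proof (rule extensionalityI[of f "carrier ?B" g])
    fix x assume "x \<in> carrier ?B"
    then obtain u where u: "u \<in> words S" "x = ?c u"
      unfolding carrier_presented_group by (elim quotientE) blast
    show "f x = g x"
      unfolding u(2) using f g f'[OF _ _ u(1)] g'[OF _ _ u(1)] by simp
  qed (use f g in auto)
qed


section \<open>Free modules and extension of scalars\<close>
lemma free_mod_lookup: "v \<in> free_mod I \<Longrightarrow> x \<notin> I \<Longrightarrow> Poly_Mapping.lookup v x = 0"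
  by (auto simp: free_mod_def in_keys_iff)

lemma free_modI: "(\<And>x. x \<notin> I \<Longrightarrow> Poly_Mapping.lookup v x = 0) \<Longrightarrow> v \<in> free_mod I"
  by (auto simp: free_mod_def in_keys_iff)

lemma free_mod_exists:
  assumes "finite I" "\<And>x. x \<notin> I \<Longrightarrow> g x = 0"
  shows "\<exists>v\<in>free_mod I. Poly_Mapping.lookup v = g"
proof -
  have "{x. g x \<noteq> 0} \<subseteq> I" using assms(2) by blast
  then have "finite {x. g x \<noteq> 0}" using assms(1) finite_subset by blast
  then have "Poly_Mapping.lookup (Poly_Mapping.Abs_poly_mapping g) = g"
    by (simp add: Poly_Mapping.Abs_poly_mapping_inverse)
  then show ?thesis using assms(2) by (intro bexI[of _ "Poly_Mapping.Abs_poly_mapping g"] free_modI) simp_all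
qed

lemma bvec_free_mod: "b \<in> I \<Longrightarrow> bvec b \<in> free_mod I"
  by (rule free_modI) (auto simp: lookup_single when_def)

lemma sum_free_mod: "(\<And>b. b \<in> A \<Longrightarrow> f b \<in> free_mod I) \<Longrightarrow> (\<Sum>b\<in>A. f b) \<in> free_mod I"
  by (rule free_modI) (auto simp: lookup_sum intro!: sum.neutral intro: free_mod_lookup)

lemma lookup_lin_ext:
  assumes "finite I" "v \<in> free_mod I"
  shows "Poly_Mapping.lookup (lin_ext I f v) x
    = (\<Sum>b\<in>I. Poly_Mapping.lookup v b * Poly_Mapping.lookup (f b) x)"
proof -
  have "Poly_Mapping.lookup (lin_ext I f v) x
      = (\<Sum>b\<in>Poly_Mapping.keys v. Poly_Mapping.lookup v b * Poly_Mapping.lookup (f b) x)"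
    using assms(2) by (simp add: lin_ext_def lookup_sum lookup_fm_scale)
  also have "\<dots> = (\<Sum>b\<in>I. Poly_Mapping.lookup v b * Poly_Mapping.lookup (f b) x)"
    using assms by (intro sum.mono_neutral_left) (auto simp: free_mod_def in_keys_iff)
  finally show ?thesis .
qed

lemma lin_ext_free_mod:
  assumes "\<And>b. b \<in> I \<Longrightarrow> f b \<in> free_mod I" "v \<in> free_mod I"
  shows "lin_ext I f v \<in> free_mod I"
proof -
  have "(\<Sum>b\<in>Poly_Mapping.keys v. Poly_Mapping.lookup v b *\<^sub>f f b) \<in> free_mod I"
    using assms by (intro sum_free_mod free_mod_smult) (auto simp: free_mod_def)
  then show ?thesis using assms(2) by (simp add: lin_ext_def)
qed

lemma linear_lin_ext: "finite I \<Longrightarrow> linear_on I (lin_ext I f)"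
  unfolding linear_on_def
  by (intro conjI ballI allI poly_mapping_eqI)
    (simp_all add: lookup_lin_ext free_mod_add free_mod_smult lookup_add lookup_fm_scale
      distrib_right sum.distrib sum_distrib_left mult.assoc)

lemma linear_on_sum:
  fixes f :: "('b \<Rightarrow>\<^sub>0 'r::comm_ring_1) \<Rightarrow> ('b \<Rightarrow>\<^sub>0 'r)"
  assumes lin: "linear_on I f" and A: "A \<subseteq> I" "finite A"
  shows "f (\<Sum>b\<in>A. c b *\<^sub>f bvec b) = (\<Sum>b\<in>A. c b *\<^sub>f f (bvec b))"
  using A(2,1)
proof (induction A rule: finite_induct)
  case empty
  have zero: "(0 :: 'r) *\<^sub>f u = 0" for u :: "'b \<Rightarrow>\<^sub>0 'r"
    by (rule poly_mapping_eqI) (simp add: lookup_fm_scale)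
  have "(0 :: 'b \<Rightarrow>\<^sub>0 'r) \<in> free_mod I" by (simp add: free_mod_def)
  then have "f (0 *\<^sub>f 0) = 0 *\<^sub>f f 0" using lin by (simp only: linear_on_def)
  then show ?case by (simp add: zero)
next
  case (insert a A)
  have "bvec a \<in> free_mod I" using insert.prems by (simp add: bvec_free_mod)
  then have 1: "f (c a *\<^sub>f bvec a) = c a *\<^sub>f f (bvec a)" "c a *\<^sub>f bvec a \<in> free_mod I"
    using lin free_mod_smult by (auto simp: linear_on_def)
  have 2: "(\<Sum>b\<in>A. c b *\<^sub>f bvec b) \<in> free_mod I"
    using insert.prems by (auto intro!: sum_free_mod free_mod_smult bvec_free_mod)
  have "f (c a *\<^sub>f bvec a + (\<Sum>b\<in>A. c b *\<^sub>f bvec b))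
      = f (c a *\<^sub>f bvec a) + f (\<Sum>b\<in>A. c b *\<^sub>f bvec b)"
    using lin 1(2) 2 by (simp add: linear_on_def)
  then show ?case using insert 1(1) by simp
qed

lemma free_mod_expand:
  assumes "finite I" "v \<in> free_mod I"
  shows "v = (\<Sum>b\<in>I. Poly_Mapping.lookup v b *\<^sub>f bvec b)"
proof (rule poly_mapping_eqI)
  fix x
  have "(\<Sum>b\<in>I. Poly_Mapping.lookup v b * Poly_Mapping.lookup (bvec b) x)
      = (\<Sum>b\<in>I. if b = x then Poly_Mapping.lookup v b else 0)"
    by (intro sum.cong) (auto simp: lookup_single when_def)
  then show "Poly_Mapping.lookup v x = Poly_Mapping.lookup (\<Sum>b\<in>I. Poly_Mapping.lookup v b *\<^sub>f bvec b) x"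
    using assms free_mod_lookup[OF assms(2)] by (simp add: lookup_sum lookup_fm_scale)
qed

lemma lookup_linear:
  assumes "finite I" "linear_on I f" "v \<in> free_mod I"
  shows "Poly_Mapping.lookup (f v) x
    = (\<Sum>b\<in>I. Poly_Mapping.lookup v b * Poly_Mapping.lookup (f (bvec b)) x)"
proof -
  have "f v = (\<Sum>b\<in>I. Poly_Mapping.lookup v b *\<^sub>f f (bvec b))"
    using linear_on_sum[OF assms(2) order_refl assms(1)] free_mod_expand[OF assms(1,3)] by metis
  then show ?thesis by (simp add: lookup_sum lookup_fm_scale)
qed

lemma GL_iff: "f \<in> carrier (GL I) \<longleftrightarrow> f \<in> Bij (free_mod I) \<and> linear_on I f"
  by (simp add: GL_def)

lemma GL_mult:
  "f \<in> carrier (GL I) \<Longrightarrow> g \<in> carrier (GL I) \<Longrightarrow> f \<otimes>\<^bsub>GL I\<^esub> g = compose (free_mod I) f g"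
  by (simp add: GL_def BijGroup_def)

lemma GL_one: "\<one>\<^bsub>GL I\<^esub> = (\<lambda>v\<in>free_mod I. v)"
  by (simp add: GL_def BijGroup_def)

lemma GL_closed: "f \<in> carrier (GL I) \<Longrightarrow> v \<in> free_mod I \<Longrightarrow> f v \<in> free_mod I"
  using Bij_imp_funcset by (auto simp: GL_iff)

lemma GL_extensional: "f \<in> carrier (GL I) \<Longrightarrow> f \<in> extensional (free_mod I)"
  using Bij_imp_extensional by (auto simp: GL_iff)

lemma GL_eqI:
  assumes "f \<in> carrier (GL I)" "g \<in> carrier (GL I)"
    and "\<And>v x. v \<in> free_mod I \<Longrightarrow> Poly_Mapping.lookup (f v) x = Poly_Mapping.lookup (g v) x"
  shows "f = g"
  using assms GL_extensional by (intro extensionalityI[of f "free_mod I" g] poly_mapping_eqI) auto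

lemma bij_linear_GL:
  fixes f :: "('b \<Rightarrow>\<^sub>0 'r::comm_ring_1) \<Rightarrow> ('b \<Rightarrow>\<^sub>0 'r)"
  assumes ext: "f \<in> extensional (free_mod I)" "g \<in> extensional (free_mod I)"
    and lin: "linear_on I f"
    and closed: "\<And>v. v \<in> free_mod I \<Longrightarrow> f v \<in> free_mod I" "\<And>v. v \<in> free_mod I \<Longrightarrow> g v \<in> free_mod I"
    and inv: "\<And>v. v \<in> free_mod I \<Longrightarrow> g (f v) = v" "\<And>v. v \<in> free_mod I \<Longrightarrow> f (g v) = v"
  shows "f \<in> carrier (GL I)"
proof -
  have "bij_betw f (free_mod I) (free_mod I)"
    using closed inv by (intro bij_betw_byWitness[where f' = g]) auto
  then show ?thesis using ext lin by (simp add: GL_iff Bij_def)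
qed

lemma lookup_map:
  "h 0 = 0 \<Longrightarrow> Poly_Mapping.lookup (Poly_Mapping.map h u) x = h (Poly_Mapping.lookup u x)"
  by (simp add: Poly_Mapping.map.rep_eq when_def)

lemma lookup_base_change:
  assumes "finite I" "h 0 = 0" "v \<in> free_mod I"
  shows "Poly_Mapping.lookup (base_change h I f v) x
    = (\<Sum>b\<in>I. Poly_Mapping.lookup v b * h (Poly_Mapping.lookup (f (bvec b)) x))"
  unfolding base_change_def lookup_lin_ext[OF assms(1,3)] lookup_map[where h = h, OF assms(2)] ..

text \<open>A ring homomorphism is compatible with matrix products; invertibility of the image follows from
  the image of the inverse.\<close>
lemma base_change_hom:
  fixes h :: "'r::comm_ring_1 \<Rightarrow> 's::comm_ring_1" and I :: "'b set"
  assumes I: "finite I"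
    and add: "\<And>a b. h (a + b) = h a + h b" and mult: "\<And>a b. h (a * b) = h a * h b" and one: "h 1 = 1"
  shows "base_change h I \<in> hom (GL I) (GL I)"
proof -
  interpret G: group "GL I :: (('b \<Rightarrow>\<^sub>0 'r) \<Rightarrow> ('b \<Rightarrow>\<^sub>0 'r)) monoid" by (rule group_GL)
  have zero: "h 0 = 0" using add[of 0 0] by simp
  have sum: "h (\<Sum>b\<in>A. f b) = (\<Sum>b\<in>A. h (f b))" for f :: "'b \<Rightarrow> 'r" and A
    by (induction A rule: infinite_finite_induct) (simp_all add: zero add)
  note lookup = lookup_base_change[where h = h, OF I zero]
  have closed: "base_change h I f v \<in> free_mod I"
    if "f \<in> carrier (GL I)" "v \<in> free_mod I" for f v
    unfolding base_change_def
  proof (rule lin_ext_free_mod[OF _ that(2)], rule free_modI)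
    fix b x assume "b \<in> I" "x \<notin> I"
    then show "Poly_Mapping.lookup (Poly_Mapping.map h (f (bvec b))) x = 0"
      unfolding lookup_map[where h = h, OF zero] free_mod_lookup[OF GL_closed[OF that(1) bvec_free_mod[OF \<open>b \<in> I\<close>]] \<open>x \<notin> I\<close>]
      by (simp only: zero)
  qed
  have comp: "base_change h I (f \<otimes>\<^bsub>GL I\<^esub> g) v = base_change h I f (base_change h I g v)"
    if f: "f \<in> carrier (GL I)" and g: "g \<in> carrier (GL I)" and v: "v \<in> free_mod I" for f g v
  proof (rule poly_mapping_eqI)
    fix x
    have e: "Poly_Mapping.lookup ((f \<otimes>\<^bsub>GL I\<^esub> g) (bvec b)) x
        = (\<Sum>c\<in>I. Poly_Mapping.lookup (g (bvec b)) c * Poly_Mapping.lookup (f (bvec c)) x)"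
      if b: "b \<in> I" for b
    proof -
      have "linear_on I f" using f by (simp add: GL_iff)
      then show ?thesis
        unfolding GL_mult[OF f g] compose_eq[OF bvec_free_mod[OF b]]
        by (rule lookup_linear[OF I _ GL_closed[OF g bvec_free_mod[OF b]]])
    qed
    have "Poly_Mapping.lookup (base_change h I (f \<otimes>\<^bsub>GL I\<^esub> g) v) x
        = (\<Sum>b\<in>I. \<Sum>c\<in>I. Poly_Mapping.lookup v b * (h (Poly_Mapping.lookup (g (bvec b)) c)
            * h (Poly_Mapping.lookup (f (bvec c)) x)))"
      unfolding lookup[OF v]
    proof (rule sum.cong[OF HOL.refl])
      fix b assume b: "b \<in> I"
      show "Poly_Mapping.lookup v b * h (Poly_Mapping.lookup ((f \<otimes>\<^bsub>GL I\<^esub> g) (bvec b)) x)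
        = (\<Sum>c\<in>I. Poly_Mapping.lookup v b * (h (Poly_Mapping.lookup (g (bvec b)) c)
            * h (Poly_Mapping.lookup (f (bvec c)) x)))"
        unfolding e[OF b] sum mult sum_distrib_left ..
    qed
    also have "\<dots> = (\<Sum>c\<in>I. \<Sum>b\<in>I. Poly_Mapping.lookup v b * (h (Poly_Mapping.lookup (g (bvec b)) c)
            * h (Poly_Mapping.lookup (f (bvec c)) x)))"
      by (rule sum.swap)
    also have "\<dots> = Poly_Mapping.lookup (base_change h I f (base_change h I g v)) x"
      unfolding lookup[OF closed[OF g v]] lookup[OF v]
      by (simp add: sum_distrib_right mult.assoc)
    finally show "Poly_Mapping.lookup (base_change h I (f \<otimes>\<^bsub>GL I\<^esub> g) v) x
        = Poly_Mapping.lookup (base_change h I f (base_change h I g v)) x" .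
  qed
  have id: "base_change h I \<one>\<^bsub>GL I\<^esub> v = v" if v: "v \<in> free_mod I" for v
  proof (rule poly_mapping_eqI)
    fix x
    have "Poly_Mapping.lookup (base_change h I \<one>\<^bsub>GL I\<^esub> v) x
        = (\<Sum>b\<in>I. if b = x then Poly_Mapping.lookup v b else 0)"
      unfolding lookup[OF v]
      by (intro sum.cong) (auto simp: GL_one bvec_free_mod lookup_single when_def one zero)
    then show "Poly_Mapping.lookup (base_change h I \<one>\<^bsub>GL I\<^esub> v) x = Poly_Mapping.lookup v x"
      using I free_mod_lookup[OF v, of x] by simp
  qed
  have ext: "base_change h I f \<in> extensional (free_mod I)" for f
    by (simp add: base_change_def lin_ext_def)
  have GL: "base_change h I f \<in> carrier (GL I)" if f: "f \<in> carrier (GL I)" for f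
  proof (rule bij_linear_GL[where g = "base_change h I (inv\<^bsub>GL I\<^esub> f)"])
    show "linear_on I (base_change h I f)"
      unfolding base_change_def by (rule linear_lin_ext[OF I])
    fix v :: "'b \<Rightarrow>\<^sub>0 's" assume v: "v \<in> free_mod I"
    show "base_change h I f v \<in> free_mod I" "base_change h I (inv\<^bsub>GL I\<^esub> f) v \<in> free_mod I"
      using f v by (simp_all add: closed)
    show "base_change h I (inv\<^bsub>GL I\<^esub> f) (base_change h I f v) = v"
      using f v comp[of "inv\<^bsub>GL I\<^esub> f" f v] by (simp add: id)
    show "base_change h I f (base_change h I (inv\<^bsub>GL I\<^esub> f) v) = v"
      using f v comp[of f "inv\<^bsub>GL I\<^esub> f" v] by (simp add: id)
  qed (rule ext ext)+
  show ?thesis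
  proof (rule homI)
    fix f g :: "('b \<Rightarrow>\<^sub>0 'r) \<Rightarrow> ('b \<Rightarrow>\<^sub>0 'r)"
    assume f: "f \<in> carrier (GL I)" and g: "g \<in> carrier (GL I)"
    show "base_change h I f \<in> carrier (GL I)" by (rule GL[OF f])
    show "base_change h I (f \<otimes>\<^bsub>GL I\<^esub> g) = base_change h I f \<otimes>\<^bsub>GL I\<^esub> base_change h I g"
      unfolding GL_mult[OF GL[OF f] GL[OF g]]
      using ext comp[OF f g] by (intro extensionalityI[of _ "free_mod I"]) (auto simp: compose_eq)
  qed
qed


section \<open>The representation over the Laurent polynomials\<close>
lemma poly_in_r_0 [simp]: "poly_in_r 0 = 0" and poly_in_r_1: "poly_in_r 1 = 1"
  by (simp_all add: poly_in_r_def)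

lemma poly_in_r_pCons: "poly_in_r (pCons c p) = of_int c + var_r * poly_in_r p"
  by (simp add: poly_in_r_def map_poly_pCons)

lemma poly_in_r_add: "poly_in_r (p + q) = poly_in_r p + poly_in_r q"
proof -
  have "map_poly of_int (p + q) = map_poly of_int p + (map_poly of_int q :: laurent_rt poly)"
    by (rule poly_eqI) (simp add: coeff_map_poly)
  then show ?thesis by (simp add: poly_in_r_def)
qed

lemma poly_in_r_smult: "poly_in_r (smult c p) = of_int c * poly_in_r p"
proof -
  have "map_poly of_int (smult c p) = smult (of_int c) (map_poly of_int p :: laurent_rt poly)"
    by (rule poly_eqI) (simp add: coeff_map_poly)
  then show ?thesis by (simp add: poly_in_r_def)
qed

lemma poly_in_r_mult: "poly_in_r (p * q) = poly_in_r p * poly_in_r q"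
  by (induction p) (simp_all add: poly_in_r_add poly_in_r_smult poly_in_r_pCons algebra_simps)

lemma poly_in_r_X: "poly_in_r [:0, 1:] = var_r"
  by (simp add: poly_in_r_pCons)

lemma poly_in_r_X_power: "poly_in_r ([:0, 1:] ^ m) = var_r ^ m"
  by (induction m) (simp_all add: poly_in_r_1 poly_in_r_mult poly_in_r_X poly_in_r_pCons)

lemma var_r_unit: "var_r * Poly_Mapping.single (- 1, 0) 1 = 1"
  by (simp add: var_r_def mult_single zero_prod_def[symmetric])

lemma var_t_unit: "var_t * Poly_Mapping.single (0, - 1) 1 = 1"
  by (simp add: var_t_def mult_single zero_prod_def[symmetric])

context ade_system
begin

lemma tau_ring_hom:
  assumes add: "\<And>a b. h (a + b) = h a + h b" and mult: "\<And>a b. h (a * b) = h a * h b"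
    and one: "h 1 = 1"
  shows "tau (h r) k (\<lambda>x. h (f x)) = (\<lambda>x. h (tau r k f x))"
proof
  fix x
  have zero: "h 0 = 0" using add[of 0 0] by simp
  have "h (1 - r ^ 2) + h (r ^ 2) = 1" using add[of "1 - r ^ 2" "r ^ 2"] one by simp
  then have q: "h (1 - r ^ 2) = 1 - h r ^ 2"
    by (simp add: power2_eq_square mult eq_diff_eq)
  show "tau (h r) k (\<lambda>x. h (f x)) x = h (tau r k f x)"
    by (simp add: tau_def add mult zero q)
qed

lemma compatible_ring_hom:
  assumes add: "\<And>a b. h (a + b) = h a + h b" and mult: "\<And>a b. h (a * b) = h a * h b"
    and one: "h 1 = 1" and \<phi>: "compatible r \<phi>"
  shows "compatible (h r) (\<lambda>k x. h (\<phi> k x))"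
proof -
  have zero: "h 0 = 0" using add[of 0 0] by simp
  show ?thesis
    unfolding compatible_def tau_ring_hom[where h = h, OF add mult one]
  proof (intro conjI ballI allI impI)
    fix i j assume "i \<in> nodes" "j \<in> nodes" "cartan i j = - 1"
    then have "tau r i (\<phi> j) = tau r j (\<phi> i)" using \<phi> unfolding compatible_def by blast
    then show "(\<lambda>x. h (tau r i (\<phi> j) x)) = (\<lambda>x. h (tau r j (\<phi> i) x))" by (simp only:)
  qed (use \<phi> zero in \<open>simp_all add: compatible_def\<close>)
qed

definition T_poly :: "nat \<Rightarrow> root \<Rightarrow> int poly" where
  "T_poly k = R_poly [:0, 1:] (simple_root k)"

definition T_laurent :: "nat \<Rightarrow> root \<Rightarrow> laurent_rt" where
  "T_laurent k x = poly_in_r (T_poly k x)"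

lemma compatible_T_laurent: "compatible var_r T_laurent"
proof -
  have "compatible (poly_in_r [:0, 1:]) (\<lambda>k x. poly_in_r (T_poly k x))"
    unfolding T_poly_def
    by (rule compatible_ring_hom[OF poly_in_r_add poly_in_r_mult poly_in_r_1 compatible_R_poly])
  then show ?thesis unfolding poly_in_r_X T_laurent_def .
qed

text \<open>The value is a power of \<open>r\<close>.\<close>
lemma T_laurent_unit: "k \<in> nodes \<Longrightarrow> \<exists>u. T_laurent k (simple_root k) * u = 1"
proof -
  assume "k \<in> nodes"
  then obtain m where "T_poly k (simple_root k) = [:0, 1:] ^ m"
    unfolding T_poly_def using R_poly_diagonal[of "simple_root k" "[:0, 1:]"] by auto
  then have "T_laurent k (simple_root k) * Poly_Mapping.single (- 1, 0) 1 ^ m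
      = (var_r * Poly_Mapping.single (- 1, 0) 1) ^ m"
    by (simp add: T_laurent_def poly_in_r_X_power power_mult_distrib)
  then show ?thesis unfolding var_r_unit by auto
qed

lemma lookup_tau_map_bvec:
  assumes k: "k \<in> nodes" and b: "b \<in> Pos"
  shows "Poly_Mapping.lookup
    (if pair k b = 2 then 0
     else if pair k b = 1 then var_r *\<^sub>f bvec (\<lambda>i. b i - simple_root k i)
     else if pair k b = 0 then bvec b
     else (1 - var_r ^ 2) *\<^sub>f bvec b + var_r *\<^sub>f bvec (\<lambda>i. b i + simple_root k i)) x
    = tau var_r k (\<lambda>y. if y = b then 1 else 0) x"
proof -
  have rr: "refl k (refl k y) = y" for y using k by (rule reflection_reflection)
  have pr: "pair k (refl k y) = - pair k y" for y using k by (simp add: pair_reflection)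
  have rx: "refl k x = b \<longleftrightarrow> x = refl k b" using rr by metis
  have Pb: "refl k b \<in> Pos" "refl k b \<noteq> simple_root k" if "b \<noteq> simple_root k"
    using that k b by (simp_all add: reflection_Pos reflection_ne_simple_root)
  from k b show ?thesis
  proof (cases rule: Pos_cases)
    case simple
    then show ?thesis
      using fun_cong[OF tau_unit_vec_same[OF k, of var_r], of x] by (simp add: unit_vec_def[abs_def])
  next
    case zero
    then have "refl k b = b" by (rule reflection_fixed)
    moreover have "b \<noteq> simple_root k" using zero k by auto
    ultimately show ?thesis
      using zero b rx by (cases "x = b") (simp_all add: tau_def lookup_single when_def)
  next
    case one
    have eq: "(\<lambda>i. b i - simple_root k i) = refl k b" using one by (simp add: reflection_def)
    have ne: "refl k b \<noteq> b" using one pr[of b] by auto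
    consider "x = refl k b" | "x = b" | "x \<noteq> refl k b" "x \<noteq> b" by blast
    then show ?thesis
      unfolding eq using one b rx pr[of b] ne ne[symmetric] Pb
      by cases (simp_all add: tau_def lookup_single when_def lookup_fm_scale rr)
  next
    case minus_one
    have eq: "(\<lambda>i. b i + simple_root k i) = refl k b" using minus_one by (simp add: reflection_def)
    have ne: "refl k b \<noteq> b" using minus_one pr[of b] by auto
    consider "x = refl k b" | "x = b" | "x \<noteq> refl k b" "x \<noteq> b" by blast
    then show ?thesis
      unfolding eq using minus_one b rx pr[of b] ne ne[symmetric] Pb
      by cases (simp_all add: tau_def lookup_single when_def lookup_fm_scale lookup_add rr)
  qed
qed

lemma tau_expand:
  assumes k: "k \<in> nodes"
  shows "tau r k f x = (\<Sum>b\<in>Pos. f b * tau r k (\<lambda>y. if y = b then 1 else 0) x)"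
proof (cases "x \<in> Pos \<and> x \<noteq> simple_root k")
  case True
  then have P: "x \<in> Pos" "refl k x \<in> Pos" using k by (simp_all add: reflection_Pos)
  obtain c d where tau: "\<And>g. tau r k g x = c * g x + d * g (refl k x)"
  proof (rule that)
    show "tau r k g x = (if pair k x = 0 then 1 else if pair k x = 1 then 0 else 1 - r ^ 2) * g x
        + (if pair k x = 0 then 0 else r) * g (refl k x)" for g
      using True by (simp add: tau_def)
  qed
  have s: "(\<Sum>b\<in>Pos. f b * (e * (if y = b then 1 else 0))) = e * f y" if "y \<in> Pos" for e y
  proof -
    have "(\<Sum>b\<in>Pos. f b * (e * (if y = b then 1 else 0))) = (\<Sum>b\<in>Pos. if y = b then e * f y else 0)"
      by (rule sum.cong) auto
    then show ?thesis using that finite_Pos by simp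
  qed
  show ?thesis
    unfolding tau distrib_left sum.distrib s[OF P(1)] s[OF P(2)] ..
next
  case False
  then have "tau r k g x = 0" for g :: "root \<Rightarrow> 'a" unfolding tau_def by (simp only: if_False)
  then show ?thesis by simp
qed

lemma lookup_tau_map:
  assumes "k \<in> nodes" "v \<in> free_mod Pos"
  shows "Poly_Mapping.lookup (tau_map X k v) x = tau var_r k (Poly_Mapping.lookup v) x"
  unfolding tau_map_def lookup_lin_ext[OF finite_Pos assms(2)] tau_expand[OF assms(1), of _ "Poly_Mapping.lookup v"]
  by (intro sum.cong HOL.refl) (simp only: lookup_tau_map_bvec[OF assms(1)])

lemma lookup_sigma_map:
  assumes k: "k \<in> nodes" and v: "v \<in> free_mod Pos"
  shows "Poly_Mapping.lookup (sigma_map X T_poly k v) = sigma var_r var_t T_laurent k (Poly_Mapping.lookup v)"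
proof
  fix x
  have "Poly_Mapping.lookup (T_map X T_poly k v) x
      = (\<Sum>b\<in>Pos. Poly_Mapping.lookup v b * (T_laurent k b * unit_vec k x))"
    unfolding T_map_def lookup_lin_ext[OF finite_Pos v] T_laurent_def
    by (intro sum.cong HOL.refl) (auto simp: lookup_fm_scale lookup_single when_def unit_vec_def)
  also have "\<dots> = form (T_laurent k) (Poly_Mapping.lookup v) * unit_vec k x"
    by (simp add: form_def sum_distrib_left mult_ac)
  finally show "Poly_Mapping.lookup (sigma_map X T_poly k v) x
      = sigma var_r var_t T_laurent k (Poly_Mapping.lookup v) x"
    using v by (simp add: sigma_map_def lookup_add lookup_fm_scale lookup_tau_map[OF k v] sigma_def mult.assoc)
qed

lemma sigma_outside: "k \<in> nodes \<Longrightarrow> x \<notin> Pos \<Longrightarrow> sigma r t \<phi> k v x = 0"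
  by (auto simp: sigma_def unit_vec_def)

lemma sigma_map_GL:
  assumes k: "k \<in> nodes"
  shows "sigma_map X T_poly k \<in> carrier (GL Pos)"
proof -
  let ?s = "sigma_map X T_poly k" and ?V = "free_mod Pos :: (root \<Rightarrow>\<^sub>0 laurent_rt) set"
  note lookup = lookup_sigma_map[OF k]
  obtain u where u: "T_laurent k (simple_root k) * u = 1" using T_laurent_unit[OF k] by blast
  note units = var_r_unit var_t_unit u
  have closed: "?s v \<in> ?V" if "v \<in> ?V" for v
    using that k by (intro free_modI) (simp add: lookup sigma_outside)
  have lin: "linear_on Pos ?s"
    unfolding linear_on_def
  proof (intro conjI ballI allI)
    fix u v :: "root \<Rightarrow>\<^sub>0 laurent_rt" assume u: "u \<in> ?V" and v: "v \<in> ?V"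
    have "Poly_Mapping.lookup (u + v) = (\<lambda>x. Poly_Mapping.lookup u x + Poly_Mapping.lookup v x)"
      by (simp add: lookup_add fun_eq_iff)
    then have "Poly_Mapping.lookup (?s (u + v)) x = Poly_Mapping.lookup (?s u + ?s v) x" for x
      using u v by (simp add: lookup free_mod_add sigma_add lookup_add)
    then show "?s (u + v) = ?s u + ?s v" by (rule poly_mapping_eqI)
  next
    fix c and v :: "root \<Rightarrow>\<^sub>0 laurent_rt" assume v: "v \<in> ?V"
    have "Poly_Mapping.lookup (c *\<^sub>f v) = (\<lambda>x. c * Poly_Mapping.lookup v x)"
      by (simp add: lookup_fm_scale fun_eq_iff)
    then have "Poly_Mapping.lookup (?s (c *\<^sub>f v)) x = Poly_Mapping.lookup (c *\<^sub>f ?s v) x" for x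
      using v by (simp add: lookup free_mod_smult sigma_scale lookup_fm_scale)
    then show "?s (c *\<^sub>f v) = c *\<^sub>f ?s v" by (rule poly_mapping_eqI)
  qed
  have "inj_on ?s ?V"
  proof (rule inj_onI)
    fix v w assume v: "v \<in> ?V" and w: "w \<in> ?V" and eq: "?s v = ?s w"
    let ?d = "\<lambda>x. Poly_Mapping.lookup v x + (- 1) * Poly_Mapping.lookup w x"
    have 1: "sigma var_r var_t T_laurent k ?d x = 0" for x
      unfolding sigma_add sigma_scale using lookup[OF v] lookup[OF w] eq by simp
    have 2: "?d x = 0" if "x \<notin> Pos" for x
      using that v w by (simp add: free_mod_lookup)
    have "?d x = 0" for x
      by (rule sigma_injective[where v = ?d and \<phi> = T_laurent, OF k units 2 1])
    then have "Poly_Mapping.lookup v x = Poly_Mapping.lookup w x" for x by simp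
    then show "v = w" by (rule poly_mapping_eqI)
  qed
  moreover have "?s ` ?V = ?V"
  proof
    show "?s ` ?V \<subseteq> ?V" using closed by blast
    show "?V \<subseteq> ?s ` ?V"
    proof
      fix v assume v: "v \<in> ?V"
      then have "\<exists>g. (\<forall>x. x \<notin> Pos \<longrightarrow> g x = 0) \<and> sigma var_r var_t T_laurent k g = Poly_Mapping.lookup v"
        by (intro sigma_surjective[where v = "Poly_Mapping.lookup v" and \<phi> = T_laurent, OF k units]
            free_mod_lookup)
      then obtain g where g: "\<And>x. x \<notin> Pos \<Longrightarrow> g x = 0"
        "sigma var_r var_t T_laurent k g = Poly_Mapping.lookup v" by blast
      obtain w where w: "w \<in> ?V" "Poly_Mapping.lookup w = g"
        using free_mod_exists[where g = g, OF finite_Pos g(1)] by blast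
      then have "Poly_Mapping.lookup (?s w) = Poly_Mapping.lookup v" using g(2) by (simp add: lookup)
      then have "?s w = v" by (simp only: Poly_Mapping.lookup_inject)
      then show "v \<in> ?s ` ?V" using w(1) by blast
    qed
  qed
  moreover have "?s \<in> extensional ?V" by (simp add: sigma_map_def)
  ultimately show ?thesis using lin by (simp add: GL_iff Bij_def bij_betw_def)
qed

lemma sigma_map_relations:
  assumes uv: "(u, v) \<in> artin_relations (ade_rank X) (coxeter_matrix X)"
  shows "eval_word (GL Pos) (sigma_map X T_poly) u = eval_word (GL Pos) (sigma_map X T_poly) v"
proof -
  let ?G = "GL Pos :: ((root \<Rightarrow>\<^sub>0 laurent_rt) \<Rightarrow> (root \<Rightarrow>\<^sub>0 laurent_rt)) monoid"
  let ?s = "sigma_map X T_poly"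
  interpret G: group ?G by (rule group_GL)
  obtain i j where "1 \<le> i" "i < j" "j \<le> ade_rank X"
    and u: "u = alternating (coxeter_matrix X i j) i j" and v: "v = alternating (coxeter_matrix X i j) j i"
    using uv unfolding artin_relations_def by blast
  then have ij: "i \<in> nodes" "j \<in> nodes" "i \<noteq> j" by (simp_all add: nodes_def)
  note GL = sigma_map_GL[OF ij(1)] sigma_map_GL[OF ij(2)]
  note phi = compatible_T_laurent
  have M: "coxeter_matrix X i j = 2 \<and> cartan i j = 0 \<or> coxeter_matrix X i j = 3 \<and> cartan i j = - 1"
    using ij(3) by (simp add: coxeter_matrix_def cartan_def)
  have mult: "(f \<otimes>\<^bsub>?G\<^esub> g) v = f (g v)" if "f \<in> carrier ?G" "g \<in> carrier ?G" "v \<in> free_mod Pos" for f g v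
    using that by (simp add: GL_mult compose_eq)
  note closed = GL_closed[OF GL(1)] GL_closed[OF GL(2)]
  from M show ?thesis
  proof
    assume M: "coxeter_matrix X i j = 2 \<and> cartan i j = 0"
    have "?s i \<otimes>\<^bsub>?G\<^esub> ?s j = ?s j \<otimes>\<^bsub>?G\<^esub> ?s i"
    proof (rule GL_eqI)
      fix v :: "root \<Rightarrow>\<^sub>0 laurent_rt" and x assume v: "v \<in> free_mod Pos"
      show "Poly_Mapping.lookup ((?s i \<otimes>\<^bsub>?G\<^esub> ?s j) v) x = Poly_Mapping.lookup ((?s j \<otimes>\<^bsub>?G\<^esub> ?s i) v) x"
        using M v ij GL by (simp add: mult closed lookup_sigma_map sigma_commute[OF phi ij(1,2)])
    qed (use GL in simp_all)
    then show ?thesis using M GL by (simp add: u v numeral_2_eq_2)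
  next
    assume M: "coxeter_matrix X i j = 3 \<and> cartan i j = - 1"
    have "?s i \<otimes>\<^bsub>?G\<^esub> (?s j \<otimes>\<^bsub>?G\<^esub> ?s i) = ?s j \<otimes>\<^bsub>?G\<^esub> (?s i \<otimes>\<^bsub>?G\<^esub> ?s j)"
    proof (rule GL_eqI)
      fix v :: "root \<Rightarrow>\<^sub>0 laurent_rt" and x assume v: "v \<in> free_mod Pos"
      show "Poly_Mapping.lookup ((?s i \<otimes>\<^bsub>?G\<^esub> (?s j \<otimes>\<^bsub>?G\<^esub> ?s i)) v) x
          = Poly_Mapping.lookup ((?s j \<otimes>\<^bsub>?G\<^esub> (?s i \<otimes>\<^bsub>?G\<^esub> ?s j)) v) x"
        using M v ij GL by (simp add: mult closed lookup_sigma_map sigma_braid[OF phi ij(1,2)])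
    qed (use GL in simp_all)
    then show ?thesis using M GL by (simp add: u v numeral_3_eq_3)
  qed
qed

lemma extends_sigma_unique_ex: "\<exists>!\<rho>. extends_sigma X T_poly \<rho>"
  unfolding extends_sigma_def artin_group_def artin_gen_def
  by (rule presented_group_universal[OF group_GL])
    (use sigma_map_GL sigma_map_relations in \<open>auto simp: nodes_def\<close>)

lemma specialised_rep_hom:
  assumes "extends_sigma X T_poly \<rho>" "0 < r\<^sub>0"
  shows "specialised_rep X r\<^sub>0 \<rho> \<in> hom (artin_group X) (GL Pos)"
proof -
  have "base_change (specialise r\<^sub>0) Pos \<in> hom (GL Pos) (GL Pos)"
    using assms(2)
    by (intro base_change_hom finite_Pos specialise_add specialise_mult specialise_one) simp
  moreover have "\<rho> \<in> hom (artin_group X) (GL Pos)" using assms(1) by (simp add: extends_sigma_def)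
  ultimately show ?thesis by (auto simp: hom_def specialised_rep_def Pi_iff)
qed

end


section \<open>Supports at \<open>t = 0\<close>\<close>
lemma lookup_single_0_mult:
  fixes p :: laurent_t
  shows "Poly_Mapping.lookup (Poly_Mapping.single 0 c * p) j = c * Poly_Mapping.lookup p j"
  by (induction p rule: poly_mapping_single_induct)
    (auto simp: distrib_left lookup_add mult_single lookup_single when_def)

lemma lookup_single_1_mult:
  fixes p :: laurent_t
  shows "Poly_Mapping.lookup (Poly_Mapping.single 1 1 * p) j = Poly_Mapping.lookup p (j - 1)"
  by (induction p rule: poly_mapping_single_induct)
    (auto simp: distrib_left lookup_add mult_single lookup_single when_def)

lemma specialise_var_r: "specialise r\<^sub>0 var_r = Poly_Mapping.single 0 r\<^sub>0"
  by (simp add: var_r_def specialise_single)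

lemma specialise_var_t: "specialise r\<^sub>0 var_t = Poly_Mapping.single 1 1"
  by (simp add: var_t_def specialise_single)

lemma specialise_poly_in_r:
  assumes "r\<^sub>0 \<noteq> 0"
  shows "\<exists>a. specialise r\<^sub>0 (poly_in_r p) = Poly_Mapping.single 0 a"
proof (induction p)
  case 0
  have "specialise r\<^sub>0 (poly_in_r 0) = Poly_Mapping.single 0 0" by (simp add: specialise_def)
  then show ?case by blast
next
  case (pCons c p)
  then obtain a where a: "specialise r\<^sub>0 (poly_in_r p) = Poly_Mapping.single 0 a" by blast
  have "(of_int c :: laurent_rt) = Poly_Mapping.single (0, 0) c"
    using Poly_Mapping.single_of_int[of c, where ?'a = "int \<times> int" and ?'b = int]
    by (simp add: zero_prod_def)
  then have "specialise r\<^sub>0 (of_int c) = Poly_Mapping.single 0 (of_int c)"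
    by (simp add: specialise_single)
  then have "specialise r\<^sub>0 (poly_in_r (pCons c p)) = Poly_Mapping.single 0 (of_int c + r\<^sub>0 * a)"
    using assms
    by (simp add: poly_in_r_pCons specialise_add specialise_mult specialise_var_r a mult_single single_add)
  then show ?case by blast
qed

context ade_system
begin

text \<open>The support of \<open>\<tau>\<^sub>k v\<close> when \<open>v\<close> has non-negative coordinates and support \<open>A\<close>, for \<open>0 < r < 1\<close>. The
  sets \<open>foldr act u Pos\<close> are the supports of the images of the vector with all coordinates 1.\<close>
definition act :: "nat \<Rightarrow> root set \<Rightarrow> root set" where
  "act k A = {x \<in> Pos. x \<noteq> simple_root k \<and>
    (x \<in> A \<and> pair k x \<noteq> 1 \<or> refl k x \<in> A \<and> pair k x \<noteq> 0)}"

lemma act_mono: "A \<subseteq> B \<Longrightarrow> act k A \<subseteq> act k B"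
  by (auto simp: act_def)

lemma foldr_act_empty: "foldr act u {} = {}"
  by (induction u) (auto simp: act_def)

text \<open>All entries of the matrix are non-negative, so no cancellation can occur.\<close>
lemma tau_nonneg_support:
  fixes f :: "root \<Rightarrow> real"
  assumes r: "0 < r" "r < 1" and k: "k \<in> nodes" and f: "\<And>x. 0 \<le> f x"
  shows "0 \<le> tau r k f x" and "{x \<in> Pos. tau r k f x \<noteq> 0} = act k {x \<in> Pos. f x \<noteq> 0}"
proof -
  have q: "0 < 1 - r ^ 2" using r by (simp add: power_less_one_iff)
  show "0 \<le> tau r k f x" for x
    using f r q by (simp add: tau_def)
  have "tau r k f x \<noteq> 0 \<longleftrightarrow> x \<in> act k {x \<in> Pos. f x \<noteq> 0}" if x: "x \<in> Pos" for x
  proof (cases "x = simple_root k")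
    case False
    then have "refl k x \<in> Pos" using x k by (simp add: reflection_Pos)
    moreover have "(1 - r ^ 2) * f x + r * f (refl k x) \<noteq> 0 \<longleftrightarrow> f x \<noteq> 0 \<or> f (refl k x) \<noteq> 0"
      using f[of x] f[of "refl k x"] r q by (smt (verit) mult_nonneg_nonneg mult_pos_pos mult_eq_0_iff)
    ultimately show ?thesis
      using pair_Pos_cases[OF k x False] x False r reflection_fixed[of k x]
      by (auto simp: tau_def act_def)
  qed (simp add: act_def)
  then show "{x \<in> Pos. tau r k f x \<noteq> 0} = act k {x \<in> Pos. f x \<noteq> 0}"
    by (auto simp: act_def)
qed

text \<open>For a linear functional \<open>f\<close> let \<open>A f\<close> be the set of positive roots on which \<open>f\<close> is positive. If
  \<open>f(\<alpha>\<^sub>k) > 0\<close>, then \<open>act k\<close> maps \<open>A f\<close> into \<open>A (f \<circ> s\<^sub>k)\<close>, which is \<open>s\<^sub>k (A f - {\<alpha>\<^sub>k})\<close> and has one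
  element less. If \<open>f\<close> is positive on no simple root, then \<open>A f\<close> is empty. Starting from the height
  functional, where \<open>A f\<close> is \<open>\<Phi>\<^sup>+\<close>, this process ends with the empty set.\<close>
lemma exists_annihilating_word: "\<exists>u\<in>lists nodes. foldr act u Pos = {}"
proof -
  define val where "val = (\<lambda>f x. \<Sum>i\<in>nodes. f i * x i :: real)"
  define A where "A = (\<lambda>f. {x \<in> Pos. 0 < val f x})"
  have fin: "finite (A f)" for f using finite_Pos by (simp add: A_def)
  have val_simple: "val f (simple_root k) = f k" if "k \<in> nodes" for f k
    using that by (simp add: val_def simple_root_def if_distrib[of "\<lambda>t. _ * t"] cong: if_cong)
  have val_refl: "val f (refl k x) = val f x - pair k x * f k" if "k \<in> nodes" for f k x
  proof -
    have "val f (refl k x) = val f x - pair k x * val f (simple_root k)"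
      by (simp add: val_def reflection_def algebra_simps sum_subtractf sum_distrib_left)
    then show ?thesis using val_simple[OF that] by simp
  qed
  have "\<exists>u\<in>lists nodes. \<forall>B\<subseteq>A f. foldr act u B = {}" for f
  proof (induction "card (A f)" arbitrary: f rule: less_induct)
    case less
    show ?case
    proof (cases "\<exists>k\<in>nodes. 0 < f k")
      case False
      have "val f x \<le> 0" if "x \<in> Pos" for x
        unfolding val_def using False Pos_nonneg[OF that]
        by (intro sum_nonpos mult_nonpos_nonneg) (auto simp: not_less)
      then have "A f = {}" by (force simp: A_def)
      then show ?thesis by (intro bexI[of _ "[]"]) auto
    next
      case True
      then obtain k where k: "k \<in> nodes" "0 < f k" by blast
      \<comment> \<open>the values of \<open>f \<circ> s\<^sub>k\<close> on the simple roots\<close>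
      define f' where "f' = (\<lambda>i. f i - cartan k i * f k)"
      have val': "val f' x = val f (refl k x)" for x
      proof -
        have "val f' x = val f x - pair k x * f k"
          unfolding pair_eq[OF k(1)]
          by (simp add: val_def f'_def algebra_simps sum_subtractf sum_distrib_left)
        then show ?thesis using val_refl[OF k(1)] by simp
      qed
      have "A f' \<subseteq> refl k ` (A f - {simple_root k})"
      proof
        fix x assume "x \<in> A f'"
        then have x: "x \<in> Pos" "0 < val f (refl k x)" by (simp_all add: A_def val')
        have "x \<noteq> simple_root k" using x(2) k by (auto simp: val_refl val_simple)
        then have "refl k x \<in> A f - {simple_root k}"
          using x k(1) by (simp add: A_def reflection_Pos reflection_ne_simple_root)
        moreover have "x = refl k (refl k x)" using k(1) by (simp add: reflection_reflection)
        ultimately show "x \<in> refl k ` (A f - {simple_root k})" by blast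
      qed
      then have "card (A f') \<le> card (refl k ` (A f - {simple_root k}))"
        by (rule card_mono[rotated]) (simp add: fin)
      also have "\<dots> \<le> card (A f - {simple_root k})" by (rule card_image_le) (simp add: fin)
      also have "\<dots> < card (A f)"
      proof (rule card_Diff1_less[OF fin])
        show "simple_root k \<in> A f" using k by (simp add: A_def val_simple)
      qed
      finally obtain u where u: "u \<in> lists nodes" "\<And>B. B \<subseteq> A f' \<Longrightarrow> foldr act u B = {}"
        using less[of f'] by blast
      have step: "act k (A f) \<subseteq> A f'"
      proof
        fix x assume x: "x \<in> act k (A f)"
        then have P: "x \<in> Pos" "x \<noteq> simple_root k" by (simp_all add: act_def)
        from x consider "0 < val f x" "pair k x \<noteq> 1" | "0 < val f (refl k x)"
          by (auto simp: act_def A_def)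
        then have "0 < val f (refl k x)"
        proof cases
          case 1
          then have "pair k x \<le> 0" using pair_Pos_cases[OF k(1) P] by auto
          then have "pair k x * f k \<le> 0" using k(2) by (simp add: mult_nonpos_nonneg)
          then show ?thesis using 1 by (simp add: val_refl[OF k(1)])
        qed
        then show "x \<in> A f'" using P by (simp add: A_def val')
      qed
      have "foldr act (u @ [k]) B = {}" if "B \<subseteq> A f" for B
        using u(2)[of "act k B"] act_mono[OF that, of k] step by simp
      then show ?thesis using u(1) k(1) by (intro bexI[of _ "u @ [k]"]) auto
    qed
  qed
  then obtain u where u: "u \<in> lists nodes" "\<And>B. B \<subseteq> A (\<lambda>i. 1) \<Longrightarrow> foldr act u B = {}" by blast
  have "0 < val (\<lambda>i. 1) x" if x: "x \<in> Pos" for x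
  proof -
    obtain i where i: "x i \<noteq> 0" using Pos_nonzero[OF x] by blast
    then have "i \<in> nodes" using Pos_lattice[OF x] by (auto simp: lattice_def)
    then show ?thesis
      unfolding val_def using i Pos_nonneg[OF x]
      by (intro sum_pos2[of nodes i]) (auto simp: less_le)
  qed
  then have "Pos \<subseteq> A (\<lambda>i. 1)" by (auto simp: A_def)
  then show ?thesis using u by blast
qed

section \<open>Positive words in the Artin group\<close>
abbreviation Artin :: "nat word set monoid" where
  "Artin \<equiv> artin_group X"

lemma group_Artin: "group Artin"
  unfolding artin_group_def by (rule group_presented_group)

lemma artin_gen_closed: "k \<in> nodes \<Longrightarrow> artin_gen X k \<in> carrier Artin"
  by (auto simp: artin_group_def artin_gen_def pres_gen_def carrier_presented_group nodes_def
      intro: quotientI)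

text \<open>The evaluation principle, applied to the identity homomorphism.\<close>
lemma Artin_class_eval:
  "w \<in> words nodes \<Longrightarrow>
    pres_rel nodes (artin_relations (ade_rank X) (coxeter_matrix X)) `` {w}
      = eval_word Artin (artin_gen X) w"
  using hom_presented_group_eval[OF group_Artin, where \<rho> = "\<lambda>x. x" and S = nodes and h = "artin_gen X"
      and R = "artin_relations (ade_rank X) (coxeter_matrix X)" and w = w]
  by (simp add: artin_group_def artin_gen_def nodes_def hom_def)

lemma Artin_relation:
  assumes ij: "i \<in> nodes" "j \<in> nodes" "i \<noteq> j"
  shows "eval_word Artin (artin_gen X) (alternating (coxeter_matrix X i j) i j)
    = eval_word Artin (artin_gen X) (alternating (coxeter_matrix X i j) j i)"
proof -
  let ?R = "artin_relations (ade_rank X) (coxeter_matrix X)"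
  have words: "alternating m a b \<in> words nodes" if "a \<in> nodes" "b \<in> nodes" for m a b
    using that by (induction m arbitrary: a b) auto
  have *: "eval_word Artin (artin_gen X) (alternating (coxeter_matrix X i j) i j)
    = eval_word Artin (artin_gen X) (alternating (coxeter_matrix X i j) j i)"
    if "i \<in> nodes" "j \<in> nodes" "i < j" for i j
  proof -
    have "(alternating (coxeter_matrix X i j) i j, alternating (coxeter_matrix X i j) j i) \<in> ?R"
      using that by (auto simp: artin_relations_def nodes_def)
    then have "(alternating (coxeter_matrix X i j) i j, alternating (coxeter_matrix X i j) j i)
        \<in> pres_rel nodes ?R"
      using that words by (intro pres_rel.relator) auto
    then have "pres_rel nodes ?R `` {alternating (coxeter_matrix X i j) i j}
        = pres_rel nodes ?R `` {alternating (coxeter_matrix X i j) j i}"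
      by (rule equiv_class_eq[OF equiv_pres_rel])
    then show ?thesis using that words by (simp add: Artin_class_eval)
  qed
  have sym: "coxeter_matrix X i j = coxeter_matrix X j i" by (auto simp: coxeter_matrix_def)
  show ?thesis
    using *[of i j] *[of j i] ij by (cases "i < j") (auto simp: sym)
qed

lemma Artin_commute:
  assumes "i \<in> nodes" "j \<in> nodes" "cartan i j = 0"
  shows "artin_gen X i \<otimes>\<^bsub>Artin\<^esub> artin_gen X j = artin_gen X j \<otimes>\<^bsub>Artin\<^esub> artin_gen X i"
proof -
  interpret group Artin by (rule group_Artin)
  have "i \<noteq> j" "coxeter_matrix X i j = 2"
    using assms by (auto simp: cartan_def coxeter_matrix_def split: if_splits)
  then show ?thesis
    using Artin_relation[OF assms(1,2)] artin_gen_closed assms by (simp add: numeral_2_eq_2)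
qed

lemma Artin_braid:
  assumes "i \<in> nodes" "j \<in> nodes" "cartan i j = - 1"
  shows "artin_gen X i \<otimes>\<^bsub>Artin\<^esub> (artin_gen X j \<otimes>\<^bsub>Artin\<^esub> artin_gen X i)
    = artin_gen X j \<otimes>\<^bsub>Artin\<^esub> (artin_gen X i \<otimes>\<^bsub>Artin\<^esub> artin_gen X j)"
proof -
  interpret group Artin by (rule group_Artin)
  have "i \<noteq> j" "coxeter_matrix X i j = 3"
    using assms by (auto simp: cartan_def coxeter_matrix_def split: if_splits)
  then show ?thesis
    using Artin_relation[OF assms(1,2)] artin_gen_closed assms by (simp add: numeral_3_eq_3)
qed

definition pos_word :: "nat list \<Rightarrow> nat word set" where
  "pos_word u = foldr (\<lambda>k y. artin_gen X k \<otimes>\<^bsub>Artin\<^esub> y) u \<one>\<^bsub>Artin\<^esub>"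

lemma pos_word_Nil [simp]: "pos_word [] = \<one>\<^bsub>Artin\<^esub>"
  and pos_word_Cons [simp]: "pos_word (k # u) = artin_gen X k \<otimes>\<^bsub>Artin\<^esub> pos_word u"
  by (simp_all add: pos_word_def)

lemma pos_word_closed: "u \<in> lists nodes \<Longrightarrow> pos_word u \<in> carrier Artin"
proof -
  interpret group Artin by (rule group_Artin)
  show "u \<in> lists nodes \<Longrightarrow> pos_word u \<in> carrier Artin"
    by (induction u) (auto simp: artin_gen_closed)
qed

lemma pos_word_append:
  assumes "u \<in> lists nodes" "v \<in> lists nodes"
  shows "pos_word (u @ v) = pos_word u \<otimes>\<^bsub>Artin\<^esub> pos_word v"
proof -
  interpret group Artin by (rule group_Artin)
  show ?thesis
    using assms(1)
  proof (induction u)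
    case (Cons k u)
    then show ?case
      using pos_word_closed[of u] pos_word_closed[OF assms(2)] artin_gen_closed[of k]
      by (auto simp: m_assoc)
  qed (use pos_word_closed[OF assms(2)] in simp)
qed

lemma simple_root_notin_act: "simple_root k \<notin> act k A"
  by (simp add: act_def)

text \<open>Induction on the length of \<open>u = s\<^sub>i c\<close>, for \<open>i \<noteq> k\<close>. For non-adjacent nodes, \<open>\<alpha>\<^sub>k\<close> is already
  missing from the set of \<open>c\<close>, so \<open>s\<^sub>k\<close> divides \<open>c\<close> and moves past \<open>s\<^sub>i\<close>. For adjacent nodes, \<open>\<alpha>\<^sub>k\<close>
  and \<open>\<alpha>\<^sub>i + \<alpha>\<^sub>k\<close> are both missing from the set of \<open>c\<close>: the former gives \<open>c = s\<^sub>k d\<close>, the latter then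
  says that \<open>\<alpha>\<^sub>i\<close> is missing from the set of \<open>d\<close>, so that \<open>d = s\<^sub>i e\<close> and
  \<open>u = s\<^sub>i s\<^sub>k s\<^sub>i e = s\<^sub>k s\<^sub>i s\<^sub>k e\<close>. The premise on equal group elements is needed because \<open>c\<close> and \<open>s\<^sub>k d\<close>
  are different words.\<close>
lemma left_divisor_if_notin_act:
  assumes inv: "\<And>u v. u \<in> lists nodes \<Longrightarrow> v \<in> lists nodes \<Longrightarrow> pos_word u = pos_word v \<Longrightarrow>
      foldr act u Pos = foldr act v Pos"
    and "u \<in> lists nodes" "k \<in> nodes" "simple_root k \<notin> foldr act u Pos"
  shows "\<exists>w\<in>lists nodes. length u = Suc (length w) \<and> pos_word u = artin_gen X k \<otimes>\<^bsub>Artin\<^esub> pos_word w"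
  using assms(2-)
proof (induction "length u" arbitrary: u k rule: less_induct)
  case less
  interpret group Artin by (rule group_Artin)
  note k = less.prems(2)
  show ?case
  proof (cases u)
    case Nil
    then show ?thesis using less.prems by simp
  next
    case (Cons i c)
    have i: "i \<in> nodes" and c: "c \<in> lists nodes" using less.prems(1) Cons by auto
    note closed = artin_gen_closed[OF i] artin_gen_closed[OF k]
    let ?A = "foldr act c Pos"
    have notin: "simple_root k \<notin> act i ?A" using less.prems(3) Cons by simp
    show ?thesis
    proof (cases "i = k")
      case True
      then show ?thesis using Cons c by auto
    next
      case False
      have IH: "\<exists>w\<in>lists nodes. length c = Suc (length w) \<and>
          pos_word c = artin_gen X k \<otimes>\<^bsub>Artin\<^esub> pos_word w" if "simple_root k \<notin> ?A"
        using Cons c k that by (intro less.hyps) auto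
      show ?thesis
      proof (cases "cartan i k = 0")
        case True
        then have "pair i (simple_root k) = 0" using i k by (simp add: pair_simple_root)
        then have "simple_root k \<notin> ?A"
          using notin k False by (auto simp: act_def)
        then obtain w where w: "w \<in> lists nodes" "length c = Suc (length w)"
          "pos_word c = artin_gen X k \<otimes>\<^bsub>Artin\<^esub> pos_word w" using IH by blast
        have "pos_word u = artin_gen X k \<otimes>\<^bsub>Artin\<^esub> pos_word (i # w)"
          using Artin_commute[OF i k True] closed pos_word_closed[OF w(1)]
          by (simp add: Cons w(3) m_assoc[symmetric])
        then show ?thesis using w i Cons by (intro bexI[of _ "i # w"]) auto
      next
        case cn: False
        then have ci: "cartan i k = - 1" "cartan k i = - 1"
          using cartan_cases[OF False] by (auto simp: cartan_commute[of k i])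
        let ?b = "refl i (simple_root k)"
        have b: "?b = refl k (simple_root i)" by (rule reflection_simple_root_adjacent[OF i k ci(1)])
        have p: "pair i (simple_root k) = - 1" "pair k (simple_root i) = - 1"
          using i k ci by (simp_all add: pair_simple_root)
        note bP = minus_1_Pos[OF i simple_root_Pos[OF k] p(1)]
        note bQ = minus_1_Pos[OF k simple_root_Pos[OF i] p(2), folded b]
        have notin2: "simple_root k \<notin> ?A" "?b \<notin> ?A"
          using notin k False p by (auto simp: act_def)
        obtain d where d: "d \<in> lists nodes" "length c = Suc (length d)"
          "pos_word c = artin_gen X k \<otimes>\<^bsub>Artin\<^esub> pos_word d" using IH[OF notin2(1)] by blast
        have "?A = act k (foldr act d Pos)"
          using inv[OF c, of "k # d"] d k by simp
        then have "simple_root i \<notin> foldr act d Pos"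
          using notin2(2) bQ reflection_reflection[OF k, of "simple_root i"] by (auto simp: act_def b)
        then obtain e where e: "e \<in> lists nodes" "length d = Suc (length e)"
          "pos_word d = artin_gen X i \<otimes>\<^bsub>Artin\<^esub> pos_word e"
          using less.hyps[OF _ d(1) i] d(2) Cons by auto
        have "pos_word u = (artin_gen X i \<otimes>\<^bsub>Artin\<^esub> (artin_gen X k \<otimes>\<^bsub>Artin\<^esub> artin_gen X i))
            \<otimes>\<^bsub>Artin\<^esub> pos_word e"
          using closed pos_word_closed[OF e(1)] by (simp add: Cons d(3) e(3) m_assoc)
        also have "\<dots> = artin_gen X k \<otimes>\<^bsub>Artin\<^esub> pos_word (i # k # e)"
          unfolding Artin_braid[OF i k ci(1)]
          using closed pos_word_closed[OF e(1)] by (simp add: m_assoc)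
        finally show ?thesis
          using e i k d(2) Cons by (intro bexI[of _ "i # k # e"]) auto
      qed
    qed
  qed
qed

text \<open>Injectivity on positive words follows by cancelling common left divisors. It extends to the
  whole group because every element is a fraction of two positive words: when a letter \<open>s\<^sub>k\<^sup>-\<^sup>1\<close> comes
  up, multiplication by the annihilating word from the right provides the factor \<open>s\<^sub>k\<close> that it
  cancels.\<close>
lemma injective_if_determines_supports:
  assumes "group G" and "\<psi> \<in> hom Artin G"
    and act_inv: "\<And>u v. u \<in> lists nodes \<Longrightarrow> v \<in> lists nodes \<Longrightarrow>
      \<psi> (pos_word u) = \<psi> (pos_word v) \<Longrightarrow> foldr act u Pos = foldr act v Pos"
  shows "inj_on \<psi> (carrier Artin)"
proof -
  interpret B: group Artin by (rule group_Artin)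
  interpret G: group G by fact
  interpret group_hom Artin G \<psi>
    using assms(2) by unfold_locales
  have left_divisor: "\<exists>w\<in>lists nodes. pos_word u = artin_gen X k \<otimes>\<^bsub>Artin\<^esub> pos_word w"
    if "u \<in> lists nodes" "k \<in> nodes" "simple_root k \<notin> foldr act u Pos" for u k
  proof -
    have "\<exists>w\<in>lists nodes. length u = Suc (length w) \<and>
        pos_word u = artin_gen X k \<otimes>\<^bsub>Artin\<^esub> pos_word w"
      by (rule left_divisor_if_notin_act[OF act_inv that]) simp_all
    then show ?thesis by blast
  qed
  have pos_inj: "pos_word u = pos_word v"
    if "u \<in> lists nodes" "v \<in> lists nodes" "\<psi> (pos_word u) = \<psi> (pos_word v)" for u v
    using that
  proof (induction u arbitrary: v)
    case Nil
    show ?case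
    proof (cases v)
      case (Cons k w)
      have eq: "foldr act [] Pos = foldr act v Pos" by (rule act_inv[OF _ Nil]) simp
      have "simple_root k \<notin> foldr act [] Pos"
        unfolding eq Cons by (simp add: simple_root_notin_act)
      then show ?thesis using Nil(1) Cons by simp
    qed simp
  next
    case (Cons k u)
    have eq: "foldr act (k # u) Pos = foldr act v Pos"
      using Cons.hyps by (intro act_inv[OF _ Cons.prems]) simp
    have "simple_root k \<notin> foldr act v Pos"
      unfolding eq[symmetric] by (simp add: simple_root_notin_act)
    then obtain w where w: "w \<in> lists nodes" "pos_word v = artin_gen X k \<otimes>\<^bsub>Artin\<^esub> pos_word w"
      using left_divisor Cons.prems(1) Cons.hyps(1) by blast
    have closed: "artin_gen X k \<in> carrier Artin" "pos_word u \<in> carrier Artin" "pos_word w \<in> carrier Artin"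
      using Cons.hyps w(1) by (simp_all add: artin_gen_closed pos_word_closed)
    then have "\<psi> (pos_word u) = \<psi> (pos_word w)"
      using Cons.prems(2) w(2) by simp
    then show ?case using Cons.IH[OF w(1)] w(2) by simp
  qed
  obtain \<Delta> where \<Delta>: "\<Delta> \<in> lists nodes" "foldr act \<Delta> Pos = {}"
    using exists_annihilating_word by blast
  have fraction: "\<exists>p\<in>lists nodes. \<exists>q\<in>lists nodes. eval_word Artin (artin_gen X) w \<otimes>\<^bsub>Artin\<^esub> pos_word q = pos_word p"
    if "w \<in> words nodes" for w
    using that
  proof (induction w)
    case Nil
    then show ?case by (intro bexI[of _ "[]"]) simp_all
  next
    case (Cons a w)
    obtain k e where a: "a = (k, e)" by (cases a)
    then have k: "k \<in> nodes" using Cons.hyps by simp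
    obtain p q where pq: "p \<in> lists nodes" "q \<in> lists nodes"
      "eval_word Artin (artin_gen X) w \<otimes>\<^bsub>Artin\<^esub> pos_word q = pos_word p" using Cons.IH by blast
    have w: "eval_word Artin (artin_gen X) w \<in> carrier Artin"
      using artin_gen_closed Cons.hyps by (intro eval_word_closed[OF group_Artin, where S = nodes]) auto
    note closed = w artin_gen_closed[OF k] pos_word_closed[OF pq(1)] pos_word_closed[OF pq(2)] pos_word_closed[OF \<Delta>(1)]
    show ?case
    proof (cases e)
      case True
      have "eval_word Artin (artin_gen X) (a # w) \<otimes>\<^bsub>Artin\<^esub> pos_word q = pos_word (k # p)"
        using closed by (simp add: a True B.m_assoc pq(3))
      then show ?thesis using pq k by (intro bexI[of _ "k # p"] bexI[of _ q]) auto
    next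
      case False
      have "foldr act (p @ \<Delta>) Pos = {}" by (simp add: \<Delta>(2) foldr_act_empty)
      then obtain u where u: "u \<in> lists nodes" "pos_word (p @ \<Delta>) = artin_gen X k \<otimes>\<^bsub>Artin\<^esub> pos_word u"
        using left_divisor[of "p @ \<Delta>" k] pq(1) \<Delta>(1) k by auto
      have "eval_word Artin (artin_gen X) w \<otimes>\<^bsub>Artin\<^esub> pos_word (q @ \<Delta>) = pos_word (p @ \<Delta>)"
        using closed pq \<Delta>(1) by (simp add: pos_word_append B.m_assoc[symmetric])
      then have "eval_word Artin (artin_gen X) (a # w) \<otimes>\<^bsub>Artin\<^esub> pos_word (q @ \<Delta>) = pos_word u"
        using closed pos_word_closed[OF u(1)] pos_word_closed[of "q @ \<Delta>"] pq(2) \<Delta>(1) u(2)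
        by (simp add: a False B.m_assoc) (simp add: B.m_assoc[symmetric])
      then show ?thesis using u(1) pq(2) \<Delta>(1) by (intro bexI[of _ u] bexI[of _ "q @ \<Delta>"]) auto
    qed
  qed
  have kernel: "x = \<one>\<^bsub>Artin\<^esub>" if x: "x \<in> carrier Artin" "\<psi> x = \<one>\<^bsub>G\<^esub>" for x
  proof -
    obtain w where w: "w \<in> words nodes" "x = eval_word Artin (artin_gen X) w"
      using x(1) Artin_class_eval unfolding artin_group_def carrier_presented_group
      by (auto simp: nodes_def elim!: quotientE)
    obtain p q where pq: "p \<in> lists nodes" "q \<in> lists nodes" "x \<otimes>\<^bsub>Artin\<^esub> pos_word q = pos_word p"
      using fraction[OF w(1)] w(2) by blast
    have closed: "pos_word p \<in> carrier Artin" "pos_word q \<in> carrier Artin"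
      using pq by (simp_all add: pos_word_closed)
    have "\<psi> (pos_word p) = \<psi> (x \<otimes>\<^bsub>Artin\<^esub> pos_word q)" by (simp only: pq(3))
    also have "\<dots> = \<psi> (pos_word q)" using x closed by simp
    finally have "\<psi> (pos_word p) = \<psi> (pos_word q)" .
    then have "pos_word p = pos_word q" by (rule pos_inj[OF pq(1,2)])
    then show ?thesis using pq(3) x(1) closed by (simp add: B.r_cancel_one)
  qed
  show ?thesis
  proof (rule inj_onI)
    fix x y assume xy: "x \<in> carrier Artin" "y \<in> carrier Artin" "\<psi> x = \<psi> y"
    then have "x \<otimes>\<^bsub>Artin\<^esub> inv\<^bsub>Artin\<^esub> y = \<one>\<^bsub>Artin\<^esub>" by (intro kernel) simp_all
    then have "inv\<^bsub>Artin\<^esub> (inv\<^bsub>Artin\<^esub> y) = x" using xy by (intro B.inv_equality) simp_all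
    then show "x = y" using xy by simp
  qed
qed

section \<open>Faithfulness of the specialised representation\<close>
lemma sigma_ring_hom:
  assumes add: "\<And>a b. h (a + b) = h a + h b" and mult: "\<And>a b. h (a * b) = h a * h b"
    and one: "h 1 = 1"
  shows "sigma (h r) (h t) (\<lambda>k x. h (\<phi> k x)) k (\<lambda>x. h (v x)) = (\<lambda>x. h (sigma r t \<phi> k v x))"
proof -
  have zero: "h 0 = 0" using add[of 0 0] by simp
  have sum: "h (\<Sum>b\<in>A. f b) = (\<Sum>b\<in>A. h (f b))" for f A
    by (induction A rule: infinite_finite_induct) (simp_all add: zero add)
  show ?thesis
    unfolding sigma_def tau_ring_hom[where h = h, OF add mult one]
    by (rule ext) (simp add: add mult one zero form_def sum unit_vec_def)
qed

lemma sigma_expand: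
  assumes k: "k \<in> nodes"
  shows "sigma r t \<phi> k f x = (\<Sum>b\<in>Pos. f b * sigma r t \<phi> k (\<lambda>y. if y = b then 1 else 0) x)"
proof -
  have "(\<Sum>b\<in>Pos. f b * (t * form (\<phi> k) (\<lambda>y. if y = b then 1 else 0) * unit_vec k x))
      = (\<Sum>b\<in>Pos. f b * (t * \<phi> k b * unit_vec k x))"
    using finite_Pos
    by (intro sum.cong) (simp_all add: form_def if_distrib[of "\<lambda>t. _ * t"] cong: if_cong)
  also have "\<dots> = t * form (\<phi> k) f * unit_vec k x"
    by (simp add: form_def sum_distrib_left mult_ac)
  finally show ?thesis
    unfolding sigma_def distrib_left sum.distrib tau_expand[OF k, of r f, symmetric] by simp
qed

lemma lookup_base_change_sigma_map:
  fixes h :: "laurent_rt \<Rightarrow> 's::comm_ring_1"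
  assumes add: "\<And>a b. h (a + b) = h a + h b" and mult: "\<And>a b. h (a * b) = h a * h b"
    and one: "h 1 = 1" and k: "k \<in> nodes" and v: "v \<in> free_mod Pos"
  shows "Poly_Mapping.lookup (base_change h Pos (sigma_map X T_poly k) v)
    = sigma (h var_r) (h var_t) (\<lambda>k x. h (T_laurent k x)) k (Poly_Mapping.lookup v)"
proof
  fix x
  have zero: "h 0 = 0" using add[of 0 0] by simp
  have "Poly_Mapping.lookup (base_change h Pos (sigma_map X T_poly k) v) x
      = (\<Sum>b\<in>Pos. Poly_Mapping.lookup v b
          * h (Poly_Mapping.lookup (sigma_map X T_poly k (bvec b)) x))"
    by (rule lookup_base_change[where h = h, OF finite_Pos zero v])
  also have "\<dots> = (\<Sum>b\<in>Pos. Poly_Mapping.lookup v b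
      * sigma (h var_r) (h var_t) (\<lambda>k x. h (T_laurent k x)) k (\<lambda>y. if y = b then 1 else 0) x)"
  proof (rule sum.cong[OF HOL.refl])
    fix b assume b: "b \<in> Pos"
    have "(\<lambda>y. if y = b then 1 else 0) = (\<lambda>y. h (Poly_Mapping.lookup (bvec b) y))"
      by (auto simp: lookup_single when_def zero one)
    then show "Poly_Mapping.lookup v b * h (Poly_Mapping.lookup (sigma_map X T_poly k (bvec b)) x)
      = Poly_Mapping.lookup v b
        * sigma (h var_r) (h var_t) (\<lambda>k x. h (T_laurent k x)) k (\<lambda>y. if y = b then 1 else 0) x"
      by (simp only: sigma_ring_hom[where h = h, OF add mult one]
          lookup_sigma_map[OF k bvec_free_mod[OF b]])
  qed
  also have "\<dots> = sigma (h var_r) (h var_t) (\<lambda>k x. h (T_laurent k x)) k (Poly_Mapping.lookup v) x"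
    by (rule sigma_expand[OF k, symmetric])
  finally show "Poly_Mapping.lookup (base_change h Pos (sigma_map X T_poly k) v) x
    = sigma (h var_r) (h var_t) (\<lambda>k x. h (T_laurent k x)) k (Poly_Mapping.lookup v) x" .
qed

lemma tau_coefficient:
  fixes v :: "root \<Rightarrow> laurent_t"
  shows "Poly_Mapping.lookup (tau (Poly_Mapping.single 0 r) k v x) j
    = tau r k (\<lambda>x. Poly_Mapping.lookup (v x) j) x"
proof -
  have "1 - Poly_Mapping.single 0 r ^ 2 = (Poly_Mapping.single 0 (1 - r ^ 2) :: laurent_t)"
    by (simp add: power2_eq_square mult_single single_diff flip: single_one)
  then show ?thesis
    by (simp add: tau_def lookup_single_0_mult lookup_add)
qed

text \<open>For vectors without negative powers of \<open>t\<close>, the rank one part of \<open>\<sigma>\<^sub>k\<close> carries a factor \<open>t\<close> and does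
  not contribute to the constant terms.\<close>
lemma sigma_coefficient:
  fixes v :: "root \<Rightarrow> laurent_t"
  assumes r: "0 < r\<^sub>0" and j: "j \<le> 0" and v: "\<And>x j. j < 0 \<Longrightarrow> Poly_Mapping.lookup (v x) j = 0"
  shows "Poly_Mapping.lookup (sigma (specialise r\<^sub>0 var_r) (specialise r\<^sub>0 var_t)
      (\<lambda>k x. specialise r\<^sub>0 (T_laurent k x)) k v x) j
    = tau r\<^sub>0 k (\<lambda>x. Poly_Mapping.lookup (v x) j) x"
proof -
  let ?\<phi> = "\<lambda>k x. specialise r\<^sub>0 (T_laurent k x)"
  have "\<exists>a. ?\<phi> k x = Poly_Mapping.single 0 a" for x
    unfolding T_laurent_def using r by (intro specialise_poly_in_r) simp
  then obtain a where a: "?\<phi> k x = Poly_Mapping.single 0 (a x)" for x by metis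
  have "Poly_Mapping.lookup (form (?\<phi> k) v) (j - 1) = 0"
    unfolding form_def a lookup_sum lookup_single_0_mult using v j by simp
  then have "Poly_Mapping.lookup (specialise r\<^sub>0 var_t * form (?\<phi> k) v * unit_vec k x) j = 0"
    by (simp add: specialise_var_t lookup_single_1_mult unit_vec_def)
  then show ?thesis
    by (simp add: sigma_def lookup_add tau_coefficient specialise_var_r)
qed

lemma specialised_rep_faithful:
  assumes \<rho>: "extends_sigma X T_poly \<rho>" and r: "0 < r\<^sub>0" "r\<^sub>0 < 1"
  shows "inj_on (specialised_rep X r\<^sub>0 \<rho>) (carrier Artin)"
proof -
  let ?\<psi> = "specialised_rep X r\<^sub>0 \<rho>"
  let ?G = "GL Pos :: ((root \<Rightarrow>\<^sub>0 laurent_t) \<Rightarrow> (root \<Rightarrow>\<^sub>0 laurent_t)) monoid"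
  interpret B: group Artin by (rule group_Artin)
  interpret G: group ?G by (rule group_GL)
  interpret group_hom Artin ?G ?\<psi>
    using specialised_rep_hom[OF \<rho> r(1)] by unfold_locales
  have "\<exists>v\<in>free_mod Pos. Poly_Mapping.lookup v = (\<lambda>x. if x \<in> Pos then 1 else 0 :: laurent_t)"
    by (rule free_mod_exists[OF finite_Pos]) simp
  then obtain v1 where v1: "v1 \<in> free_mod Pos"
    "Poly_Mapping.lookup v1 = (\<lambda>x. if x \<in> Pos then 1 else 0 :: laurent_t)" by blast
  have gen: "Poly_Mapping.lookup (?\<psi> (artin_gen X k) v) = sigma (specialise r\<^sub>0 var_r) (specialise r\<^sub>0 var_t)
      (\<lambda>k x. specialise r\<^sub>0 (T_laurent k x)) k (Poly_Mapping.lookup v)"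
    if "k \<in> nodes" "v \<in> free_mod Pos" for k v
  proof -
    have "\<rho> (artin_gen X k) = sigma_map X T_poly k"
      using \<rho> that(1) by (simp add: extends_sigma_def nodes_def)
    then show ?thesis
      unfolding specialised_rep_def using r that
      by (simp add: lookup_base_change_sigma_map specialise_add specialise_mult specialise_one)
  qed
  have inv: "?\<psi> (pos_word u) v1 \<in> free_mod Pos \<and>
      (\<forall>x j. j < 0 \<longrightarrow> Poly_Mapping.lookup (Poly_Mapping.lookup (?\<psi> (pos_word u) v1) x) j = 0) \<and>
      (\<forall>x. 0 \<le> Poly_Mapping.lookup (Poly_Mapping.lookup (?\<psi> (pos_word u) v1) x) 0) \<and>
      {x \<in> Pos. Poly_Mapping.lookup (Poly_Mapping.lookup (?\<psi> (pos_word u) v1) x) 0 \<noteq> 0} = foldr act u Pos"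
    if "u \<in> lists nodes" for u
    using that
  proof (induction u)
    case Nil
    have "?\<psi> (pos_word []) v1 = v1" using v1(1) by (simp add: GL_one)
    then show ?case using v1 by (simp add: lookup_one when_def)
  next
    case (Cons k u)
    let ?w = "?\<psi> (pos_word u) v1"
    have w: "?w \<in> free_mod Pos"
      "\<And>x j. j < 0 \<Longrightarrow> Poly_Mapping.lookup (Poly_Mapping.lookup ?w x) j = 0"
      "\<And>x. 0 \<le> Poly_Mapping.lookup (Poly_Mapping.lookup ?w x) 0"
      "{x \<in> Pos. Poly_Mapping.lookup (Poly_Mapping.lookup ?w x) 0 \<noteq> 0} = foldr act u Pos"
      using Cons.IH by blast+
    have closed: "artin_gen X k \<in> carrier Artin" "pos_word u \<in> carrier Artin"
      using Cons.hyps by (simp_all add: artin_gen_closed pos_word_closed)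
    have step: "?\<psi> (pos_word (k # u)) v1 = ?\<psi> (artin_gen X k) ?w"
      using closed v1(1) by (simp add: GL_mult compose_eq)
    have coeff: "Poly_Mapping.lookup (Poly_Mapping.lookup (?\<psi> (artin_gen X k) ?w) x) j
        = tau r\<^sub>0 k (\<lambda>x. Poly_Mapping.lookup (Poly_Mapping.lookup ?w x) j) x" if "j \<le> 0" for x j
      unfolding gen[OF Cons.hyps(1) w(1)] by (rule sigma_coefficient[OF r(1) that w(2)])
    show ?case
      unfolding step
    proof (intro conjI allI impI)
      show "?\<psi> (artin_gen X k) ?w \<in> free_mod Pos"
        by (rule GL_closed[OF hom_closed[OF closed(1)] w(1)])
      fix x and j :: int assume "j < 0"
      then show "Poly_Mapping.lookup (Poly_Mapping.lookup (?\<psi> (artin_gen X k) ?w) x) j = 0"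
        by (simp add: coeff w(2) tau_def)
    next
      show "0 \<le> Poly_Mapping.lookup (Poly_Mapping.lookup (?\<psi> (artin_gen X k) ?w) x) 0" for x
        unfolding coeff[OF order_refl] by (rule tau_nonneg_support(1)[OF r Cons.hyps(1) w(3)])
      show "{x \<in> Pos. Poly_Mapping.lookup (Poly_Mapping.lookup (?\<psi> (artin_gen X k) ?w) x) 0 \<noteq> 0}
          = foldr act (k # u) Pos"
        unfolding coeff[OF order_refl] tau_nonneg_support(2)[OF r Cons.hyps(1) w(3)] w(4) by simp
    qed
  qed
  show ?thesis
  proof (rule injective_if_determines_supports[OF group_GL specialised_rep_hom[OF \<rho> r(1)]])
    fix u v assume "u \<in> lists nodes" "v \<in> lists nodes" "?\<psi> (pos_word u) = ?\<psi> (pos_word v)"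
    then show "foldr act u Pos = foldr act v Pos"
      using inv[of u] inv[of v] by simp
  qed
qed

end

theorem theorem1p2:
  fixes X :: ade
  assumes "valid_ade X"
  shows "\<exists>T :: nat \<Rightarrow> root \<Rightarrow> int poly.
    (\<exists>!\<rho>. extends_sigma X T \<rho>) \<and>
    (\<forall>\<rho> r\<^sub>0. extends_sigma X T \<rho> \<and> 0 < r\<^sub>0 \<and> r\<^sub>0 < 1 \<longrightarrow>
       specialised_rep X r\<^sub>0 \<rho> \<in> hom (artin_group X) (GL (pos_roots X)) \<and>
       inj_on (specialised_rep X r\<^sub>0 \<rho>) (carrier (artin_group X)))"
proof -
  interpret ade_system X by unfold_locales fact
  show ?thesis
    using extends_sigma_unique_ex specialised_rep_hom specialised_rep_faithful
    by (intro exI[of _ T_poly] conjI allI impI) auto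
qed

end
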